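(* Let $(X,d)$ be a separable ultra-metric space in which all closed balls are compact, let $\mu$ be a Radon measure on $X$ with full support, let $\sigma$ be a distance distribution function, and let $\mathcal{L}$ be the isotropic Laplacian associated with $(d,\mu,\sigma)$. Let $\Lambda=\{d_*(x,y):x,y\in X,\ x\ne y\}$. Then the spectrum of $\mathcal{L}$ is pure point (i.e. $\mathcal{L}$ has a complete system of eigenfunctions in $L^2(X,\mu)$) and $$\operatorname{spec}\mathcal{L}=\overline{\left\{\tfrac1r:r\in\Lambda\right\}}\cup\{0\}.$$ The space $L^2(X,\mu)$ decomposes into an orthogonal sum of finite-dimensional (subspaces of) eigenspaces of $\mathcal{L}$ as follows: if $\mu(X)=\infty$ then $$L^2(X,\mu)=\bigoplus_{\rho(B)>0}\mathcal{H}_B,$$ and if $\mu(X)<\infty$ then $$L^2(X,\mu)=\{\mathrm{const}\}\oplus\bigoplus_{\rho(B)>0}\mathcal{H}_B,$$ where $B$ runs over all balls in $X$ with $\rho(B)>0$.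
   Context: Closed balls: $B_r(x)=\{y:d(x,y)\le r\}$; $\mathrm{Q}_rf(x)=\frac1{\mu(B_r(x))}\int_{B_r(x)}f\,d\mu$. A distance distribution function is a strictly increasing left-continuous function $\sigma:[0,\infty]\to[0,1]$ with $\sigma(0+)=0$, $\sigma(\infty)=1$. The isotropic Markov operator associated with $(d,\mu,\sigma)$ is $P=\int_{[0,\infty)}\mathrm{Q}_r\,d\sigma(r)$, self-adjoint in $L^2(X,\mu)$ with spectrum in $[0,1]$; the isotropic Laplacian is the non-negative definite self-adjoint operator $\mathcal{L}=\log\frac1P$ (functional calculus), so that $P^t=\exp(-t\mathcal{L})$. Intrinsic ultra-metric: $\frac1{d_*(x,y)}=\log\frac1{\sigma(d(x,y))}$ (with $d_*(x,x)=0$); it determines the same set of balls as $d$. For a ball $B$ (regarded as a set), $\rho(B)$ is its minimal $d_*$-radius, i.e. the smallest $r\ge0$ with $B=\{y:d_*(x,y)\le r\}$ for $x\in B$. For balls $C\subset B$, $C$ is a child of $B$ (written $C\prec B$) if $C\ne B$ and any ball $A$ with $C\subset A\subset B$ equals $C$ or $B$. If $\rho(B)>0$, then $B$ has finitely many, and at least two, children; they are disjoint with union $B$ and have positive measure. For such $B$, $$\mathcal{H}_B=\operatorname{span}\{f_C:C\prec B\},\qquad f_C=\frac1{\mu(C)}\mathbf{1}_C-\frac1{\mu(B)}\mathbf{1}_B,$$ whose non-zero elements are eigenfunctions of $\mathcal{L}$ with eigenvalue $1/\rho(B)$. *)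

theory Defs
  imports "HOL-Analysis.Analysis"
begin

section \<open>The space of square-integrable functions\<close>

text \<open>
  Elements of \<open>L\<^sup>2\<close> are represented by functions; equality in \<open>L\<^sup>2\<close> is equality almost everywhere,
  and every notion below is invariant under changes on null sets.
\<close>

definition l2 :: "'a measure \<Rightarrow> ('a \<Rightarrow> complex) set" where
  "l2 M = {f. f \<in> borel_measurable M \<and> integrable M (\<lambda>x. (cmod (f x))\<^sup>2)}"

definition l2_inner :: "'a measure \<Rightarrow> ('a \<Rightarrow> complex) \<Rightarrow> ('a \<Rightarrow> complex) \<Rightarrow> complex" where
  "l2_inner M f g = (LINT x|M. f x * cnj (g x))"

definition l2_norm :: "'a measure \<Rightarrow> ('a \<Rightarrow> complex) \<Rightarrow> real" where
  "l2_norm M f = sqrt (LINT x|M. (cmod (f x))\<^sup>2)"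

definition lspan :: "('a \<Rightarrow> complex) set \<Rightarrow> ('a \<Rightarrow> complex) set" where
  "lspan S = {\<lambda>x. \<Sum>h\<in>T. a h * h x | T a. finite T \<and> T \<subseteq> S}"

definition finite_dimensional :: "('a \<Rightarrow> complex) set \<Rightarrow> bool" where
  "finite_dimensional V \<longleftrightarrow> (\<exists>S. finite S \<and> V = lspan S)"

definition orthonormal_set :: "'a measure \<Rightarrow> ('a \<Rightarrow> complex) set \<Rightarrow> bool" where
  "orthonormal_set M S \<longleftrightarrow> S \<subseteq> l2 M \<and> (\<forall>f\<in>S. \<forall>g\<in>S. l2_inner M f g = (if f = g then 1 else 0))"

definition l2_total :: "'a measure \<Rightarrow> ('a \<Rightarrow> complex) set \<Rightarrow> bool" where
  "l2_total M S \<longleftrightarrow> S \<subseteq> l2 M \<and>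
     (\<forall>f\<in>l2 M. \<forall>e>0. \<exists>g\<in>lspan S. l2_norm M (\<lambda>x. f x - g x) < e)"

text \<open>Hilbert direct sum: the series of components converges unconditionally in \<open>L\<^sup>2\<close>; uniqueness of
  the components follows from orthogonality.\<close>

definition orthogonal_sum_decomposition ::
    "'a measure \<Rightarrow> 'i set \<Rightarrow> ('i \<Rightarrow> ('a \<Rightarrow> complex) set) \<Rightarrow> bool" where
  "orthogonal_sum_decomposition M I H \<longleftrightarrow>
     (\<forall>i\<in>I. H i \<subseteq> l2 M) \<and>
     (\<forall>i\<in>I. \<forall>j\<in>I. i \<noteq> j \<longrightarrow> (\<forall>f\<in>H i. \<forall>g\<in>H j. l2_inner M f g = 0)) \<and>
     (\<forall>f\<in>l2 M. \<exists>g. (\<forall>i\<in>I. g i \<in> H i) \<and>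
        ((\<lambda>J. l2_norm M (\<lambda>x. f x - (\<Sum>i\<in>J. g i x))) \<longlongrightarrow> 0) (finite_subsets_at_top I))"


section \<open>Operators in \<open>L\<^sup>2\<close>\<close>

text \<open>Possibly unbounded operators are given by their graphs: \<open>A f g\<close> means that \<open>f\<close> is in the
  domain and \<open>A f = g\<close> almost everywhere.\<close>

type_synonym 'a l2_operator = "('a \<Rightarrow> complex) \<Rightarrow> ('a \<Rightarrow> complex) \<Rightarrow> bool"

definition graph_of :: "'a measure \<Rightarrow> (('a \<Rightarrow> complex) \<Rightarrow> 'a \<Rightarrow> complex) \<Rightarrow> 'a l2_operator" where
  "graph_of M T f g \<longleftrightarrow> f \<in> l2 M \<and> g \<in> l2 M \<and> (AE x in M. g x = T f x)"

definition bounded_operator :: "'a measure \<Rightarrow> (('a \<Rightarrow> complex) \<Rightarrow> 'a \<Rightarrow> complex) \<Rightarrow> bool" where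
  "bounded_operator M T \<longleftrightarrow>
     (\<forall>f\<in>l2 M. T f \<in> l2 M) \<and>
     (\<forall>f\<in>l2 M. \<forall>g\<in>l2 M. \<forall>a b.
        AE x in M. T (\<lambda>y. a * f y + b * g y) x = a * T f x + b * T g x) \<and>
     (\<exists>K. \<forall>f\<in>l2 M. l2_norm M (T f) \<le> K * l2_norm M f)"

definition eigenspace :: "'a measure \<Rightarrow> 'a l2_operator \<Rightarrow> complex \<Rightarrow> ('a \<Rightarrow> complex) set" where
  "eigenspace M A z = {f \<in> l2 M. A f (\<lambda>x. z * f x)}"

definition eigenfunction :: "'a measure \<Rightarrow> 'a l2_operator \<Rightarrow> ('a \<Rightarrow> complex) \<Rightarrow> bool" where
  "eigenfunction M A f \<longleftrightarrow> \<not> (AE x in M. f x = 0) \<and> (\<exists>z. f \<in> eigenspace M A z)"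

text \<open>A point \<open>z\<close> is in the resolvent set if \<open>A - z\<close> has an everywhere defined bounded two-sided
  inverse \<open>R\<close>.\<close>

definition resolvent_set :: "'a measure \<Rightarrow> 'a l2_operator \<Rightarrow> complex set" where
  "resolvent_set M A = {z. \<exists>R. bounded_operator M R \<and>
     (\<forall>h\<in>l2 M. A (R h) (\<lambda>x. h x + z * R h x)) \<and>
     (\<forall>f g. A f g \<longrightarrow> (AE x in M. R (\<lambda>y. g y - z * f y) x = f x))}"

definition spectrum :: "'a measure \<Rightarrow> 'a l2_operator \<Rightarrow> complex set" where
  "spectrum M A = - resolvent_set M A"

definition pure_point_spectrum :: "'a measure \<Rightarrow> 'a l2_operator \<Rightarrow> bool" where
  "pure_point_spectrum M A \<longleftrightarrow>
     (\<exists>S. orthonormal_set M S \<and> l2_total M S \<and> (\<forall>f\<in>S. eigenfunction M A f))"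


section \<open>Functional calculus\<close>

definition orthogonal_projection :: "'a measure \<Rightarrow> (('a \<Rightarrow> complex) \<Rightarrow> 'a \<Rightarrow> complex) \<Rightarrow> bool" where
  "orthogonal_projection M T \<longleftrightarrow> bounded_operator M T \<and>
     (\<forall>f\<in>l2 M. AE x in M. T (T f) x = T f x) \<and>
     (\<forall>f\<in>l2 M. \<forall>g\<in>l2 M. l2_inner M (T f) g = l2_inner M f (T g))"

definition projection_valued_measure ::
    "'a measure \<Rightarrow> (real set \<Rightarrow> ('a \<Rightarrow> complex) \<Rightarrow> 'a \<Rightarrow> complex) \<Rightarrow> bool" where
  "projection_valued_measure M E \<longleftrightarrow>
     (\<forall>S\<in>sets borel. orthogonal_projection M (E S)) \<and>
     (\<forall>f\<in>l2 M. AE x in M. E UNIV f x = f x) \<and>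
     (\<forall>S\<in>sets borel. \<forall>T\<in>sets borel. \<forall>f\<in>l2 M. AE x in M. E (S \<inter> T) f x = E S (E T f) x) \<and>
     (\<forall>S. range S \<subseteq> sets borel \<longrightarrow> disjoint_family S \<longrightarrow> (\<forall>f\<in>l2 M.
        (\<lambda>n. l2_norm M (\<lambda>x. E (\<Union>i. S i) f x - (\<Sum>i<n. E (S i) f x))) \<longlonglongrightarrow> 0))"

text \<open>The measure \<open>d\<langle>E f, f\<rangle>\<close>.\<close>

definition scalar_spectral_measure ::
    "'a measure \<Rightarrow> (real set \<Rightarrow> ('a \<Rightarrow> complex) \<Rightarrow> 'a \<Rightarrow> complex) \<Rightarrow> ('a \<Rightarrow> complex) \<Rightarrow> real measure" where
  "scalar_spectral_measure M E f =
     measure_of UNIV (sets borel) (\<lambda>S. ennreal (Re (l2_inner M (E S f) f)))"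

text \<open>
  The operator \<open>\<integral> \<phi> dE\<close> with domain \<open>{f. \<integral> \<phi>\<^sup>2 d\<langle>E f, f\<rangle> < \<infinity>}\<close>: for a simple function \<open>s\<close> one has
  \<open>(\<integral> s dE) f = \<Sum>y. y E(s = y) f\<close>, with norm the \<open>L\<^sup>2\<close>-norm of \<open>s\<close> with respect to \<open>d\<langle>E f, f\<rangle>\<close>;
  the general case is the extension of this isometry by density.
\<close>

definition spectral_integral ::
    "'a measure \<Rightarrow> (real set \<Rightarrow> ('a \<Rightarrow> complex) \<Rightarrow> 'a \<Rightarrow> complex) \<Rightarrow> (real \<Rightarrow> real) \<Rightarrow> 'a l2_operator" where
  "spectral_integral M E \<phi> f g \<longleftrightarrow>
     f \<in> l2 M \<and> g \<in> l2 M \<and> \<phi> \<in> borel_measurable borel \<and>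
     (\<integral>\<^sup>+t. ennreal ((\<phi> t)\<^sup>2) \<partial>scalar_spectral_measure M E f) < \<infinity> \<and>
     (\<exists>s :: nat \<Rightarrow> real \<Rightarrow> real.
        (\<forall>n. simple_function borel (s n)) \<and>
        (\<lambda>n. \<integral>\<^sup>+t. ennreal ((s n t - \<phi> t)\<^sup>2) \<partial>scalar_spectral_measure M E f) \<longlonglongrightarrow> 0 \<and>
        (\<lambda>n. l2_norm M (\<lambda>x.
           (\<Sum>y\<in>range (s n). complex_of_real y * E (s n -` {y}) f x) - g x)) \<longlonglongrightarrow> 0)"

definition is_spectral_measure_of ::
    "'a measure \<Rightarrow> 'a l2_operator \<Rightarrow> (real set \<Rightarrow> ('a \<Rightarrow> complex) \<Rightarrow> 'a \<Rightarrow> complex) \<Rightarrow> bool" where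
  "is_spectral_measure_of M A E \<longleftrightarrow> projection_valued_measure M E \<and>
     (\<forall>f g. A f g \<longleftrightarrow> spectral_integral M E (\<lambda>t. t) f g)"

text \<open>By the spectral theorem, a self-adjoint operator has a spectral measure, unique up to equality
  almost everywhere; the choice below is thus immaterial.\<close>

definition functional_calculus :: "'a measure \<Rightarrow> (real \<Rightarrow> real) \<Rightarrow> 'a l2_operator \<Rightarrow> 'a l2_operator" where
  "functional_calculus M \<phi> A = spectral_integral M (SOME E. is_spectral_measure_of M A E) \<phi>"


section \<open>Isotropic Markov operator and Laplacian\<close>

text \<open>Radon measures on a (locally compact Hausdorff) space.\<close>

definition radon_measure :: "'a::topological_space measure \<Rightarrow> bool" where
  "radon_measure M \<longleftrightarrow> sets M = sets borel \<and>
     (\<forall>K. compact K \<longrightarrow> emeasure M K < \<infinity>) \<and>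
     (\<forall>A\<in>sets borel. emeasure M A = (INF U\<in>{U. open U \<and> A \<subseteq> U}. emeasure M U)) \<and>
     (\<forall>U. open U \<longrightarrow> emeasure M U = (SUP K\<in>{K. compact K \<and> K \<subseteq> U}. emeasure M K))"

definition full_support :: "'a::topological_space measure \<Rightarrow> bool" where
  "full_support M \<longleftrightarrow> (\<forall>U. open U \<and> U \<noteq> {} \<longrightarrow> emeasure M U > 0)"

definition distance_distribution :: "(ennreal \<Rightarrow> real) \<Rightarrow> bool" where
  "distance_distribution \<sigma> \<longleftrightarrow>
     range \<sigma> \<subseteq> {0..1} \<and> strict_mono \<sigma> \<and> (\<forall>t. (\<sigma> \<longlongrightarrow> \<sigma> t) (at_left t)) \<and>
     (\<sigma> \<longlongrightarrow> 0) (at_right 0) \<and> \<sigma> \<infinity> = 1"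

text \<open>
  The Stieltjes measure \<open>d\<sigma>\<close>, for which \<open>[a, b)\<close> has mass \<open>\<sigma>(b) - \<sigma>(a)\<close>. Since \<open>interval_measure\<close>
  expects a right-continuous function, it is applied to \<open>r \<mapsto> \<sigma>(r+)\<close>; this function is \<open>0\<close> for
  \<open>r < 0\<close>, as \<open>ennreal s = 0\<close> for \<open>s \<le> 0\<close> and \<open>\<sigma> 0 = 0\<close>.
\<close>

definition stieltjes :: "(ennreal \<Rightarrow> real) \<Rightarrow> real measure" where
  "stieltjes \<sigma> = interval_measure (\<lambda>r. INF s\<in>{r<..}. \<sigma> (ennreal s))"

definition ball_average :: "'a::metric_space measure \<Rightarrow> real \<Rightarrow> ('a \<Rightarrow> complex) \<Rightarrow> 'a \<Rightarrow> complex" where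
  "ball_average M r f x = (1 / measure M (cball x r)) *\<^sub>R (LINT y:cball x r|M. f y)"

definition markov_operator ::
    "'a::metric_space measure \<Rightarrow> (ennreal \<Rightarrow> real) \<Rightarrow> ('a \<Rightarrow> complex) \<Rightarrow> 'a \<Rightarrow> complex" where
  "markov_operator M \<sigma> f x = (LINT r:{0..}|stieltjes \<sigma>. ball_average M r f x)"

text \<open>The value of \<open>ln (1 / s)\<close> at \<open>s = 0\<close> (here \<open>0\<close> instead of \<open>\<infinity>\<close>) plays no role, since \<open>0\<close> is not
  an eigenvalue of the Markov operator.\<close>

definition isotropic_laplacian ::
    "'a::metric_space measure \<Rightarrow> (ennreal \<Rightarrow> real) \<Rightarrow> 'a l2_operator" where
  "isotropic_laplacian M \<sigma> =
     functional_calculus M (\<lambda>s. ln (1 / s)) (graph_of M (markov_operator M \<sigma>))"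


section \<open>Intrinsic ultra-metric and balls\<close>

definition intrinsic_dist :: "(ennreal \<Rightarrow> real) \<Rightarrow> 'a::metric_space \<Rightarrow> 'a \<Rightarrow> real" where
  "intrinsic_dist \<sigma> x y = (if x = y then 0 else 1 / ln (1 / \<sigma> (ennreal (dist x y))))"

definition is_ball :: "'a::metric_space set \<Rightarrow> bool" where
  "is_ball B \<longleftrightarrow> (\<exists>x r. 0 \<le> r \<and> B = cball x r)"

definition intrinsic_radius :: "(ennreal \<Rightarrow> real) \<Rightarrow> 'a::metric_space set \<Rightarrow> real" where
  "intrinsic_radius \<sigma> B = (LEAST r. 0 \<le> r \<and> (\<forall>x\<in>B. B = {y. intrinsic_dist \<sigma> x y \<le> r}))"

definition child_ball :: "'a::metric_space set \<Rightarrow> 'a set \<Rightarrow> bool" where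
  "child_ball C B \<longleftrightarrow> is_ball C \<and> is_ball B \<and> C \<subset> B \<and>
     (\<forall>A. is_ball A \<and> C \<subseteq> A \<and> A \<subseteq> B \<longrightarrow> A = C \<or> A = B)"

definition child_function :: "'a measure \<Rightarrow> 'a set \<Rightarrow> 'a set \<Rightarrow> 'a \<Rightarrow> complex" where
  "child_function M B C x =
     complex_of_real (indicator C x / measure M C - indicator B x / measure M B)"

definition ball_space :: "'a::metric_space measure \<Rightarrow> 'a set \<Rightarrow> ('a \<Rightarrow> complex) set" where
  "ball_space M B = lspan {child_function M B C | C. child_ball C B}"

end

theory Submission
  imports Defs
begin

text \<open>
  If \<open>f\<close> is orthogonal to \<open>ball_space \<mu> B\<close>, then \<open>f\<close> has the same average over \<open>B\<close> and over each child
  of \<open>B\<close>. Any two balls of positive radius lie in a common ball and are linked to it by a finite chain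
  of children, so a function orthogonal to all these spaces has one and the same average over every
  ball. Balls generate the Borel sets, hence the function is constant; if \<open>\<mu>\<close> is infinite, then the
  Cauchy-Schwarz inequality on large balls forces the constant to be \<open>0\<close>.

  On \<open>ball_space \<mu> B\<close> the average over balls of radius \<open>r\<close> is the identity if \<open>r\<close> is less than the
  diameter of \<open>B\<close> and \<open>0\<close> otherwise. Hence the Markov operator is multiplication by the mass that
  \<open>\<sigma>\<close> gives to the radii below the diameter, which is \<open>exp (- 1 / \<rho>(B))\<close>. Being a contraction of
  \<open>L\<^sup>2\<close>, the Markov operator is diagonal in every orthonormal basis adapted to these spaces.

  A spectral measure \<open>E\<close> of a diagonal operator is determined by the eigenvalues: for an
  eigenfunction \<open>f\<close> with eigenvalue \<open>a\<close>, the integral of \<open>(t - a)\<^sup>2\<close> with respect to \<open>d\<langle>E f, f\<rangle>\<close>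
  vanishes, so \<open>E(T) f\<close> is \<open>f\<close> or \<open>0\<close> according to whether \<open>a \<in> T\<close>. The functional calculus therefore
  just applies the function to the eigenvalues, and the spectrum of the result is the closure of the
  new eigenvalues. If \<open>\<mu>\<close> is infinite, then the space is unbounded and \<open>0\<close> is a limit of the
  \<open>1 / d\<^sub>*(x, y)\<close>; if \<open>\<mu>\<close> is finite, then \<open>0\<close> is the eigenvalue of the constants.
\<close>

section \<open>Square-integrable functions\<close>

text \<open>\<open>functional_calculus\<close> uses a spectral measure picked by
  \<open>SOME\<close>. So one spectral measure has to be built explicitly, or the choice would mean
  nothing, and every other one has to be controlled. Describing operators by coefficients in an
  orthonormal basis makes both possible: countable additivity and convergence become statements
  about counting measure on the basis, where dominated convergence is available.

  The child functions of a ball are linearly dependent, since the sum of all \<mu>(C) f_C vanishes.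
  The basis is therefore extracted by Gram-Schmidt, and spans only up to null sets, as functions
  stand for their classes.

  The geometry rests on writing a ball of positive intrinsic radius as
  \<open>cball x (dist x y)\<close> with x and y distinct. Compactness makes the radius an attained
  distance, the children are then the open balls of that same radius, and left-continuity of
  \<sigma> gives the radii strictly below it exactly the mass
  \<open>\<sigma> (ennreal (dist x y))\<close>.\<close>

lemma l2_iff_nn_integral:
  "f \<in> l2 M \<longleftrightarrow> f \<in> borel_measurable M \<and> (\<integral>\<^sup>+x. ennreal ((cmod (f x))\<^sup>2) \<partial>M) < \<infinity>"
  unfolding l2_def by (auto simp: integrable_iff_bounded)

lemma l2_measurable: "f \<in> l2 M \<Longrightarrow> f \<in> borel_measurable M"
  by (simp add: l2_def)

lemma l2_norm_nonneg [simp]: "0 \<le> l2_norm M f"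
  by (simp add: l2_norm_def)

lemma l2_norm_squared: "(l2_norm M f)\<^sup>2 = (LINT x|M. (cmod (f x))\<^sup>2)"
  by (simp add: l2_norm_def)

lemma nn_integral_l2:
  "f \<in> l2 M \<Longrightarrow> (\<integral>\<^sup>+x. ennreal ((cmod (f x))\<^sup>2) \<partial>M) = ennreal ((l2_norm M f)\<^sup>2)"
  unfolding l2_norm_squared by (rule nn_integral_eq_integral) (auto simp: l2_def)

lemma cmod_add_squared_le: "(cmod (a + b))\<^sup>2 \<le> 2 * (cmod a)\<^sup>2 + 2 * (cmod b)\<^sup>2"
proof -
  have "(cmod (a + b))\<^sup>2 \<le> (cmod a + cmod b)\<^sup>2"
    by (intro power_mono norm_triangle_ineq) auto
  also have "\<dots> \<le> 2 * (cmod a)\<^sup>2 + 2 * (cmod b)\<^sup>2"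
    using sum_squares_bound[of "cmod a" "cmod b"] by (simp add: power2_sum)
  finally show ?thesis .
qed

lemma l2_add: assumes "f \<in> l2 M" "g \<in> l2 M" shows "(\<lambda>x. f x + g x) \<in> l2 M"
proof -
  have [measurable]: "f \<in> borel_measurable M" "g \<in> borel_measurable M"
    using assms by (auto simp: l2_def)
  have "integrable M (\<lambda>x. 2 * (cmod (f x))\<^sup>2 + 2 * (cmod (g x))\<^sup>2)"
    using assms by (auto simp: l2_def)
  then have "integrable M (\<lambda>x. (cmod (f x + g x))\<^sup>2)"
    by (rule Bochner_Integration.integrable_bound) (auto simp: cmod_add_squared_le)
  then show ?thesis by (simp add: l2_def)
qed

lemma l2_scale: assumes "f \<in> l2 M" shows "(\<lambda>x. a * f x) \<in> l2 M"
  using assms by (auto simp: l2_def norm_mult power_mult_distrib)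

lemma l2_diff: assumes "f \<in> l2 M" "g \<in> l2 M" shows "(\<lambda>x. f x - g x) \<in> l2 M"
  using l2_add[OF assms(1) l2_scale[OF assms(2), of "-1"]] by simp

lemma l2_zero [simp]: "(\<lambda>x. 0) \<in> l2 M"
  by (simp add: l2_def)

lemma l2_sum: assumes "\<And>i. i \<in> F \<Longrightarrow> f i \<in> l2 M" shows "(\<lambda>x. \<Sum>i\<in>F. f i x) \<in> l2 M"
  using assms by (induction F rule: infinite_finite_induct) (auto intro: l2_add)

section \<open>Inner product, norm and the Cauchy-Schwarz inequality\<close>

lemma l2_inner_integrable:
  assumes "f \<in> l2 M" "g \<in> l2 M" shows "integrable M (\<lambda>x. f x * cnj (g x))"
proof -
  have [measurable]: "f \<in> borel_measurable M" "g \<in> borel_measurable M"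
    using assms by (auto simp: l2_def)
  have [measurable]: "(\<lambda>x. cnj (g x)) \<in> borel_measurable M"
    by (rule borel_measurable_continuous_onI[THEN measurable_compose_rev]) (auto intro!: continuous_intros)
  have b: "cmod a * cmod b \<le> (cmod a)\<^sup>2 + (cmod b)\<^sup>2" for a b
  proof -
    have "0 \<le> cmod a * cmod b" by simp
    then show ?thesis using sum_squares_bound[of "cmod a" "cmod b"] unfolding mult.assoc by linarith
  qed
  have "integrable M (\<lambda>x. (cmod (f x))\<^sup>2 + (cmod (g x))\<^sup>2)"
    using assms by (auto simp: l2_def)
  then show ?thesis
    by (rule Bochner_Integration.integrable_bound) (auto simp: norm_mult b)
qed

lemma l2_inner_add_left:
  "f \<in> l2 M \<Longrightarrow> g \<in> l2 M \<Longrightarrow> h \<in> l2 M \<Longrightarrow>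
   l2_inner M (\<lambda>x. f x + g x) h = l2_inner M f h + l2_inner M g h"
  unfolding l2_inner_def
  by (simp add: distrib_right Bochner_Integration.integral_add l2_inner_integrable)

lemma l2_inner_scale_left: "l2_inner M (\<lambda>x. a * f x) h = a * l2_inner M f h"
  unfolding l2_inner_def by (simp add: mult.assoc)

lemma l2_inner_cnj: "l2_inner M g f = cnj (l2_inner M f g)"
proof -
  have "l2_inner M g f = (LINT x|M. cnj (f x * cnj (g x)))"
    unfolding l2_inner_def by (simp add: mult.commute)
  also have "\<dots> = cnj (l2_inner M f g)"
    unfolding l2_inner_def by (rule Bochner_Integration.integral_cnj)
  finally show ?thesis .
qed

lemma l2_inner_scale_right: "l2_inner M f (\<lambda>x. a * h x) = cnj a * l2_inner M f h"
  by (subst (1 2) l2_inner_cnj) (simp add: l2_inner_scale_left)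

lemma l2_inner_zero [simp]: "l2_inner M (\<lambda>x. 0) h = 0" "l2_inner M h (\<lambda>x. 0) = 0"
  by (simp_all add: l2_inner_def)

lemma l2_inner_diff_left:
  "f \<in> l2 M \<Longrightarrow> g \<in> l2 M \<Longrightarrow> h \<in> l2 M \<Longrightarrow>
   l2_inner M (\<lambda>x. f x - g x) h = l2_inner M f h - l2_inner M g h"
  using l2_inner_add_left[OF _ l2_scale[of g M "-1"], of f h] l2_inner_scale_left[of M "-1" g h] by simp

lemma l2_inner_add_right:
  "f \<in> l2 M \<Longrightarrow> g \<in> l2 M \<Longrightarrow> h \<in> l2 M \<Longrightarrow>
   l2_inner M h (\<lambda>x. f x + g x) = l2_inner M h f + l2_inner M h g"
  by (subst (1 2 3) l2_inner_cnj) (simp add: l2_inner_add_left)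

lemma l2_inner_diff_right:
  "f \<in> l2 M \<Longrightarrow> g \<in> l2 M \<Longrightarrow> h \<in> l2 M \<Longrightarrow>
   l2_inner M h (\<lambda>x. f x - g x) = l2_inner M h f - l2_inner M h g"
  by (subst (1 2 3) l2_inner_cnj) (simp add: l2_inner_diff_left)

lemma l2_inner_sum_left:
  assumes "\<And>i. i \<in> F \<Longrightarrow> f i \<in> l2 M" "h \<in> l2 M"
  shows "l2_inner M (\<lambda>x. \<Sum>i\<in>F. f i x) h = (\<Sum>i\<in>F. l2_inner M (f i) h)"
  using assms by (induction F rule: infinite_finite_induct) (auto simp: l2_inner_add_left l2_sum)

lemma l2_inner_sum_right:
  assumes "\<And>i. i \<in> F \<Longrightarrow> f i \<in> l2 M" "h \<in> l2 M"
  shows "l2_inner M h (\<lambda>x. \<Sum>i\<in>F. f i x) = (\<Sum>i\<in>F. l2_inner M h (f i))"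
  by (subst (1 2) l2_inner_cnj) (simp add: l2_inner_sum_left assms)

lemma l2_inner_cong_AE:
  assumes "f \<in> l2 M" "f' \<in> l2 M" "g \<in> l2 M" "g' \<in> l2 M"
    and "AE x in M. f x = f' x" "AE x in M. g x = g' x"
  shows "l2_inner M f g = l2_inner M f' g'"
  unfolding l2_inner_def
  by (rule integral_cong_AE)
     (use assms l2_inner_integrable in \<open>auto intro: borel_measurable_integrable\<close>)

lemma l2_inner_self: "l2_inner M f f = of_real ((l2_norm M f)\<^sup>2)"
  unfolding l2_inner_def l2_norm_squared integral_complex_of_real[symmetric]
  by (simp add: complex_norm_square del: integral_complex_of_real of_real_power flip: of_real_power)

lemma l2_norm_scale: "l2_norm M (\<lambda>x. a * f x) = cmod a * l2_norm M f"
  by (simp add: l2_norm_def norm_mult power_mult_distrib real_sqrt_mult)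

lemma l2_norm_minus_commute: "l2_norm M (\<lambda>x. f x - g x) = l2_norm M (\<lambda>x. g x - f x)"
  by (simp add: l2_norm_def norm_minus_commute)

lemma l2_norm_zero [simp]: "l2_norm M (\<lambda>x. 0) = 0"
  by (simp add: l2_norm_def)

lemma l2_norm_eq_0_iff: assumes "f \<in> l2 M" shows "l2_norm M f = 0 \<longleftrightarrow> (AE x in M. f x = 0)"
proof -
  have "l2_norm M f = 0 \<longleftrightarrow> (LINT x|M. (cmod (f x))\<^sup>2) = 0" by (simp add: l2_norm_def)
  also have "\<dots> \<longleftrightarrow> (AE x in M. f x = 0)"
    using assms by (subst integral_nonneg_eq_0_iff_AE) (auto simp: l2_def)
  finally show ?thesis .
qed

lemma l2_norm_cong_AE:
  assumes "f \<in> l2 M" "g \<in> l2 M" "AE x in M. f x = g x" shows "l2_norm M f = l2_norm M g"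
  unfolding l2_norm_def
  by (intro arg_cong[where f = sqrt] integral_cong_AE) (use assms in \<open>auto simp: l2_def\<close>)

lemma l2_norm_diff_squared:
  assumes "f \<in> l2 M" "g \<in> l2 M"
  shows "(l2_norm M (\<lambda>x. f x - g x))\<^sup>2 = (l2_norm M f)\<^sup>2 + (l2_norm M g)\<^sup>2 - 2 * Re (l2_inner M f g)"
proof -
  have "complex_of_real ((l2_norm M (\<lambda>x. f x - g x))\<^sup>2) =
     l2_inner M f f + l2_inner M g g - (l2_inner M f g + cnj (l2_inner M f g))"
    unfolding l2_inner_self[symmetric] using assms
    by (simp add: l2_inner_diff_left l2_inner_diff_right l2_diff flip: l2_inner_cnj)
  also have "\<dots> = of_real ((l2_norm M f)\<^sup>2 + (l2_norm M g)\<^sup>2 - 2 * Re (l2_inner M f g))"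
    by (simp add: l2_inner_self complex_add_cnj)
  finally show ?thesis by (simp only: of_real_eq_iff)
qed

lemma l2_Cauchy_Schwarz:
  assumes f: "f \<in> l2 M" and g: "g \<in> l2 M"
  shows "cmod (l2_inner M f g) \<le> l2_norm M f * l2_norm M g"
proof (cases "l2_norm M g = 0")
  case True
  then have "AE x in M. g x = 0" using g by (simp add: l2_norm_eq_0_iff)
  then have "l2_inner M f g = l2_inner M f (\<lambda>x. 0)"
    by (intro l2_inner_cong_AE) (use f g in auto)
  then show ?thesis by simp
next
  case False
  \<comment> \<open>With this coefficient \<open>c * g\<close> is the orthogonal projection of
    \<open>f\<close> onto the line through \<open>g\<close>; the inequality says that the squared
    norm of the remainder is nonnegative.\<close>
  define c where "c = l2_inner M f g / of_real ((l2_norm M g)\<^sup>2)"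
  have "0 \<le> (l2_norm M (\<lambda>x. f x - c * g x))\<^sup>2" by simp
  also have "\<dots> = (l2_norm M f)\<^sup>2 + (cmod c * l2_norm M g)\<^sup>2 - 2 * Re (cnj c * l2_inner M f g)"
    using f g by (simp add: l2_norm_diff_squared l2_scale l2_norm_scale l2_inner_scale_right)
  also have "cnj c * l2_inner M f g = of_real ((cmod (l2_inner M f g))\<^sup>2 / (l2_norm M g)\<^sup>2)"
    unfolding c_def by (simp add: mult.commute[of "cnj _"] flip: complex_norm_square)
  also have "(cmod c * l2_norm M g)\<^sup>2 = (cmod (l2_inner M f g))\<^sup>2 / (l2_norm M g)\<^sup>2"
    using False by (simp add: c_def norm_divide norm_power power_divide power_mult_distrib)
      (simp add: power2_eq_square power4_eq_xxxx)
  finally have "(cmod (l2_inner M f g))\<^sup>2 / (l2_norm M g)\<^sup>2 \<le> (l2_norm M f)\<^sup>2" by simp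
  then have "(cmod (l2_inner M f g))\<^sup>2 \<le> (l2_norm M f * l2_norm M g)\<^sup>2"
    using False by (simp add: divide_simps power_mult_distrib)
  then show ?thesis by (rule power2_le_imp_le) simp
qed

text \<open>The filter is arbitrary because the lemma serves both sequences and the net of finite
  subsets of a basis.\<close>

lemma l2_inner_tendsto:
  assumes f: "\<forall>\<^sub>F i in F. f i \<in> l2 M" and g: "g \<in> l2 M" and h: "h \<in> l2 M"
    and lim: "((\<lambda>i. l2_norm M (\<lambda>x. f i x - g x)) \<longlongrightarrow> 0) F"
  shows "((\<lambda>i. l2_inner M (f i) h) \<longlongrightarrow> l2_inner M g h) F"
proof (rule LIM_zero_cancel, rule Lim_null_comparison)
  show "\<forall>\<^sub>F i in F. norm (l2_inner M (f i) h - l2_inner M g h) \<le> l2_norm M (\<lambda>x. f i x - g x) * l2_norm M h"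
    using f
  proof (rule eventually_mono)
    fix i assume fi: "f i \<in> l2 M"
    show "norm (l2_inner M (f i) h - l2_inner M g h) \<le> l2_norm M (\<lambda>x. f i x - g x) * l2_norm M h"
      unfolding l2_inner_diff_left[OF fi g h, symmetric] by (intro l2_Cauchy_Schwarz l2_diff fi g h)
  qed
  show "((\<lambda>i. l2_norm M (\<lambda>x. f i x - g x) * l2_norm M h) \<longlongrightarrow> 0) F"
    using tendsto_mult_right[OF lim] by simp
qed

section \<open>Completeness of L^2\<close>

lemma sqrt_power_tendsto_zero: "(\<lambda>n. sqrt ((1/8) ^ n)) \<longlonglongrightarrow> 0"
proof -
  have "(\<lambda>n. sqrt ((1/8) ^ n)) \<longlonglongrightarrow> sqrt 0" by (intro tendsto_intros LIMSEQ_power_zero) auto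
  then show ?thesis by simp
qed

text \<open>Riesz--Fischer: the rate \<open>8\<^sup>-\<^sup>n\<close> makes \<open>\<Sum>n. 4\<^sup>n \<bar>f (n+1) - f n\<bar>\<^sup>2\<close> integrable, so that
  the sequence converges almost everywhere without passing to a subsequence.\<close>

lemma l2_complete:
  fixes f :: "nat \<Rightarrow> 'a \<Rightarrow> complex"
  assumes f: "\<And>n. f n \<in> l2 M"
    and rate: "\<And>n m. n \<le> m \<Longrightarrow> (l2_norm M (\<lambda>x. f m x - f n x))\<^sup>2 \<le> (1/8) ^ n"
  shows "\<exists>g\<in>l2 M. (\<lambda>n. l2_norm M (\<lambda>x. f n x - g x)) \<longlonglongrightarrow> 0"
proof -
  have [measurable]: "f n \<in> borel_measurable M" for n using f by (auto simp: l2_def)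
  define h where "h n x = f (Suc n) x - f n x" for n x
  have h: "h n \<in> l2 M" for n unfolding h_def by (intro l2_diff f)
  have [measurable]: "h n \<in> borel_measurable M" for n using h by (auto simp: l2_def)
  have "(\<integral>\<^sup>+x. (\<Sum>n. ennreal (4 ^ n * (cmod (h n x))\<^sup>2)) \<partial>M)
      = (\<Sum>n. \<integral>\<^sup>+x. ennreal (4 ^ n * (cmod (h n x))\<^sup>2) \<partial>M)"
    by (rule nn_integral_suminf) auto
  also have "\<dots> = (\<Sum>n. ennreal (4 ^ n * (l2_norm M (h n))\<^sup>2))"
    by (simp add: ennreal_mult nn_integral_cmult nn_integral_l2 h)
  also have "\<dots> \<le> (\<Sum>n. ennreal ((1/2) ^ n))"
  proof (intro suminf_le ennreal_leI)
    fix n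
    have "4 ^ n * (l2_norm M (h n))\<^sup>2 \<le> 4 ^ n * (1/8) ^ n"
      using rate[of n "Suc n"] by (intro mult_left_mono) (auto simp: h_def[abs_def])
    also have "\<dots> = (1/2::real) ^ n" by (simp add: power_mult_distrib[symmetric])
    finally show "4 ^ n * (l2_norm M (h n))\<^sup>2 \<le> (1/2::real) ^ n" .
  qed auto
  also have "\<dots> < \<infinity>"
    by (subst suminf_ennreal2) (auto simp: ennreal_less_top)
  finally have "AE x in M. (\<Sum>n. ennreal (4 ^ n * (cmod (h n x))\<^sup>2)) \<noteq> \<infinity>"
    by (intro nn_integral_PInf_AE) auto
  then have conv: "AE x in M. (\<lambda>n. f n x) \<longlonglongrightarrow> lim (\<lambda>n. f n x)"
  proof eventually_elim
    case (elim x)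
    then obtain C where C: "(\<Sum>n. ennreal (4 ^ n * (cmod (h n x))\<^sup>2)) = ennreal C" "0 \<le> C"
      using ennreal_cases unfolding infinity_ennreal_def by blast
    have "cmod (h n x) \<le> sqrt C * (1/2) ^ n" for n
    proof -
      have "ennreal (4 ^ n * (cmod (h n x))\<^sup>2) \<le> ennreal C"
        using sum_le_suminf[of "\<lambda>n. ennreal (4 ^ n * (cmod (h n x))\<^sup>2)" "{n}"] C(1) by auto
      then have "4 ^ n * (cmod (h n x))\<^sup>2 \<le> C" using C(2) by (simp only: ennreal_le_iff)
      then have "(cmod (h n x))\<^sup>2 \<le> C / 4 ^ n" by (simp add: field_simps)
      also have "\<dots> = (sqrt C * (1/2) ^ n)\<^sup>2"
      proof -
        have "((1/2::real) ^ n)\<^sup>2 = ((1/2)\<^sup>2) ^ n"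
          by (simp only: power_mult[symmetric] mult.commute)
        also have "\<dots> = 1 / 4 ^ n" by (simp add: power_divide)
        finally show ?thesis using C(2) by (simp add: power_mult_distrib)
      qed
      finally show ?thesis by (rule power2_le_imp_le) (use C in auto)
    qed
    then have "summable (\<lambda>n. h n x)"
      by (intro summable_comparison_test'[OF summable_mult[OF summable_geometric[of "1/2"]], of 0])
         simp_all
    then have "convergent (\<lambda>n. \<Sum>i<n. h i x)" by (simp add: summable_iff_convergent)
    moreover have "(\<Sum>i<n. h i x) = f n x - f 0 x" for n
      unfolding h_def by (rule sum_lessThan_telescope)
    ultimately have "convergent (\<lambda>n. f n x)"
      using convergent_add_const_right_iff[of "\<lambda>n. f n x" "- f 0 x"] by simp
    then show ?case by (simp add: convergent_LIMSEQ_iff)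
  qed
  define g where "g x = lim (\<lambda>n. f n x)" for x
  have [measurable]: "g \<in> borel_measurable M" unfolding g_def by measurable
  \<comment> \<open>Fatou's lemma lets \<open>m\<close> tend to infinity in the Cauchy estimate. The
    bound gives the rate of convergence, and its finiteness puts \<open>f n - g\<close>, hence
    \<open>g\<close>, into \<open>l2 M\<close>.\<close>
  have bound: "(\<integral>\<^sup>+x. ennreal ((cmod (f n x - g x))\<^sup>2) \<partial>M) \<le> ennreal ((1/8) ^ n)" for n
  proof -
    have "(\<integral>\<^sup>+x. ennreal ((cmod (f n x - g x))\<^sup>2) \<partial>M)
        \<le> (\<integral>\<^sup>+x. liminf (\<lambda>m. ennreal ((cmod (f n x - f m x))\<^sup>2)) \<partial>M)"
    proof (rule nn_integral_mono_AE, use conv in eventually_elim)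
      case (elim x)
      have "(\<lambda>m. ennreal ((cmod (f n x - f m x))\<^sup>2)) \<longlonglongrightarrow> ennreal ((cmod (f n x - g x))\<^sup>2)"
        using elim unfolding g_def by (intro tendsto_intros)
      then show ?case using lim_imp_Liminf[OF trivial_limit_sequentially] by force
    qed
    also have "\<dots> \<le> liminf (\<lambda>m. \<integral>\<^sup>+x. ennreal ((cmod (f n x - f m x))\<^sup>2) \<partial>M)"
      by (rule nn_integral_liminf) auto
    also have "\<dots> \<le> liminf (\<lambda>m::nat. ennreal ((1/8) ^ n))"
    proof (rule Liminf_mono, rule eventually_sequentiallyI[of n])
      fix m assume "n \<le> m"
      then show "(\<integral>\<^sup>+x. ennreal ((cmod (f n x - f m x))\<^sup>2) \<partial>M) \<le> ennreal ((1/8) ^ n)"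
        using rate[of n m] by (simp add: nn_integral_l2 l2_diff f l2_norm_minus_commute[of M "f n"])
    qed
    also have "\<dots> = ennreal ((1/8) ^ n)" by (simp add: Liminf_const)
    finally show ?thesis .
  qed
  have fg: "(\<lambda>x. f n x - g x) \<in> l2 M" for n
    unfolding l2_iff_nn_integral using le_less_trans[OF bound[of n]] by simp
  have "g \<in> l2 M" using l2_diff[OF f[of 0] fg[of 0]] by simp
  moreover have "(\<lambda>n. l2_norm M (\<lambda>x. f n x - g x)) \<longlonglongrightarrow> 0"
  proof (rule Lim_null_comparison[OF always_eventually sqrt_power_tendsto_zero], rule allI)
    fix n
    show "norm (l2_norm M (\<lambda>x. f n x - g x)) \<le> sqrt ((1/8) ^ n)"
      using bound[of n] by (simp, intro real_le_rsqrt) (simp add: nn_integral_l2[OF fg])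
  qed
  ultimately show ?thesis by blast
qed

section \<open>Spans and orthonormal expansions\<close>

lemma lspan_finite:
  assumes "finite S" shows "lspan S = {\<lambda>x. \<Sum>h\<in>S. a h * h x | a. True}"
proof safe
  fix f assume "f \<in> lspan S"
  then obtain T a where T: "finite T" "T \<subseteq> S" "f = (\<lambda>x. \<Sum>h\<in>T. a h * h x)"
    unfolding lspan_def by blast
  have "(\<Sum>h\<in>T. a h * h x) = (\<Sum>h\<in>S. (if h \<in> T then a h else 0) * h x)" for x
    using T assms by (intro sum.mono_neutral_cong_left) auto
  then show "\<exists>a. f = (\<lambda>x. \<Sum>h\<in>S. a h * h x) \<and> True" unfolding T(3) by auto
next
  fix a show "(\<lambda>x. \<Sum>h\<in>S. a h * h x) \<in> lspan S"
    unfolding lspan_def using assms by blast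
qed

lemma lspan_base: "f \<in> S \<Longrightarrow> f \<in> lspan S"
  unfolding lspan_def by (rule CollectI, rule exI[of _ "{f}"], rule exI[of _ "\<lambda>_. 1"]) auto

lemma lspan_sum:
  assumes "finite T" "T \<subseteq> S" shows "(\<lambda>x. \<Sum>h\<in>T. a h * h x) \<in> lspan S"
  using assms unfolding lspan_def by blast

lemma lspan_zero: "(\<lambda>x. 0) \<in> lspan S"
  using lspan_sum[of "{}" S] by simp

lemma lspan_add: assumes "f \<in> lspan S" "g \<in> lspan S" shows "(\<lambda>x. f x + g x) \<in> lspan S"
proof -
  obtain T a where T: "finite T" "T \<subseteq> S" "f = (\<lambda>x. \<Sum>h\<in>T. a h * h x)"
    using assms(1) unfolding lspan_def by blast
  obtain U b where U: "finite U" "U \<subseteq> S" "g = (\<lambda>x. \<Sum>h\<in>U. b h * h x)"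
    using assms(2) unfolding lspan_def by blast
  have "(\<Sum>h\<in>T. a h * h x) = (\<Sum>h\<in>T \<union> U. (if h \<in> T then a h else 0) * h x)" for x
    using T U by (intro sum.mono_neutral_cong_left) auto
  moreover have "(\<Sum>h\<in>U. b h * h x) = (\<Sum>h\<in>T \<union> U. (if h \<in> U then b h else 0) * h x)" for x
    using T U by (intro sum.mono_neutral_cong_left) auto
  ultimately have "(\<lambda>x. f x + g x) =
      (\<lambda>x. \<Sum>h\<in>T \<union> U. ((if h \<in> T then a h else 0) + (if h \<in> U then b h else 0)) * h x)"
    unfolding T(3) U(3) by (simp add: distrib_right sum.distrib)
  then show ?thesis using T U by (simp add: lspan_sum)
qed

lemma lspan_scale: assumes "f \<in> lspan S" shows "(\<lambda>x. c * f x) \<in> lspan S"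
proof -
  obtain T a where T: "finite T" "T \<subseteq> S" "f = (\<lambda>x. \<Sum>h\<in>T. a h * h x)"
    using assms unfolding lspan_def by blast
  have "(\<lambda>x. c * f x) = (\<lambda>x. \<Sum>h\<in>T. (c * a h) * h x)"
    unfolding T(3) by (simp add: sum_distrib_left mult.assoc)
  then show ?thesis using T by (simp add: lspan_sum)
qed

lemma lspan_sums: assumes "\<And>i. i \<in> F \<Longrightarrow> f i \<in> lspan S" shows "(\<lambda>x. \<Sum>i\<in>F. f i x) \<in> lspan S"
  using assms by (induction F rule: infinite_finite_induct) (auto intro: lspan_add lspan_zero)

lemma lspan_induct [consumes 1, case_names zero add scale]:
  assumes f: "f \<in> lspan S" and z: "P (\<lambda>x. 0)"
    and add: "\<And>f g. P f \<Longrightarrow> P g \<Longrightarrow> P (\<lambda>x. f x + g x)"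
    and scale: "\<And>a h. h \<in> S \<Longrightarrow> P (\<lambda>x. a * h x)"
  shows "P f"
proof -
  obtain T a where T: "finite T" "T \<subseteq> S" "f = (\<lambda>x. \<Sum>h\<in>T. a h * h x)"
    using f unfolding lspan_def by blast
  have "P (\<lambda>x. \<Sum>h\<in>T. a h * h x)"
    using T(1,2) by (induction T) (auto intro!: z add scale)
  then show ?thesis by (simp add: T(3))
qed

lemma lspan_subset_l2: assumes "S \<subseteq> l2 M" shows "lspan S \<subseteq> l2 M"
proof
  fix f assume "f \<in> lspan S" then show "f \<in> l2 M"
    by (induction rule: lspan_induct) (use assms in \<open>auto intro: l2_add l2_scale\<close>)
qed

lemma lspan_least: assumes "S \<subseteq> lspan T" shows "lspan S \<subseteq> lspan T"
proof
  fix f assume "f \<in> lspan S" then show "f \<in> lspan T"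
    by (induction rule: lspan_induct) (use assms in \<open>auto intro: lspan_zero lspan_add lspan_scale\<close>)
qed

text \<open>Bridge from unordered sums over a possibly uncountable basis to integrals over counting
  measure, so that monotonicity and dominated convergence apply to sums of coefficients.\<close>

lemma has_sum_imp_nn_integral_count_space:
  fixes f :: "'a \<Rightarrow> real"
  assumes "(f has_sum s) S" "\<And>x. x \<in> S \<Longrightarrow> 0 \<le> f x"
  shows "(\<integral>\<^sup>+x. ennreal (f x) \<partial>count_space S) = ennreal s"
proof -
  have "f summable_on S" using assms(1) by (rule has_sum_imp_summable)
  then have "(\<lambda>x. norm (f x)) summable_on S"
    by (rule summable_on_iff_abs_summable_on_real[THEN iffD1])
  then have i: "integrable (count_space S) f"
    by (simp only: abs_summable_equivalent Infinite_Set_Sum.abs_summable_on_def)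
  have "(\<integral>\<^sup>+x. ennreal (f x) \<partial>count_space S) = ennreal (integral\<^sup>L (count_space S) f)"
    by (rule nn_integral_eq_integral[OF i]) (simp add: AE_count_space assms(2))
  also have "integral\<^sup>L (count_space S) f = infsetsum f S" by (simp only: infsetsum_def)
  also have "\<dots> = infsum f S"
    by (rule infsetsum_infsum) (simp only: Infinite_Set_Sum.abs_summable_on_def i)
  also have "\<dots> = s" by (rule infsumI[OF assms(1)])
  finally show ?thesis .
qed

lemma nn_integral_count_space_finite_imp_summable_on:
  fixes f :: "'a \<Rightarrow> real"
  assumes "(\<integral>\<^sup>+x. ennreal (f x) \<partial>count_space S) < \<infinity>" "\<And>x. x \<in> S \<Longrightarrow> 0 \<le> f x"
  shows "f summable_on S"
proof -
  have "integrable (count_space S) f"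
    by (rule integrableI_nonneg) (use assms in \<open>auto simp: AE_count_space\<close>)
  then have "(\<lambda>x. norm (f x)) summable_on S"
    by (simp only: abs_summable_equivalent Infinite_Set_Sum.abs_summable_on_def)
  then show ?thesis by (rule abs_summable_summable)
qed

section \<open>Orthonormal sets: Pythagoras, Bessel, Riesz-Fischer\<close>

lemma orthonormal_inner:
  "orthonormal_set M S \<Longrightarrow> e \<in> S \<Longrightarrow> e' \<in> S \<Longrightarrow> l2_inner M e e' = (if e = e' then 1 else 0)"
  by (auto simp: orthonormal_set_def)

lemma orthonormal_l2: "orthonormal_set M S \<Longrightarrow> e \<in> S \<Longrightarrow> e \<in> l2 M"
  by (auto simp: orthonormal_set_def)

lemma orthonormal_inner_sum:
  assumes S: "orthonormal_set M S" and F: "finite F" "F \<subseteq> S" and e: "e \<in> S"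
  shows "l2_inner M (\<lambda>x. \<Sum>h\<in>F. c h * h x) e = (if e \<in> F then c e else 0)"
proof -
  have "l2_inner M (\<lambda>x. \<Sum>h\<in>F. c h * h x) e = (\<Sum>h\<in>F. c h * l2_inner M h e)"
    using S F e by (subst l2_inner_sum_left) (auto intro!: l2_scale orthonormal_l2 simp: l2_inner_scale_left)
  also have "\<dots> = (\<Sum>h\<in>F. if h = e then c e else 0)"
    using S F e by (intro sum.cong) (auto simp: orthonormal_inner subset_iff)
  finally show ?thesis using F by simp
qed

lemma orthonormal_sum_l2:
  assumes "orthonormal_set M S" "F \<subseteq> S" shows "(\<lambda>x. \<Sum>h\<in>F. c h * h x) \<in> l2 M"
  using assms by (intro l2_sum l2_scale) (auto intro: orthonormal_l2)

lemma inner_orthonormal_sum: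
  assumes S: "orthonormal_set M S" and F: "F \<subseteq> S" and f: "f \<in> l2 M"
  shows "l2_inner M f (\<lambda>x. \<Sum>h\<in>F. c h * h x) = (\<Sum>h\<in>F. cnj (c h) * l2_inner M f h)"
  using S F f by (subst l2_inner_sum_right) (auto intro!: l2_scale orthonormal_l2 simp: l2_inner_scale_right)

lemma orthonormal_norm_sum:
  assumes S: "orthonormal_set M S" and F: "finite F" "F \<subseteq> S"
  shows "(l2_norm M (\<lambda>x. \<Sum>h\<in>F. c h * h x))\<^sup>2 = (\<Sum>h\<in>F. (cmod (c h))\<^sup>2)"
proof -
  have "complex_of_real ((l2_norm M (\<lambda>x. \<Sum>h\<in>F. c h * h x))\<^sup>2) = (\<Sum>h\<in>F. cnj (c h) * c h)"
    unfolding l2_inner_self[symmetric] using S F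
    by (simp add: inner_orthonormal_sum orthonormal_sum_l2)
       (intro sum.cong, auto simp: orthonormal_inner_sum subset_iff)
  also have "\<dots> = complex_of_real (\<Sum>h\<in>F. (cmod (c h))\<^sup>2)"
    by (simp add: mult.commute flip: complex_norm_square)
  finally show ?thesis by (simp only: of_real_eq_iff)
qed

text \<open>The partial Fourier sum of \<open>f\<close> over \<open>G\<close>.\<close>

abbreviation expansion :: "'a measure \<Rightarrow> ('a \<Rightarrow> complex) \<Rightarrow> ('a \<Rightarrow> complex) set \<Rightarrow> 'a \<Rightarrow> complex" where
  "expansion M f G \<equiv> \<lambda>x. \<Sum>h\<in>G. l2_inner M f h * h x"

text \<open>The expansion is the orthogonal projection of \<open>f\<close> onto the span of
  \<open>F\<close>, so this is Pythagoras. Bessel's inequality and the decrease of the remainder as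
  \<open>F\<close> grows are both read off from it.\<close>

lemma orthonormal_norm_remainder:
  assumes S: "orthonormal_set M S" and F: "finite F" "F \<subseteq> S" and f: "f \<in> l2 M"
  shows "(l2_norm M (\<lambda>x. f x - expansion M f F x))\<^sup>2
    = (l2_norm M f)\<^sup>2 - (\<Sum>h\<in>F. (cmod (l2_inner M f h))\<^sup>2)"
proof -
  have "l2_inner M f (expansion M f F) = of_real (\<Sum>h\<in>F. (cmod (l2_inner M f h))\<^sup>2)"
    using S F f by (simp add: inner_orthonormal_sum mult.commute[of "cnj _"] flip: complex_norm_square)
  then show ?thesis
    using S F f by (simp add: l2_norm_diff_squared orthonormal_sum_l2 orthonormal_norm_sum)
qed

text \<open>Summability provides finite sets outside of which all finite sums are at most 8^-n, the
  rate that \<open>l2_complete\<close> asks for. The last conclusion records that \<open>g\<close>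
  is a limit of finite partial sums, which the coefficients alone would not tell for a set that is
  not yet known to be total.\<close>

lemma Riesz_Fischer:
  fixes c :: "('a \<Rightarrow> complex) \<Rightarrow> complex"
  assumes S: "orthonormal_set M S" and c: "(\<lambda>e. (cmod (c e))\<^sup>2) summable_on S"
  obtains g where "g \<in> l2 M" "\<And>e. e \<in> S \<Longrightarrow> l2_inner M g e = c e"
    "\<And>r. r > 0 \<Longrightarrow> \<exists>F. finite F \<and> F \<subseteq> S \<and> l2_norm M (\<lambda>x. g x - (\<Sum>h\<in>F. c h * h x)) < r"
proof -
  have "\<exists>F. finite F \<and> F \<subseteq> S \<and> (\<forall>G. finite G \<and> G \<subseteq> S \<and> G \<inter> F = {} \<longrightarrow> (\<Sum>h\<in>G. (cmod (c h))\<^sup>2) \<le> (1/8)^n)"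
    for n :: nat
  proof -
    define s where "s = infsum (\<lambda>e. (cmod (c e))\<^sup>2) S"
    have hs: "((\<lambda>e. (cmod (c e))\<^sup>2) has_sum s) S" using c s_def by simp
    obtain F where F: "finite F" "F \<subseteq> S" "dist (\<Sum>h\<in>F. (cmod (c h))\<^sup>2) s \<le> (1/8)^n"
      using has_sum_finite_approximation[OF hs, of "(1/8)^n"] by auto
    have "(\<Sum>h\<in>G. (cmod (c h))\<^sup>2) \<le> (1/8)^n" if G: "finite G" "G \<subseteq> S" "G \<inter> F = {}" for G
    proof -
      have "(\<Sum>h\<in>G \<union> F. (cmod (c h))\<^sup>2) \<le> s"
        using has_sum_mono_neutral[OF has_sum_finite[of "G \<union> F" "\<lambda>e. (cmod (c e))\<^sup>2"] hs] G F by auto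
      then show ?thesis using F G by (simp add: sum.union_disjoint dist_real_def)
    qed
    with F show ?thesis by blast
  qed
  then obtain F0 where F0: "\<And>n. finite (F0 n)" "\<And>n. F0 n \<subseteq> S"
    "\<And>n G. finite G \<Longrightarrow> G \<subseteq> S \<Longrightarrow> G \<inter> F0 n = {} \<Longrightarrow> (\<Sum>h\<in>G. (cmod (c h))\<^sup>2) \<le> (1/8)^n"
    by metis
  \<comment> \<open>Cumulative unions make the sets increasing, so that \<open>f m - f n\<close> is
    a sum over \<open>F m - F n\<close>, which is disjoint from \<open>F n\<close> and hence a small
    tail.\<close>
  define F where "F n = (\<Union>i\<le>n. F0 i)" for n
  have F: "finite (F n)" "F n \<subseteq> S" for n using F0 by (auto simp: F_def)
  have Fmono: "F n \<subseteq> F m" if "n \<le> m" for n m proof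
    fix x assume "x \<in> F n"
    then obtain i where "i \<le> n" "x \<in> F0 i" by (auto simp: F_def)
    then show "x \<in> F m" using that unfolding F_def by (intro UN_I[of i]) auto
  qed
  have tail: "(\<Sum>h\<in>G. (cmod (c h))\<^sup>2) \<le> (1/8)^n" if "finite G" "G \<subseteq> S" "G \<inter> F n = {}" for n G
    by (rule F0(3)) (use that in \<open>auto simp: F_def\<close>)
  define f where "f n x = (\<Sum>h\<in>F n. c h * h x)" for n x
  have f: "f n \<in> l2 M" for n
    unfolding f_def[abs_def] by (rule orthonormal_sum_l2[OF S F(2)])
  have "\<exists>g\<in>l2 M. (\<lambda>n. l2_norm M (\<lambda>x. f n x - g x)) \<longlonglongrightarrow> 0"
  proof (rule l2_complete[OF f])
    fix n m :: nat assume "n \<le> m"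
    have "f m x - f n x = (\<Sum>h\<in>F m - F n. c h * h x)" for x
      unfolding f_def using F Fmono[OF \<open>n \<le> m\<close>] by (subst sum_diff) auto
    then have "(l2_norm M (\<lambda>x. f m x - f n x))\<^sup>2 = (\<Sum>h\<in>F m - F n. (cmod (c h))\<^sup>2)"
      using orthonormal_norm_sum[OF S, of "F m - F n" c] F[of m] by auto
    also have "\<dots> \<le> (1/8)^n" by (rule tail) (use F[of m] in auto)
    finally show "(l2_norm M (\<lambda>x. f m x - f n x))\<^sup>2 \<le> (1/8)^n" .
  qed
  then obtain g where g: "g \<in> l2 M" and lim: "(\<lambda>n. l2_norm M (\<lambda>x. f n x - g x)) \<longlonglongrightarrow> 0" by blast
  have "l2_inner M g e = c e" if e: "e \<in> S" for e
  proof -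
    have 1: "(\<lambda>n. l2_inner M (f n) e) \<longlonglongrightarrow> l2_inner M g e"
      by (intro l2_inner_tendsto always_eventually allI f g lim orthonormal_l2[OF S e])
    have 2: "(\<lambda>n. l2_inner M (f n) e) \<longlonglongrightarrow> c e"
    proof (rule LIM_zero_cancel, rule Lim_null_comparison[OF always_eventually sqrt_power_tendsto_zero], rule allI)
      fix n
      show "norm (l2_inner M (f n) e - c e) \<le> sqrt ((1/8)^n)"
      \<comment> \<open>The coefficient is exact once \<open>e\<close> has been included; before
        that it is 0 in the partial sum, and \<open>{e}\<close> is itself one of the small
        tails.\<close>
      proof (cases "e \<in> F n")
        case True
        then show ?thesis using orthonormal_inner_sum[OF S F e, of c] by (simp add: f_def[abs_def])
      next
        case False
        then have "(cmod (c e))\<^sup>2 \<le> (1/8)^n" using tail[of "{e}" n] e by simp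
        then show ?thesis using orthonormal_inner_sum[OF S F e, of c] False
          by (simp add: f_def[abs_def] real_le_rsqrt)
      qed
    qed
    show ?thesis by (rule LIMSEQ_unique[OF 1 2])
  qed
  moreover have "\<exists>F. finite F \<and> F \<subseteq> S \<and> l2_norm M (\<lambda>x. g x - (\<Sum>h\<in>F. c h * h x)) < r" if "r > 0" for r
  proof -
    have "\<forall>\<^sub>F n in sequentially. l2_norm M (\<lambda>x. f n x - g x) < r"
      using order_tendstoD(2)[OF lim that] .
    then obtain n where "l2_norm M (\<lambda>x. f n x - g x) < r" by (auto simp: eventually_sequentially)
    then show ?thesis using F[of n] by (auto simp: l2_norm_minus_commute[of M g] f_def[symmetric])
  qed
  ultimately show ?thesis by (intro that[OF g]) auto
qed

text \<open>Totality is stated as a trivial orthogonal complement, the form in which it can be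
  checked for child functions; density of the span is derived from it in
  \<open>l2_totalI\<close>.\<close>

locale l2_basis =
  fixes M :: "'a measure" and S :: "('a \<Rightarrow> complex) set"
  assumes orthonormal: "orthonormal_set M S"
    and total: "\<And>f. f \<in> l2 M \<Longrightarrow> (\<And>e. e \<in> S \<Longrightarrow> l2_inner M f e = 0) \<Longrightarrow> AE x in M. f x = 0"
begin

lemmas basis_l2 = orthonormal_l2[OF orthonormal]

lemma basis_norm: assumes e: "e \<in> S" shows "l2_norm M e = 1"
proof -
  have "complex_of_real ((l2_norm M e)\<^sup>2) = 1"
    using orthonormal_inner[OF orthonormal e e] by (simp only: l2_inner_self refl if_True)
  then have "(l2_norm M e)\<^sup>2 = 1" by (simp only: of_real_eq_1_iff)
  then show ?thesis using power2_eq_iff_nonneg[of "l2_norm M e" 1] by simp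
qed

text \<open>The device that turns every later identity almost everywhere into an identity of
  coefficients.\<close>

lemma eq_AE_iff:
  assumes "f \<in> l2 M" "g \<in> l2 M"
  shows "(AE x in M. f x = g x) \<longleftrightarrow> (\<forall>e\<in>S. l2_inner M f e = l2_inner M g e)"
proof
  assume "AE x in M. f x = g x"
  then show "\<forall>e\<in>S. l2_inner M f e = l2_inner M g e"
    by (intro ballI l2_inner_cong_AE) (use assms basis_l2 in auto)
next
  assume "\<forall>e\<in>S. l2_inner M f e = l2_inner M g e"
  then have "AE x in M. f x - g x = 0"
    by (intro total l2_diff assms) (simp add: l2_inner_diff_left assms basis_l2)
  then show "AE x in M. f x = g x" by simp
qed

lemma coefficients_summable:
  assumes "f \<in> l2 M" shows "(\<lambda>e. (cmod (l2_inner M f e))\<^sup>2) summable_on S"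
proof (rule nonneg_bdd_above_summable_on)
  show "bdd_above (sum (\<lambda>e. (cmod (l2_inner M f e))\<^sup>2) ` {F. F \<subseteq> S \<and> finite F})"
  proof (rule bdd_aboveI2)
    fix F assume "F \<in> {F. F \<subseteq> S \<and> finite F}"
    then show "(\<Sum>h\<in>F. (cmod (l2_inner M f h))\<^sup>2) \<le> (l2_norm M f)\<^sup>2"
      using orthonormal_norm_remainder[OF orthonormal _ _ assms, of F]
        zero_le_power2[of "l2_norm M (\<lambda>x. f x - expansion M f F x)"]
      by (simp del: zero_le_power2)
  qed
qed auto

text \<open>Riesz-Fischer produces some function with the coefficients of \<open>f\<close> that is
  approximated by partial sums; totality identifies it with \<open>f\<close> almost everywhere.
  Passing from \<open>F\<close> to a larger \<open>G\<close> only shrinks the remainder.\<close>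

lemma finite_approximation:
  assumes f: "f \<in> l2 M" and r: "r > 0"
  shows "\<exists>F. finite F \<and> F \<subseteq> S \<and> (\<forall>G. finite G \<and> F \<subseteq> G \<and> G \<subseteq> S \<longrightarrow>
      l2_norm M (\<lambda>x. f x - expansion M f G x) < r)"
proof -
  obtain g where g: "g \<in> l2 M" "\<And>e. e \<in> S \<Longrightarrow> l2_inner M g e = l2_inner M f e"
    "\<And>r. r > 0 \<Longrightarrow> \<exists>F. finite F \<and> F \<subseteq> S \<and> l2_norm M (\<lambda>x. g x - expansion M f F x) < r"
    by (rule Riesz_Fischer[OF orthonormal coefficients_summable[OF f]]) (assumption | rule that)+
  obtain F where F: "finite F" "F \<subseteq> S" "l2_norm M (\<lambda>x. g x - expansion M f F x) < r"
    using g(3)[OF r] by blast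
  have "AE x in M. f x = g x" using f g by (simp add: eq_AE_iff)
  then have "l2_norm M (\<lambda>x. f x - expansion M f F x)
      = l2_norm M (\<lambda>x. g x - expansion M f F x)"
    by (intro l2_norm_cong_AE) (auto intro!: l2_diff f g orthonormal_sum_l2[OF orthonormal] F)
  with F have lt: "l2_norm M (\<lambda>x. f x - expansion M f F x) < r" by simp
  have "l2_norm M (\<lambda>x. f x - expansion M f G x) < r"
    if G: "finite G" "F \<subseteq> G" "G \<subseteq> S" for G
  proof -
    have "(\<Sum>h\<in>F. (cmod (l2_inner M f h))\<^sup>2) \<le> (\<Sum>h\<in>G. (cmod (l2_inner M f h))\<^sup>2)"
      by (intro sum_mono2 G) auto
    then have "(l2_norm M (\<lambda>x. f x - expansion M f G x))\<^sup>2
        \<le> (l2_norm M (\<lambda>x. f x - expansion M f F x))\<^sup>2"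
      using F G f by (simp add: orthonormal_norm_remainder[OF orthonormal])
    then show ?thesis using lt by (meson power2_le_imp_le l2_norm_nonneg le_less_trans)
  qed
  then show ?thesis using F by (intro exI[of _ F]) simp
qed

lemma expansion_tendsto:
  assumes f: "f \<in> l2 M"
  shows "((\<lambda>G. l2_norm M (\<lambda>x. expansion M f G x - f x)) \<longlongrightarrow> 0) (finite_subsets_at_top S)"
  unfolding tendsto_iff eventually_finite_subsets_at_top dist_real_def
  using finite_approximation[OF f] by (simp add: l2_norm_minus_commute[of M f])

lemma expansion_l2:
  "\<forall>\<^sub>F G in finite_subsets_at_top S. expansion M f G \<in> l2 M"
  by (intro eventually_finite_subsets_at_top_weakI orthonormal_sum_l2[OF orthonormal])

lemma Parseval_inner:
  assumes f: "f \<in> l2 M" and g: "g \<in> l2 M"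
  shows "((\<lambda>e. l2_inner M f e * cnj (l2_inner M g e)) has_sum l2_inner M f g) S"
  unfolding has_sum_def
proof (rule Lim_transform_eventually[OF l2_inner_tendsto[OF expansion_l2 f g expansion_tendsto[OF f]]])
  show "\<forall>\<^sub>F G in finite_subsets_at_top S. l2_inner M (expansion M f G) g
      = (\<Sum>e\<in>G. l2_inner M f e * cnj (l2_inner M g e))"
  proof (rule eventually_finite_subsets_at_top_weakI)
    fix G assume "finite G" "G \<subseteq> S"
    then show "l2_inner M (expansion M f G) g = (\<Sum>e\<in>G. l2_inner M f e * cnj (l2_inner M g e))"
      using basis_l2 g by (subst l2_inner_sum_left)
        (auto intro!: l2_scale sum.cong simp: l2_inner_scale_left l2_inner_cnj[of M g] subset_iff)
  qed
qed

lemma Parseval: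
  assumes f: "f \<in> l2 M"
  shows "((\<lambda>e. (cmod (l2_inner M f e))\<^sup>2) has_sum (l2_norm M f)\<^sup>2) S"
proof -
  have "((\<lambda>e. Re (l2_inner M f e * cnj (l2_inner M f e))) has_sum Re (l2_inner M f f)) S"
    by (intro has_sum_Re Parseval_inner f)
  moreover have "Re (z * cnj z) = (cmod z)\<^sup>2" for z
    by (simp only: complex_norm_square[symmetric] Re_complex_of_real)
  ultimately show ?thesis by (simp only: l2_inner_self Re_complex_of_real)
qed

lemma Parseval_nn:
  "f \<in> l2 M \<Longrightarrow>
    (\<integral>\<^sup>+e. ennreal ((cmod (l2_inner M f e))\<^sup>2) \<partial>count_space S) = ennreal ((l2_norm M f)\<^sup>2)"
  by (rule has_sum_imp_nn_integral_count_space[OF Parseval]) auto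

lemma synthesis:
  assumes "(\<integral>\<^sup>+e. ennreal ((cmod (c e))\<^sup>2) \<partial>count_space S) < \<infinity>"
  shows "\<exists>g\<in>l2 M. \<forall>e\<in>S. l2_inner M g e = c e"
  by (rule Riesz_Fischer[OF orthonormal nn_integral_count_space_finite_imp_summable_on[OF assms]]) auto

lemma l2_totalI: "l2_total M S"
  unfolding l2_total_def
proof (intro conjI ballI allI impI)
  show "S \<subseteq> l2 M" using basis_l2 by auto
  fix f and r :: real assume "f \<in> l2 M" "r > 0"
  then obtain F where "finite F" "F \<subseteq> S" "\<forall>G. finite G \<and> F \<subseteq> G \<and> G \<subseteq> S \<longrightarrow>
      l2_norm M (\<lambda>x. f x - expansion M f G x) < r"
    using finite_approximation by meson
  then show "\<exists>g\<in>lspan S. l2_norm M (\<lambda>x. f x - g x) < r"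
    by (intro bexI[of _ "expansion M f F"]) (auto intro: lspan_sum)
qed

end

section \<open>Diagonal operators\<close>

abbreviation simple_integral ::
    "(real set \<Rightarrow> ('a \<Rightarrow> complex) \<Rightarrow> 'a \<Rightarrow> complex) \<Rightarrow> (real \<Rightarrow> real) \<Rightarrow> ('a \<Rightarrow> complex) \<Rightarrow> 'a \<Rightarrow> complex" where
  "simple_integral E s f \<equiv> \<lambda>x. \<Sum>y\<in>range s. complex_of_real y * E (s -` {y}) f x"

lemma simple_function_borelD:
  fixes s :: "real \<Rightarrow> real"
  assumes "simple_function borel s"
  shows "finite (range s)" "s -` {y} \<in> sets borel" "s \<in> borel_measurable borel"
proof -
  show "finite (range s)" using assms by (simp add: simple_function_def)
  show [measurable]: "s \<in> borel_measurable borel" using assms by (rule borel_measurable_simple_function)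
  show "s -` {y} \<in> sets borel" using measurable_sets[of s borel borel "{y}"] by simp
qed

section \<open>Multiplication operators and their spectral integrals\<close>

context l2_basis
begin

text \<open>Multiplication by \<open>c\<close> on its maximal domain: requiring \<open>g\<close> to
  lie in \<open>l2 M\<close> is what makes the products of \<open>c e\<close> with the coefficients
  of \<open>f\<close> square-summable. The operator may be unbounded.\<close>

definition diagonal :: "(('a \<Rightarrow> complex) \<Rightarrow> real) \<Rightarrow> 'a l2_operator" where
  "diagonal c f g \<longleftrightarrow> f \<in> l2 M \<and> g \<in> l2 M \<and>
     (\<forall>e\<in>S. l2_inner M g e = complex_of_real (c e) * l2_inner M f e)"

text \<open>The coefficients fix the value up to a null set only, hence the choice. It is meaningful
  as soon as \<open>m\<close> is bounded on \<open>S\<close>, by \<open>synthesis\<close>.\<close>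

definition multiplier :: "(('a \<Rightarrow> complex) \<Rightarrow> complex) \<Rightarrow> ('a \<Rightarrow> complex) \<Rightarrow> 'a \<Rightarrow> complex" where
  "multiplier m f = (SOME g. g \<in> l2 M \<and> (\<forall>e\<in>S. l2_inner M g e = m e * l2_inner M f e))"

lemma norm_le_coefficients:
  assumes "f \<in> l2 M" "g \<in> l2 M" "0 \<le> K"
    and "\<And>e. e \<in> S \<Longrightarrow> cmod (l2_inner M g e) \<le> K * cmod (l2_inner M f e)"
  shows "l2_norm M g \<le> K * l2_norm M f"
proof (rule power2_le_imp_le)
  have "((\<lambda>e. K\<^sup>2 * (cmod (l2_inner M f e))\<^sup>2) has_sum K\<^sup>2 * (l2_norm M f)\<^sup>2) S"
    by (intro has_sum_cmult_right Parseval assms)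
  from Parseval[OF assms(2)] this show "(l2_norm M g)\<^sup>2 \<le> (K * l2_norm M f)\<^sup>2"
    unfolding power_mult_distrib
    by (rule has_sum_mono) (use assms(4) in \<open>auto simp flip: power_mult_distrib intro!: power_mono\<close>)
qed (use assms(3) in auto)

lemma
  assumes f: "f \<in> l2 M" and m: "\<And>e. e \<in> S \<Longrightarrow> cmod (m e) \<le> K"
  shows multiplier_l2: "multiplier m f \<in> l2 M"
    and multiplier_inner: "e \<in> S \<Longrightarrow> l2_inner M (multiplier m f) e = m e * l2_inner M f e"
proof -
  have "(\<integral>\<^sup>+e. ennreal ((cmod (m e * l2_inner M f e))\<^sup>2) \<partial>count_space S)
      \<le> (\<integral>\<^sup>+e. ennreal (K\<^sup>2) * ennreal ((cmod (l2_inner M f e))\<^sup>2) \<partial>count_space S)"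
  proof (rule nn_integral_mono)
    fix e assume "e \<in> space (count_space S)"
    then have "(cmod (m e))\<^sup>2 \<le> K\<^sup>2" using m[of e] by (intro power_mono) auto
    then show "ennreal ((cmod (m e * l2_inner M f e))\<^sup>2) \<le> ennreal (K\<^sup>2) * ennreal ((cmod (l2_inner M f e))\<^sup>2)"
      by (simp add: norm_mult power_mult_distrib mult_right_mono flip: ennreal_mult)
  qed
  also have "\<dots> < \<infinity>"
    by (subst nn_integral_cmult) (simp_all add: Parseval_nn f ennreal_mult_less_top)
  finally have "\<exists>g\<in>l2 M. \<forall>e\<in>S. l2_inner M g e = m e * l2_inner M f e" by (rule synthesis)
  then have "\<exists>g. g \<in> l2 M \<and> (\<forall>e\<in>S. l2_inner M g e = m e * l2_inner M f e)" by blast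
  then have *: "multiplier m f \<in> l2 M \<and> (\<forall>e\<in>S. l2_inner M (multiplier m f) e = m e * l2_inner M f e)"
    unfolding multiplier_def by (rule someI_ex)
  then show "multiplier m f \<in> l2 M" by blast
  show "e \<in> S \<Longrightarrow> l2_inner M (multiplier m f) e = m e * l2_inner M f e" using * by blast
qed

lemma multiplier_norm:
  assumes f: "f \<in> l2 M" and m: "\<And>e. e \<in> S \<Longrightarrow> cmod (m e) \<le> K" and "0 \<le> K"
  shows "l2_norm M (multiplier m f) \<le> K * l2_norm M f"
  by (rule norm_le_coefficients)
     (simp_all add: assms multiplier_l2[OF f m] multiplier_inner[OF f m] norm_mult mult_right_mono)

lemma multiplier_linear:
  assumes f: "f \<in> l2 M" and g: "g \<in> l2 M" and m: "\<And>e. e \<in> S \<Longrightarrow> cmod (m e) \<le> K"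
  shows "AE x in M. multiplier m (\<lambda>y. a * f y + b * g y) x = a * multiplier m f x + b * multiplier m g x"
proof -
  have h: "(\<lambda>y. a * f y + b * g y) \<in> l2 M" by (intro l2_add l2_scale f g)
  show ?thesis
    by (subst eq_AE_iff)
       (auto intro!: l2_add l2_scale
         simp: multiplier_l2[OF _ m] multiplier_inner[OF _ m] f g h
           l2_inner_add_left l2_inner_scale_left l2_scale basis_l2 distrib_left mult.left_commute)
qed

lemma multiplier_bounded_operator:
  assumes m: "\<And>e. e \<in> S \<Longrightarrow> cmod (m e) \<le> K"
  shows "bounded_operator M (multiplier m)"
  unfolding bounded_operator_def
proof (intro conjI ballI allI)
  \<comment> \<open>For empty \<open>S\<close> nothing forces \<open>K\<close> to be nonnegative, as
    \<open>multiplier_norm\<close> requires.\<close>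
  have m': "\<And>e. e \<in> S \<Longrightarrow> cmod (m e) \<le> max K 0" using m by (simp add: le_max_iff_disj)
  show "\<exists>K. \<forall>f\<in>l2 M. l2_norm M (multiplier m f) \<le> K * l2_norm M f"
    using multiplier_norm[OF _ m'] by (intro exI[of _ "max K 0"]) auto
qed (use multiplier_l2[OF _ m] multiplier_linear[OF _ _ m] in auto)

text \<open>Common interface for the constructed \<open>eigenprojection c\<close> and for an
  arbitrary spectral measure of \<open>diagonal c\<close>, so that the spectral integral is computed
  once for both.\<close>

definition diagonal_pvm ::
    "(('a \<Rightarrow> complex) \<Rightarrow> real) \<Rightarrow> (real set \<Rightarrow> ('a \<Rightarrow> complex) \<Rightarrow> 'a \<Rightarrow> complex) \<Rightarrow> bool" where
  "diagonal_pvm c E \<longleftrightarrow> (\<forall>T\<in>sets borel. \<forall>f\<in>l2 M. E T f \<in> l2 M \<and>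
     (\<forall>e\<in>S. l2_inner M (E T f) e = (if c e \<in> T then l2_inner M f e else 0)))"

lemma
  assumes "diagonal_pvm c E" "T \<in> sets borel" "f \<in> l2 M"
  shows diagonal_pvm_l2: "E T f \<in> l2 M"
    and diagonal_pvm_inner: "e \<in> S \<Longrightarrow> l2_inner M (E T f) e = (if c e \<in> T then l2_inner M f e else 0)"
  using assms unfolding diagonal_pvm_def by blast+

definition eigenprojection ::
    "(('a \<Rightarrow> complex) \<Rightarrow> real) \<Rightarrow> real set \<Rightarrow> ('a \<Rightarrow> complex) \<Rightarrow> 'a \<Rightarrow> complex" where
  "eigenprojection c T = multiplier (\<lambda>e. if c e \<in> T then 1 else 0)"

lemma eigenprojection_l2: "f \<in> l2 M \<Longrightarrow> eigenprojection c T f \<in> l2 M"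
  unfolding eigenprojection_def by (rule multiplier_l2[where K = 1]) auto

lemma eigenprojection_inner:
  "f \<in> l2 M \<Longrightarrow> e \<in> S \<Longrightarrow> l2_inner M (eigenprojection c T f) e = (if c e \<in> T then l2_inner M f e else 0)"
  unfolding eigenprojection_def by (subst multiplier_inner[where K = 1]) auto

lemma diagonal_pvm_eigenprojection: "diagonal_pvm c (eigenprojection c)"
  unfolding diagonal_pvm_def by (simp add: eigenprojection_l2 eigenprojection_inner)

text \<open>After \<open>n\<close> sets the error keeps exactly the coefficients of those
  \<open>e\<close> whose value \<open>c e\<close> lies in the union but in none of the first
  \<open>n\<close> sets. Each \<open>e\<close> is concerned for finitely many \<open>n\<close> only,
  and the coefficients of \<open>f\<close> dominate.\<close>

lemma eigenprojection_countably_additive: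
  fixes T :: "nat \<Rightarrow> real set"
  assumes disj: "disjoint_family T" and f: "f \<in> l2 M"
  shows "(\<lambda>n. l2_norm M (\<lambda>x. eigenprojection c (\<Union>i. T i) f x - (\<Sum>i<n. eigenprojection c (T i) f x))) \<longlonglongrightarrow> 0"
  (is "(\<lambda>n. l2_norm M (?D n)) \<longlonglongrightarrow> 0")
proof -
  have D: "?D n \<in> l2 M" for n by (intro l2_diff l2_sum eigenprojection_l2 f)
  let ?rest = "\<lambda>n e. c e \<in> (\<Union>i. T i) \<and> \<not> (\<exists>i<n. c e \<in> T i)"
  have sum_if: "(\<Sum>i<n. if c e \<in> T i then z else 0) = (if \<exists>i<n. c e \<in> T i then z else (0::complex))" for n e z
  proof (cases "\<exists>i<n. c e \<in> T i")
    case True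
    then obtain i where i: "i < n" "c e \<in> T i" by blast
    have "c e \<in> T j \<longleftrightarrow> j = i" for j using disj i by (auto simp: disjoint_family_on_def)
    with True i show ?thesis by simp
  qed auto
  have coef: "l2_inner M (?D n) e = (if ?rest n e then l2_inner M f e else 0)" if "e \<in> S" for n e
    using that by (subst l2_inner_diff_left, insert f)
      (auto simp: l2_inner_sum_left eigenprojection_l2 eigenprojection_inner l2_sum basis_l2 sum_if)
  let ?u = "\<lambda>e. ennreal ((cmod (l2_inner M f e))\<^sup>2)"
  have "(\<lambda>n. \<integral>\<^sup>+e. (if ?rest n e then ?u e else 0) \<partial>count_space S) \<longlonglongrightarrow> (\<integral>\<^sup>+e. 0 \<partial>count_space S)"
  proof (rule nn_integral_dominated_convergence[where w = ?u])
    show "(\<integral>\<^sup>+e. ?u e \<partial>count_space S) < \<infinity>" by (simp add: Parseval_nn f)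
    have "(\<lambda>n. if ?rest n e then ?u e else 0) \<longlonglongrightarrow> 0" for e
    proof (cases "c e \<in> (\<Union>i. T i)")
      case True
      then obtain i where "c e \<in> T i" by blast
      then have "\<forall>\<^sub>F n in sequentially. (if ?rest n e then ?u e else 0) = 0"
        by (intro eventually_sequentiallyI[of "Suc i"]) auto
      then show ?thesis by (rule tendsto_eventually)
    qed simp
    then show "AE e in count_space S. (\<lambda>n. if ?rest n e then ?u e else 0) \<longlonglongrightarrow> 0" by simp
  qed auto
  moreover have "(\<integral>\<^sup>+e. (if ?rest n e then ?u e else 0) \<partial>count_space S) = ennreal ((l2_norm M (?D n))\<^sup>2)" for n
    unfolding Parseval_nn[OF D, symmetric] by (rule nn_integral_cong) (auto simp: coef)
  ultimately have "(\<lambda>n. ennreal ((l2_norm M (?D n))\<^sup>2)) \<longlonglongrightarrow> ennreal 0" by simp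
  then have "(\<lambda>n. (l2_norm M (?D n))\<^sup>2) \<longlonglongrightarrow> 0" by (subst (asm) tendsto_ennreal_iff) auto
  from tendsto_real_sqrt[OF this] show ?thesis by simp
qed

lemma projection_valued_measure_eigenprojection:
  "projection_valued_measure M (eigenprojection c)"
  unfolding projection_valued_measure_def orthogonal_projection_def
proof (intro conjI ballI allI impI)
  show "bounded_operator M (eigenprojection c T)" for T
    unfolding eigenprojection_def by (rule multiplier_bounded_operator[where K = 1]) auto
  fix f T U assume f: "f \<in> l2 M"
  note simps = eigenprojection_l2 eigenprojection_inner f
  show "AE x in M. eigenprojection c T (eigenprojection c T f) x = eigenprojection c T f x"
    by (subst eq_AE_iff) (auto simp: simps)
  show "AE x in M. eigenprojection c UNIV f x = f x"
    by (subst eq_AE_iff) (auto simp: simps)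
  show "AE x in M. eigenprojection c (T \<inter> U) f x = eigenprojection c T (eigenprojection c U f) x"
    by (subst eq_AE_iff) (auto simp: simps)
  fix g assume g: "g \<in> l2 M"
  have 1: "((\<lambda>e. l2_inner M (eigenprojection c T f) e * cnj (l2_inner M g e)) has_sum
      l2_inner M (eigenprojection c T f) g) S"
    by (intro Parseval_inner simps g)
  have 2: "((\<lambda>e. l2_inner M f e * cnj (l2_inner M (eigenprojection c T g) e)) has_sum
      l2_inner M f (eigenprojection c T g)) S"
    by (intro Parseval_inner simps g)
  have "((\<lambda>e. l2_inner M (eigenprojection c T f) e * cnj (l2_inner M g e)) has_sum
      l2_inner M f (eigenprojection c T g)) S"
    by (rule has_sum_cong[THEN iffD1, OF _ 2]) (use g in \<open>simp add: simps\<close>)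
  from has_sum_unique[OF 1 this]
  show "l2_inner M (eigenprojection c T f) g = l2_inner M f (eigenprojection c T g)" .
next
  fix T :: "nat \<Rightarrow> real set" and f
  assume "disjoint_family T" "f \<in> l2 M"
  then show "(\<lambda>n. l2_norm M (\<lambda>x. eigenprojection c (\<Union>i. T i) f x - (\<Sum>i<n. eigenprojection c (T i) f x))) \<longlonglongrightarrow> 0"
    by (rule eigenprojection_countably_additive)
qed

text \<open>The scalar spectral measure is the image under \<open>c\<close> of the counting measure
  on \<open>S\<close>, weighted by the squared moduli of the coefficients of
  \<open>f\<close>.\<close>

lemma nn_integral_scalar_spectral_measure:
  assumes E: "diagonal_pvm c E" and f: "f \<in> l2 M" and h: "h \<in> borel_measurable borel"
  shows "(\<integral>\<^sup>+t. h t \<partial>scalar_spectral_measure M E f)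
    = (\<integral>\<^sup>+e. ennreal ((cmod (l2_inner M f e))\<^sup>2) * h (c e) \<partial>count_space S)"
proof -
  define N where "N = distr (density (count_space S) (\<lambda>e. ennreal ((cmod (l2_inner M f e))\<^sup>2))) borel c"
  have em: "emeasure N T = ennreal (Re (l2_inner M (E T f) f))" if T: "T \<in> sets borel" for T
  proof -
    have "emeasure N T = (\<integral>\<^sup>+e. ennreal ((cmod (l2_inner M f e))\<^sup>2) * indicator (c -` T \<inter> S) e \<partial>count_space S)"
      unfolding N_def using T by (subst emeasure_distr) (auto simp: emeasure_density)
    also have "\<dots> = (\<integral>\<^sup>+e. ennreal (Re (l2_inner M (E T f) e * cnj (l2_inner M f e))) \<partial>count_space S)"
    proof (rule nn_integral_cong)
      fix e assume "e \<in> space (count_space S)"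
      moreover have "Re (z * cnj z) = (cmod z)\<^sup>2" for z
        by (simp only: complex_norm_square[symmetric] Re_complex_of_real)
      ultimately show "ennreal ((cmod (l2_inner M f e))\<^sup>2) * indicator (c -` T \<inter> S) e
          = ennreal (Re (l2_inner M (E T f) e * cnj (l2_inner M f e)))"
        using diagonal_pvm_inner[OF E T f, of e] by (cases "c e \<in> T") (simp_all del: complex_mult_cnj)
    qed
    also have "\<dots> = ennreal (Re (l2_inner M (E T f) f))"
    proof (rule has_sum_imp_nn_integral_count_space)
      show "((\<lambda>e. Re (l2_inner M (E T f) e * cnj (l2_inner M f e))) has_sum Re (l2_inner M (E T f) f)) S"
        by (intro has_sum_Re Parseval_inner f diagonal_pvm_l2[OF E T])
    qed (use diagonal_pvm_inner[OF E T f] in auto)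
    finally show ?thesis .
  qed
  \<comment> \<open>\<open>measure_of\<close> consults its set function on the sigma-algebra only,
    and there it agrees with the measure \<open>N\<close>; so the result is \<open>N\<close>, and
    that it is a measure need not be checked by hand.\<close>
  have "scalar_spectral_measure M E f = measure_of (space N) (sets N) (emeasure N)"
  proof -
    have N: "space N = UNIV" "sets N = sets borel" by (simp_all add: N_def)
    have \<sigma>: "sigma_sets UNIV (sets borel) = sets (borel :: real measure)"
      using sets.sigma_sets_eq[of "borel :: real measure"] by simp
    show ?thesis unfolding N scalar_spectral_measure_def
      by (rule measure_of_eq) (simp_all only: \<sigma> em subset_UNIV Pow_UNIV)
  qed
  also have "\<dots> = N" by (rule measure_of_of_measure)
  finally have "(\<integral>\<^sup>+t. h t \<partial>scalar_spectral_measure M E f) = (\<integral>\<^sup>+t. h t \<partial>N)" by simp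
  also have "\<dots> = (\<integral>\<^sup>+e. h (c e) \<partial>density (count_space S) (\<lambda>e. ennreal ((cmod (l2_inner M f e))\<^sup>2)))"
    unfolding N_def by (rule nn_integral_distr) (use h in auto)
  also have "\<dots> = (\<integral>\<^sup>+e. ennreal ((cmod (l2_inner M f e))\<^sup>2) * h (c e) \<partial>count_space S)"
    by (rule nn_integral_density) auto
  finally show ?thesis .
qed

lemma
  assumes E: "diagonal_pvm c E" and f: "f \<in> l2 M" and s: "simple_function borel s"
  shows diagonal_simple_l2: "simple_integral E s f \<in> l2 M"
    and diagonal_simple_inner: "e \<in> S \<Longrightarrow>
      l2_inner M (simple_integral E s f) e
        = complex_of_real (s (c e)) * l2_inner M f e"
proof -
  note l2E = diagonal_pvm_l2[OF E simple_function_borelD(2)[OF s] f]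
  note inE = diagonal_pvm_inner[OF E simple_function_borelD(2)[OF s] f]
  show "simple_integral E s f \<in> l2 M"
    by (intro l2_sum l2_scale l2E)
  assume e: "e \<in> S"
  have "l2_inner M (simple_integral E s f) e
      = (\<Sum>y\<in>range s. if y = s (c e) then complex_of_real (s (c e)) * l2_inner M f e else 0)"
    using e by (subst l2_inner_sum_left)
      (auto intro!: l2_scale l2E sum.cong simp: basis_l2 l2_inner_scale_left inE)
  also have "\<dots> = complex_of_real (s (c e)) * l2_inner M f e"
    using simple_function_borelD(1)[OF s] by (simp add: sum.delta)
  finally show "l2_inner M (simple_integral E s f) e
        = complex_of_real (s (c e)) * l2_inner M f e" .
qed

text \<open>For fixed \<open>e\<close> one sequence of numbers has two limits: the coefficient of
  \<open>g\<close>, by continuity of the inner product, and \<open>\<phi> (c e)\<close> times the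
  coefficient of \<open>f\<close>, because the contribution of the single point \<open>e\<close> is
  at most the whole integral.\<close>

lemma spectral_integral_diagonal_imp:
  assumes E: "diagonal_pvm c E" and I: "spectral_integral M E \<phi> f g"
  shows "diagonal (\<lambda>e. \<phi> (c e)) f g"
proof -
  have f: "f \<in> l2 M" and g: "g \<in> l2 M" and [measurable]: "\<phi> \<in> borel_measurable borel"
    using I by (auto simp: spectral_integral_def)
  from I obtain s where s: "\<And>n. simple_function borel (s n)"
    and c1: "(\<lambda>n. \<integral>\<^sup>+t. ennreal ((s n t - \<phi> t)\<^sup>2) \<partial>scalar_spectral_measure M E f) \<longlonglongrightarrow> 0"
    and c2: "(\<lambda>n. l2_norm M (\<lambda>x. simple_integral E (s n) f x - g x)) \<longlonglongrightarrow> 0"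
    unfolding spectral_integral_def by blast
  note [measurable] = simple_function_borelD(3)[OF s]
  have "l2_inner M g e = complex_of_real (\<phi> (c e)) * l2_inner M f e" if e: "e \<in> S" for e
  proof -
    let ?z = "\<lambda>n. complex_of_real (s n (c e)) * l2_inner M f e"
    have "(\<lambda>n. l2_inner M (simple_integral E (s n) f) e) \<longlonglongrightarrow> l2_inner M g e"
      by (intro l2_inner_tendsto always_eventually allI diagonal_simple_l2[OF E f s] g basis_l2[OF e] c2)
    then have 1: "?z \<longlonglongrightarrow> l2_inner M g e" by (simp only: diagonal_simple_inner[OF E f s e])
    have le: "ennreal ((cmod (?z n - complex_of_real (\<phi> (c e)) * l2_inner M f e))\<^sup>2)
        \<le> (\<integral>\<^sup>+t. ennreal ((s n t - \<phi> t)\<^sup>2) \<partial>scalar_spectral_measure M E f)" for n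
    proof -
      have "(cmod (?z n - complex_of_real (\<phi> (c e)) * l2_inner M f e))\<^sup>2
          = (cmod (l2_inner M f e))\<^sup>2 * (s n (c e) - \<phi> (c e))\<^sup>2"
        unfolding left_diff_distrib[symmetric] of_real_diff[symmetric] norm_mult norm_of_real
        by (simp add: power_mult_distrib mult.commute)
      then have "ennreal ((cmod (?z n - complex_of_real (\<phi> (c e)) * l2_inner M f e))\<^sup>2)
          = ennreal ((cmod (l2_inner M f e))\<^sup>2) * ennreal ((s n (c e) - \<phi> (c e))\<^sup>2)"
        by (simp add: ennreal_mult)
      also have "\<dots> \<le> (\<integral>\<^sup>+e. ennreal ((cmod (l2_inner M f e))\<^sup>2) * ennreal ((s n (c e) - \<phi> (c e))\<^sup>2) \<partial>count_space S)"
        using e by (rule nn_integral_ge_point)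
      finally show ?thesis
        by (subst nn_integral_scalar_spectral_measure[OF E f]) measurable
    qed
    have "(\<lambda>n. ennreal ((cmod (?z n - complex_of_real (\<phi> (c e)) * l2_inner M f e))\<^sup>2)) \<longlonglongrightarrow> ennreal 0"
      unfolding ennreal_0 by (rule tendsto_sandwich[OF _ _ tendsto_const c1]) (auto simp: le)
    then have "(\<lambda>n. (cmod (?z n - complex_of_real (\<phi> (c e)) * l2_inner M f e))\<^sup>2) \<longlonglongrightarrow> 0"
      by (subst (asm) tendsto_ennreal_iff) auto
    from tendsto_real_sqrt[OF this]
    have "(\<lambda>n. cmod (?z n - complex_of_real (\<phi> (c e)) * l2_inner M f e)) \<longlonglongrightarrow> 0" by simp
    then have 2: "?z \<longlonglongrightarrow> complex_of_real (\<phi> (c e)) * l2_inner M f e"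
      by (simp add: tendsto_norm_zero_iff LIM_zero_iff)
    show ?thesis by (rule LIMSEQ_unique[OF 1 2])
  qed
  with f g show ?thesis unfolding diagonal_def by blast
qed

text \<open>By Parseval, the distance of the simple integrals from \<open>g\<close> and the distance
  of the simple functions from \<phi> are given by the same sum over the basis, so one application
  of dominated convergence settles both requirements of \<open>spectral_integral\<close>.\<close>

lemma diagonal_imp_spectral_integral:
  assumes E: "diagonal_pvm c E" and \<phi>[measurable]: "\<phi> \<in> borel_measurable borel"
    and D: "diagonal (\<lambda>e. \<phi> (c e)) f g"
  shows "spectral_integral M E \<phi> f g"
proof -
  have f: "f \<in> l2 M" and g: "g \<in> l2 M"
    and coef: "\<And>e. e \<in> S \<Longrightarrow> l2_inner M g e = complex_of_real (\<phi> (c e)) * l2_inner M f e"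
    using D by (auto simp: diagonal_def)
  let ?c = "\<lambda>e. ennreal ((cmod (l2_inner M f e))\<^sup>2)" and ?w = "\<lambda>e. ennreal ((\<phi> (c e))\<^sup>2)"
  have sq: "?c e * ennreal (t\<^sup>2) = ennreal ((cmod (complex_of_real t * l2_inner M f e))\<^sup>2)" for e t
    by (simp add: norm_mult power_mult_distrib mult.commute flip: ennreal_mult)
  have "(\<integral>\<^sup>+e. ?c e * ?w e \<partial>count_space S)
      = (\<integral>\<^sup>+e. ennreal ((cmod (l2_inner M g e))\<^sup>2) \<partial>count_space S)"
    by (rule nn_integral_cong) (simp add: sq coef)
  also have "\<dots> < \<infinity>" by (simp add: Parseval_nn g)
  finally have fin': "(\<integral>\<^sup>+e. ?c e * ?w e \<partial>count_space S) < \<infinity>" .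
  then have fin: "(\<integral>\<^sup>+t. ennreal ((\<phi> t)\<^sup>2) \<partial>scalar_spectral_measure M E f) < \<infinity>"
    by (subst nn_integral_scalar_spectral_measure[OF E f]) measurable
  \<comment> \<open>The approximation centred at 0 gives the factor 2; then \<bar>s n - \<phi>\<bar>
    is at most 3 \<bar>\<phi>\<bar>, which explains the 9 in the dominating function below.\<close>
  obtain s where s: "\<And>n. simple_function borel (s n)"
    and s_lim: "\<And>t. (\<lambda>n. s n t) \<longlonglongrightarrow> \<phi> t" and s_bd: "\<And>n t. \<bar>s n t\<bar> \<le> 2 * \<bar>\<phi> t\<bar>"
    using borel_measurable_implies_sequence_metric[OF \<phi>, of 0] by (auto simp: dist_real_def)
  note [measurable] = simple_function_borelD(3)[OF s]
  let ?q = "\<lambda>n e. ennreal ((s n (c e) - \<phi> (c e))\<^sup>2)"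
  have lim: "(\<lambda>n. \<integral>\<^sup>+e. ?c e * ?q n e \<partial>count_space S)
      \<longlonglongrightarrow> (\<integral>\<^sup>+e. 0 \<partial>count_space S)"
  proof (rule nn_integral_dominated_convergence[where w =
        "\<lambda>e. 9 * (?c e * ?w e)"])
    show "(\<integral>\<^sup>+e. 9 * (?c e * ?w e) \<partial>count_space S) < \<infinity>"
      using fin' by (subst nn_integral_cmult) (auto simp: ennreal_mult_less_top)
    fix n
    show "AE e in count_space S. ?c e * ?q n e
        \<le> 9 * (?c e * ?w e)"
    proof (rule AE_I2)
      fix e
      have "\<bar>s n (c e) - \<phi> (c e)\<bar> \<le> 3 * \<bar>\<phi> (c e)\<bar>" using s_bd[of n "c e"] by linarith
      then have "(s n (c e) - \<phi> (c e))\<^sup>2 \<le> (3 * \<phi> (c e))\<^sup>2"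
        by (intro abs_le_square_iff[THEN iffD1]) (simp add: abs_mult)
      then have "(s n (c e) - \<phi> (c e))\<^sup>2 \<le> 9 * (\<phi> (c e))\<^sup>2" by (simp add: power_mult_distrib)
      then have "?q n e \<le> ennreal (9 * (\<phi> (c e))\<^sup>2)"
        by (rule ennreal_leI)
      also have "\<dots> = 9 * ?w e" by (simp add: ennreal_mult)
      finally have "?q n e \<le> 9 * ?w e" .
      then have "?c e * ?q n e
          \<le> ?c e * (9 * ?w e)"
        by (rule mult_left_mono) simp
      then show "?c e * ?q n e
        \<le> 9 * (?c e * ?w e)" by (simp only: mult.left_commute)
    qed
  next
    show "AE e in count_space S. (\<lambda>n. ?c e * ?q n e) \<longlonglongrightarrow> 0"
    proof (rule AE_I2)
      fix e
      have "(\<lambda>n. (cmod (l2_inner M f e))\<^sup>2 * (s n (c e) - \<phi> (c e))\<^sup>2) \<longlonglongrightarrow>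
          (cmod (l2_inner M f e))\<^sup>2 * (\<phi> (c e) - \<phi> (c e))\<^sup>2"
        by (intro tendsto_intros s_lim)
      then have "(\<lambda>n. ennreal ((cmod (l2_inner M f e))\<^sup>2 * (s n (c e) - \<phi> (c e))\<^sup>2)) \<longlonglongrightarrow> ennreal 0"
        by (intro tendsto_ennrealI) simp
      then show "(\<lambda>n. ?c e * ?q n e) \<longlonglongrightarrow> 0"
        by (simp add: ennreal_mult)
    qed
  qed auto
  have c1: "(\<lambda>n. \<integral>\<^sup>+t. ennreal ((s n t - \<phi> t)\<^sup>2) \<partial>scalar_spectral_measure M E f) \<longlonglongrightarrow> 0"
  proof -
    have "(\<integral>\<^sup>+t. ennreal ((s n t - \<phi> t)\<^sup>2) \<partial>scalar_spectral_measure M E f)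
        = (\<integral>\<^sup>+e. ?c e * ?q n e \<partial>count_space S)" for n
      by (rule nn_integral_scalar_spectral_measure[OF E f]) measurable
    then show ?thesis using lim by simp
  qed
  have c2: "(\<lambda>n. l2_norm M (\<lambda>x. simple_integral E (s n) f x - g x)) \<longlonglongrightarrow> 0"
  proof -
    let ?d = "\<lambda>n x. simple_integral E (s n) f x - g x"
    have d: "?d n \<in> l2 M" for n by (intro l2_diff diagonal_simple_l2[OF E f s] g)
    have "ennreal ((l2_norm M (?d n))\<^sup>2)
        = (\<integral>\<^sup>+e. ?c e * ?q n e \<partial>count_space S)" for n
      unfolding Parseval_nn[OF d, symmetric] sq
    proof (rule nn_integral_cong)
      fix e assume "e \<in> space (count_space S)"
      then show "ennreal ((cmod (l2_inner M (?d n) e))\<^sup>2) =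
          ennreal ((cmod (complex_of_real (s n (c e) - \<phi> (c e)) * l2_inner M f e))\<^sup>2)"
        by (subst l2_inner_diff_left[OF diagonal_simple_l2[OF E f s] g basis_l2])
           (simp_all add: diagonal_simple_inner[OF E f s] coef left_diff_distrib)
    qed
    then have "(\<lambda>n. ennreal ((l2_norm M (?d n))\<^sup>2)) \<longlonglongrightarrow> ennreal 0" using lim by simp
    then have "(\<lambda>n. (l2_norm M (?d n))\<^sup>2) \<longlonglongrightarrow> 0" by (subst (asm) tendsto_ennreal_iff) auto
    from tendsto_real_sqrt[OF this] show ?thesis by simp
  qed
  show ?thesis unfolding spectral_integral_def
    by (intro conjI f g \<phi> fin exI[of _ s] allI s c1 c2)
qed

end

section \<open>Eigenfunctions and spectral measures\<close>

context
  fixes M :: "'a measure" and E :: "real set \<Rightarrow> ('a \<Rightarrow> complex) \<Rightarrow> 'a \<Rightarrow> complex"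
  assumes E: "projection_valued_measure M E"
begin

lemmas
  pvm_projection = E[unfolded projection_valued_measure_def orthogonal_projection_def, THEN conjunct1, rule_format] and
  pvm_UNIV = E[unfolded projection_valued_measure_def, THEN conjunct2, THEN conjunct1, rule_format] and
  pvm_Int = E[unfolded projection_valued_measure_def, THEN conjunct2, THEN conjunct2, THEN conjunct1, rule_format] and
  pvm_countably_additive =
    E[unfolded projection_valued_measure_def, THEN conjunct2, THEN conjunct2, THEN conjunct2, rule_format]

lemma pvm_l2: "T \<in> sets borel \<Longrightarrow> f \<in> l2 M \<Longrightarrow> E T f \<in> l2 M"
  by (rule pvm_projection[THEN conjunct1, unfolded bounded_operator_def, THEN conjunct1, rule_format])

lemma pvm_symmetric:
  "T \<in> sets borel \<Longrightarrow> f \<in> l2 M \<Longrightarrow> g \<in> l2 M \<Longrightarrow> l2_inner M (E T f) g = l2_inner M f (E T g)"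
  by (rule pvm_projection[THEN conjunct2, THEN conjunct2, rule_format])

lemma pvm_inner_Int:
  assumes "T \<in> sets borel" "U \<in> sets borel" "f \<in> l2 M"
  shows "l2_inner M (E T f) (E U f) = l2_inner M (E (T \<inter> U) f) f"
proof -
  have "l2_inner M (E T f) (E U f) = l2_inner M (E U (E T f)) f"
    using assms by (intro pvm_symmetric[symmetric] pvm_l2)
  also have "\<dots> = l2_inner M (E (T \<inter> U) f) f"
    using assms pvm_Int[OF assms(2,1,3)]
    by (intro l2_inner_cong_AE) (auto intro!: pvm_l2 sets.Int simp: Int_commute)
  finally show ?thesis .
qed

lemma pvm_inner: "T \<in> sets borel \<Longrightarrow> f \<in> l2 M \<Longrightarrow> l2_inner M (E T f) f = of_real ((l2_norm M (E T f))\<^sup>2)"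
  using pvm_inner_Int[of T T f] by (simp only: Int_absorb l2_inner_self)

lemma pvm_norm_sums:
  fixes T :: "nat \<Rightarrow> real set"
  assumes T: "range T \<subseteq> sets borel" "disjoint_family T" and f: "f \<in> l2 M"
  shows "(\<lambda>i. (l2_norm M (E (T i) f))\<^sup>2) sums (l2_norm M (E (\<Union>i. T i) f))\<^sup>2"
proof -
  have T': "T i \<in> sets borel" "(\<Union>i. T i) \<in> sets borel" for i using T by auto
  have "(\<lambda>n. l2_inner M (\<lambda>x. \<Sum>i<n. E (T i) f x) f) \<longlonglongrightarrow> l2_inner M (E (\<Union>i. T i) f) f"
    using pvm_countably_additive[OF T f]
    by (intro l2_inner_tendsto always_eventually allI l2_sum pvm_l2 T' f)
       (simp only: l2_norm_minus_commute[of M "E (\<Union>i. T i) f"])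
  then have "(\<lambda>i. l2_inner M (E (T i) f) f) sums l2_inner M (E (\<Union>i. T i) f) f"
    unfolding sums_def by (simp only: l2_inner_sum_left[OF pvm_l2[OF T'(1) f] f])
  then have "(\<lambda>i. complex_of_real ((l2_norm M (E (T i) f))\<^sup>2)) sums complex_of_real ((l2_norm M (E (\<Union>i. T i) f))\<^sup>2)"
    by (simp only: pvm_inner[OF T'(1) f] pvm_inner[OF T'(2) f])
  from sums_Re[OF this] show ?thesis by (simp only: Re_complex_of_real)
qed

lemma space_scalar_spectral_measure [simp]: "space (scalar_spectral_measure M E f) = UNIV"
  unfolding scalar_spectral_measure_def by (subst space_measure_of) auto

lemma sets_scalar_spectral_measure [simp, measurable_cong]:
  "sets (scalar_spectral_measure M E f) = sets borel"
proof -
  have "sets (scalar_spectral_measure M E f) = sigma_sets UNIV (sets borel)"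
    unfolding scalar_spectral_measure_def by (subst sets_measure_of) auto
  also have "\<dots> = sets borel"
    using sets.sigma_sets_eq[of "borel :: real measure"] by simp
  finally show ?thesis .
qed

text \<open>\<open>measure_of\<close> returns the zero measure for a set function that is not a
  measure, so positivity and countable additivity come before any value can be read off.\<close>

lemma emeasure_scalar_spectral_measure:
  assumes f: "f \<in> l2 M" and T: "T \<in> sets borel"
  shows "emeasure (scalar_spectral_measure M E f) T = ennreal ((l2_norm M (E T f))\<^sup>2)"
proof -
  define m where "m S = ennreal (Re (l2_inner M (E S f) f))" for S
  have m: "m S = ennreal ((l2_norm M (E S f))\<^sup>2)" if "S \<in> sets borel" for S
    unfolding m_def by (simp only: pvm_inner[OF that f] Re_complex_of_real)
  \<comment> \<open>The constant sequence of empty sets is a disjoint family; a constant series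
    converges only if its term is 0.\<close>
  have "(\<lambda>i. (l2_norm M (E {} f))\<^sup>2) sums (l2_norm M (E {} f))\<^sup>2"
    using pvm_norm_sums[OF _ _ f, of "\<lambda>_. {}"] by (simp add: disjoint_family_on_def)
  then have "summable (\<lambda>i::nat. (l2_norm M (E {} f))\<^sup>2)" by (rule sums_summable)
  then have "m {} = 0" by (simp add: m summable_const_iff)
  moreover have "countably_additive (sets borel) m"
  proof (rule countably_additiveI)
    fix A :: "nat \<Rightarrow> real set"
    assume A: "range A \<subseteq> sets borel" "disjoint_family A" "(\<Union>i. A i) \<in> sets borel"
    have "(\<Sum>i. m (A i)) = (\<Sum>i. ennreal ((l2_norm M (E (A i) f))\<^sup>2))"
      using A by (intro suminf_cong m) auto
    also have "\<dots> = ennreal ((l2_norm M (E (\<Union>i. A i) f))\<^sup>2)"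
      by (rule suminf_ennreal_eq[OF _ pvm_norm_sums[OF A(1,2) f]]) simp
    finally show "(\<Sum>i. m (A i)) = m (\<Union>i. A i)" using m[OF A(3)] by simp
  qed
  ultimately have "positive (sets (scalar_spectral_measure M E f)) m"
    "countably_additive (sets (scalar_spectral_measure M E f)) m"
    by (simp_all add: positive_def)
  moreover have "scalar_spectral_measure M E f = measure_of UNIV (sets borel) m"
    unfolding scalar_spectral_measure_def m_def[abs_def] ..
  ultimately have "emeasure (scalar_spectral_measure M E f) T = m T"
    using T by (intro emeasure_measure_of[where A = "sets borel" and \<Omega> = UNIV]) auto
  then show ?thesis by (simp add: m T)
qed

text \<open>The isometry of the spectral integral for the simple function \<open>s - a\<close>.
  Expanding the square leaves the moments of orders 0, 1 and 2 of the masses \<open>m y\<close>,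
  which are \<open>ff\<close>, \<open>gf\<close> and \<open>gg\<close>.\<close>

lemma pvm_simple_remainder:
  assumes f: "f \<in> l2 M" and s: "simple_function borel s"
  shows "ennreal ((l2_norm M (\<lambda>x. simple_integral E s f x - complex_of_real a * f x))\<^sup>2)
    = (\<integral>\<^sup>+t. ennreal ((s t - a)\<^sup>2) \<partial>scalar_spectral_measure M E f)"
proof -
  note fin = simple_function_borelD(1)[OF s] and S = simple_function_borelD(2)[OF s]
    and [measurable] = simple_function_borelD(3)[OF s]
  define m where "m y = (l2_norm M (E (s -` {y}) f))\<^sup>2" for y
  let ?g = "simple_integral E s f"
  note l2 = pvm_l2[OF S f]
  have g: "?g \<in> l2 M" by (intro l2_sum l2_scale l2)
  let ?N = "scalar_spectral_measure M E f"
  have emm: "emeasure ?N (s -` {y}) = ennreal (m y)" for y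
    by (simp add: emeasure_scalar_spectral_measure[OF f S] m_def)
  have empty: "l2_inner M (E {} f) f = 0"
    using emeasure_scalar_spectral_measure[OF f, of "{}"] pvm_inner[of "{}" f] f by simp
  have gf: "l2_inner M ?g f = complex_of_real (\<Sum>y\<in>range s. y * m y)"
    by (subst l2_inner_sum_left)
       (auto intro!: l2_scale l2 f simp: l2_inner_scale_left pvm_inner[OF S f] m_def)
  have "l2_inner M ?g ?g = (\<Sum>y\<in>range s. \<Sum>z\<in>range s. complex_of_real (y * z) * l2_inner M (E (s -` {y}) f) (E (s -` {z}) f))"
    using g by (simp add: l2_inner_sum_left l2_inner_sum_right l2_scale l2 l2_inner_scale_left
        l2_inner_scale_right sum_distrib_left mult.assoc)
  also have "\<dots> = (\<Sum>y\<in>range s. \<Sum>z\<in>range s. if z = y then complex_of_real (y\<^sup>2 * m y) else 0)"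
  proof (intro sum.cong refl)
    fix y z
    have "s -` {y} \<inter> s -` {z} = (if z = y then s -` {y} else {})" by auto
    then show "complex_of_real (y * z) * l2_inner M (E (s -` {y}) f) (E (s -` {z}) f)
        = (if z = y then complex_of_real (y\<^sup>2 * m y) else 0)"
      unfolding pvm_inner_Int[OF S S f]
      by (simp add: empty pvm_inner[OF S f] m_def power2_eq_square)
  qed
  also have "\<dots> = complex_of_real (\<Sum>y\<in>range s. y\<^sup>2 * m y)" using fin by simp
  finally have gg: "(l2_norm M ?g)\<^sup>2 = (\<Sum>y\<in>range s. y\<^sup>2 * m y)"
    unfolding l2_inner_self by (simp only: of_real_eq_iff)
  have "ennreal ((l2_norm M f)\<^sup>2) = emeasure ?N UNIV"
    using l2_norm_cong_AE[OF pvm_l2[OF _ f] f pvm_UNIV[OF f]]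
    by (simp add: emeasure_scalar_spectral_measure[OF f])
  also have "UNIV = (\<Union>y\<in>range s. s -` {y})" by auto
  also have "emeasure ?N (\<Union>y\<in>range s. s -` {y}) = (\<Sum>y\<in>range s. emeasure ?N (s -` {y}))"
    using fin S by (intro sum_emeasure[symmetric]) (auto simp: disjoint_family_on_def)
  also have "\<dots> = ennreal (\<Sum>y\<in>range s. m y)"
    by (simp add: emm sum_ennreal m_def)
  finally have ff: "(l2_norm M f)\<^sup>2 = (\<Sum>y\<in>range s. m y)"
    by (subst (asm) ennreal_inj) (auto intro!: sum_nonneg simp: m_def)
  have "(l2_norm M (\<lambda>x. ?g x - complex_of_real a * f x))\<^sup>2
      = (\<Sum>y\<in>range s. y\<^sup>2 * m y) + a\<^sup>2 * (\<Sum>y\<in>range s. m y) - 2 * (a * (\<Sum>y\<in>range s. y * m y))"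
    by (subst l2_norm_diff_squared[OF g l2_scale[OF f]])
       (simp add: l2_inner_scale_right l2_norm_scale gf gg ff power_mult_distrib)
  also have "\<dots> = (\<Sum>y\<in>range s. (y - a)\<^sup>2 * m y)"
  proof -
    have "(\<Sum>y\<in>range s. (y - a)\<^sup>2 * m y) = (\<Sum>y\<in>range s. y\<^sup>2 * m y + a\<^sup>2 * m y - 2 * (a * (y * m y)))"
      by (intro sum.cong) (auto simp: power2_eq_square algebra_simps)
    then show ?thesis by (simp add: sum.distrib sum_subtractf sum_distrib_left)
  qed
  finally have "ennreal ((l2_norm M (\<lambda>x. ?g x - complex_of_real a * f x))\<^sup>2)
      = (\<Sum>y\<in>range s. ennreal ((y - a)\<^sup>2) * emeasure ?N (s -` {y}))"
    by (simp add: emm m_def sum_ennreal flip: ennreal_mult)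
  also have "\<dots> = (\<Sum>y\<in>range s. \<integral>\<^sup>+t. ennreal ((y - a)\<^sup>2) * indicator (s -` {y}) t \<partial>?N)"
    using S by (simp add: nn_integral_cmult_indicator)
  also have "\<dots> = (\<integral>\<^sup>+t. (\<Sum>y\<in>range s. ennreal ((y - a)\<^sup>2) * indicator (s -` {y}) t) \<partial>?N)"
    using S by (intro nn_integral_sum[symmetric]) (auto intro!: borel_measurable_times borel_measurable_indicator)
  also have "\<dots> = (\<integral>\<^sup>+t. ennreal ((s t - a)\<^sup>2) \<partial>?N)"
  proof (rule nn_integral_cong)
    fix t
    have "(\<Sum>y\<in>range s. ennreal ((y - a)\<^sup>2) * indicator (s -` {y}) t)
        = (\<Sum>y\<in>range s. if y = s t then ennreal ((s t - a)\<^sup>2) else 0)"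
      by (intro sum.cong) (auto simp: indicator_def)
    then show "(\<Sum>y\<in>range s. ennreal ((y - a)\<^sup>2) * indicator (s -` {y}) t) = ennreal ((s t - a)\<^sup>2)"
      using fin by simp
  qed
  finally show ?thesis .
qed

text \<open>In the L^2 space of the scalar spectral measure the functions \<open>s n\<close> tend to
  the identity by definition of the spectral integral, and to the constant \<open>a\<close> by
  \<open>pvm_simple_remainder\<close>. Hence \<open>t = a\<close> almost everywhere: the measure is
  concentrated at \<open>a\<close>.\<close>

lemma pvm_eigenfunction:
  assumes I: "spectral_integral M E (\<lambda>t. t) f (\<lambda>x. complex_of_real a * f x)" and T: "T \<in> sets borel"
  shows "AE x in M. E T f x = (if a \<in> T then f x else 0)"
proof -
  have f: "f \<in> l2 M" using I by (simp add: spectral_integral_def)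
  let ?N = "scalar_spectral_measure M E f"
  obtain s where s: "\<And>n. simple_function borel (s n)"
    and c1: "(\<lambda>n. \<integral>\<^sup>+t. ennreal ((s n t - t)\<^sup>2) \<partial>?N) \<longlonglongrightarrow> 0"
    and c2: "(\<lambda>n. l2_norm M (\<lambda>x. simple_integral E (s n) f x - complex_of_real a * f x)) \<longlonglongrightarrow> 0"
    using I unfolding spectral_integral_def by blast
  note [measurable] = simple_function_borelD(3)[OF s]
  let ?u = "\<lambda>n. 2 * (\<integral>\<^sup>+t. ennreal ((s n t - t)\<^sup>2) \<partial>?N) + 2 * (\<integral>\<^sup>+t. ennreal ((s n t - a)\<^sup>2) \<partial>?N)"
  have c3: "(\<lambda>n. \<integral>\<^sup>+t. ennreal ((s n t - a)\<^sup>2) \<partial>?N) \<longlonglongrightarrow> 0"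
    unfolding pvm_simple_remainder[OF f s, symmetric]
    using tendsto_ennrealI[OF tendsto_power[OF c2, of 2]] by simp
  have "(\<integral>\<^sup>+t. ennreal ((t - a)\<^sup>2) \<partial>?N) \<le> ?u n" for n
  proof -
    have "(\<integral>\<^sup>+t. ennreal ((t - a)\<^sup>2) \<partial>?N) \<le>
        (\<integral>\<^sup>+t. 2 * ennreal ((s n t - t)\<^sup>2) + 2 * ennreal ((s n t - a)\<^sup>2) \<partial>?N)"
    proof (rule nn_integral_mono)
      fix t
      have "(t - a)\<^sup>2 \<le> 2 * (s n t - t)\<^sup>2 + 2 * (s n t - a)\<^sup>2"
        using zero_le_power2[of "(s n t - t) + (s n t - a)"] by (simp add: power2_eq_square algebra_simps)
      then have "ennreal ((t - a)\<^sup>2) \<le> ennreal (2 * (s n t - t)\<^sup>2 + 2 * (s n t - a)\<^sup>2)"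
        by (rule ennreal_leI)
      then show "ennreal ((t - a)\<^sup>2) \<le> 2 * ennreal ((s n t - t)\<^sup>2) + 2 * ennreal ((s n t - a)\<^sup>2)"
        by (simp add: ennreal_mult)
    qed
    also have "\<dots> = ?u n" by (simp add: nn_integral_add nn_integral_cmult)
    finally show ?thesis .
  qed
  moreover have "?u \<longlonglongrightarrow> 2 * 0 + 2 * 0"
    by (intro tendsto_add ennreal_tendsto_cmult c1 c3) auto
  ultimately have "(\<integral>\<^sup>+t. ennreal ((t - a)\<^sup>2) \<partial>?N) \<le> 2 * 0 + 2 * 0"
    by (intro LIMSEQ_le_const) auto
  then have "AE t in ?N. t = a" by (simp add: nn_integral_0_iff_AE)
  then have zero: "l2_norm M (E U f) = 0" if "U \<in> sets borel" "a \<notin> U" for U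
  proof -
    have "AE t in ?N. t \<notin> U"
      using \<open>AE t in ?N. t = a\<close> by (rule eventually_mono) (use that in auto)
    then have "emeasure ?N U = 0" using that by (subst (asm) AE_iff_measurable[of U]) auto
    then show ?thesis using that by (simp add: emeasure_scalar_spectral_measure[OF f])
  qed
  show ?thesis
  proof (cases "a \<in> T")
    case False
    then show ?thesis using zero[OF T] by (simp add: l2_norm_eq_0_iff pvm_l2[OF T f])
  next
    case True
    have "emeasure ?N UNIV = emeasure ?N T + emeasure ?N (- T)"
      using T by (subst plus_emeasure) auto
    moreover have "emeasure ?N (- T) = 0"
      using zero[of "- T"] T True by (simp add: emeasure_scalar_spectral_measure[OF f])
    ultimately have "ennreal ((l2_norm M (E UNIV f))\<^sup>2) = ennreal ((l2_norm M (E T f))\<^sup>2)"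
      using T by (simp add: emeasure_scalar_spectral_measure[OF f])
    then have n: "(l2_norm M (E T f))\<^sup>2 = (l2_norm M f)\<^sup>2"
      using l2_norm_cong_AE[OF pvm_l2[OF _ f] f pvm_UNIV[OF f]] by simp
    \<comment> \<open>Expanding the square, the cross term is the squared norm of
      \<open>E T f\<close> as well, so all terms cancel.\<close>
    have "(l2_norm M (\<lambda>x. E T f x - f x))\<^sup>2 = 0"
      using n by (simp add: l2_norm_diff_squared pvm_l2[OF T f] f pvm_inner[OF T f])
    then have "AE x in M. E T f x - f x = 0"
      using l2_norm_eq_0_iff[OF l2_diff[OF pvm_l2[OF T f] f]] by simp
    with True show ?thesis by simp
  qed
qed

end

section \<open>Functional calculus of a diagonal operator\<close>

context l2_basis
begin

lemma diagonal_basis: assumes "e \<in> S" shows "diagonal c e (\<lambda>x. complex_of_real (c e) * e x)"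
  unfolding diagonal_def
proof (intro conjI ballI)
  fix e' assume "e' \<in> S"
  then show "l2_inner M (\<lambda>x. complex_of_real (c e) * e x) e' = complex_of_real (c e') * l2_inner M e e'"
    using orthonormal_inner[OF orthonormal assms, of e'] by (cases "e = e'") (simp_all add: l2_inner_scale_left)
qed (use basis_l2[OF assms] in \<open>simp_all add: l2_scale\<close>)

text \<open>Symmetry moves \<open>E T\<close> onto the basis vector, an eigenfunction, where
  \<open>pvm_eigenfunction\<close> gives its value.\<close>

lemma spectral_measure_diagonal:
  assumes E: "is_spectral_measure_of M (diagonal c) E"
  shows "diagonal_pvm c E"
  unfolding diagonal_pvm_def
proof (intro ballI conjI)
  fix T f assume T: "T \<in> sets (borel :: real measure)" and f: "f \<in> l2 M"
  have pvm: "projection_valued_measure M E" using E by (simp add: is_spectral_measure_of_def)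
  show "E T f \<in> l2 M" by (rule pvm_l2[OF pvm T f])
  fix e assume e: "e \<in> S"
  have "spectral_integral M E (\<lambda>t. t) e (\<lambda>x. complex_of_real (c e) * e x)"
    using E diagonal_basis[OF e, of c] by (simp add: is_spectral_measure_of_def)
  from pvm_eigenfunction[OF pvm this T]
  have AE: "AE x in M. E T e x = (if c e \<in> T then e x else 0)" .
  have "l2_inner M (E T f) e = l2_inner M f (E T e)"
    by (rule pvm_symmetric[OF pvm T f basis_l2[OF e]])
  also have "\<dots> = l2_inner M f (\<lambda>x. if c e \<in> T then e x else 0)"
  proof (rule l2_inner_cong_AE)
    show "(\<lambda>x. if c e \<in> T then e x else 0) \<in> l2 M"
      using basis_l2[OF e] by (cases "c e \<in> T") simp_all
  qed (use AE f e in \<open>auto simp: basis_l2 pvm_l2[OF pvm T]\<close>)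
  finally show "l2_inner M (E T f) e = (if c e \<in> T then l2_inner M f e else 0)" by simp
qed

text \<open>The existence half, which gives the \<open>SOME\<close> in
  \<open>functional_calculus\<close> its meaning.\<close>

lemma is_spectral_measure_eigenprojection: "is_spectral_measure_of M (diagonal c) (eigenprojection c)"
  unfolding is_spectral_measure_of_def
proof (intro conjI allI iffI)
  show "projection_valued_measure M (eigenprojection c)" by (rule projection_valued_measure_eigenprojection)
  fix f g
  show "spectral_integral M (eigenprojection c) (\<lambda>t. t) f g" if "diagonal c f g"
    using diagonal_imp_spectral_integral[OF diagonal_pvm_eigenprojection[of c], of "\<lambda>t. t"] that by simp
  show "diagonal c f g" if "spectral_integral M (eigenprojection c) (\<lambda>t. t) f g"
    using spectral_integral_diagonal_imp[OF diagonal_pvm_eigenprojection that] by simp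
qed

lemma functional_calculus_diagonal:
  assumes "\<phi> \<in> borel_measurable borel"
  shows "functional_calculus M \<phi> (diagonal c) = diagonal (\<lambda>e. \<phi> (c e))"
proof -
  let ?E = "SOME E. is_spectral_measure_of M (diagonal c) E"
  have "is_spectral_measure_of M (diagonal c) ?E"
    by (rule someI[of "is_spectral_measure_of M (diagonal c)", OF is_spectral_measure_eigenprojection])
  then have E: "diagonal_pvm c ?E" by (rule spectral_measure_diagonal)
  show ?thesis
    unfolding functional_calculus_def
  proof (intro ext iffI)
    fix f g
    show "diagonal (\<lambda>e. \<phi> (c e)) f g" if "spectral_integral M ?E \<phi> f g"
      by (rule spectral_integral_diagonal_imp[OF E that])
    show "spectral_integral M ?E \<phi> f g" if "diagonal (\<lambda>e. \<phi> (c e)) f g"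
      by (rule diagonal_imp_spectral_integral[OF E assms that])
  qed
qed

lemma eigenspace_diagonalI:
  assumes "f \<in> l2 M" "\<And>e. e \<in> S \<Longrightarrow> l2_inner M f e = 0 \<or> c e = a"
  shows "f \<in> eigenspace M (diagonal c) (complex_of_real a)"
  unfolding eigenspace_def diagonal_def
proof (intro CollectI conjI ballI assms(1) l2_scale)
  fix e assume "e \<in> S"
  from assms(2)[OF this]
  show "l2_inner M (\<lambda>x. complex_of_real a * f x) e = complex_of_real (c e) * l2_inner M f e"
    by (auto simp: l2_inner_scale_left)
qed

lemma pure_point_spectrum_diagonal: "pure_point_spectrum M (diagonal c)"
  unfolding pure_point_spectrum_def
proof (rule exI[of _ S], intro conjI ballI)
  show "orthonormal_set M S" by (rule orthonormal)
  show "l2_total M S" by (rule l2_totalI)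
  fix e assume e: "e \<in> S"
  have "e \<in> eigenspace M (diagonal c) (complex_of_real (c e))"
    using diagonal_basis[OF e, of c] basis_l2[OF e] by (simp only: eigenspace_def mem_Collect_eq simp_thms)
  moreover have "\<not> (AE x in M. e x = 0)"
    unfolding l2_norm_eq_0_iff[OF basis_l2[OF e], symmetric] basis_norm[OF e] by simp
  ultimately show "eigenfunction M (diagonal c) e" by (auto simp only: eigenfunction_def)
qed

end

section \<open>Spectrum of a diagonal operator\<close>

context l2_basis
begin

text \<open>At distance \<open>d\<close> from the eigenvalues, multiplication by the reciprocals of
  \<open>c e - z\<close> is bounded by \<open>1 / d\<close> and inverts. Conversely, pairing the
  resolvent equation for \<open>h = e\<close> with \<open>e\<close> itself bounds \<bar>c e -
  a\<bar> below by \<open>1 / K\<close>, so \<open>a\<close> cannot be a limit of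
  eigenvalues.\<close>

lemma spectrum_diagonal: "spectrum M (diagonal c) = complex_of_real ` closure (c ` S)"
proof (intro equalityI subsetI)
  fix z assume z: "z \<in> spectrum M (diagonal c)"
  show "z \<in> complex_of_real ` closure (c ` S)"
  proof (rule ccontr)
    assume nz: "z \<notin> complex_of_real ` closure (c ` S)"
    have "closed (complex_of_real ` closure (c ` S))"
      by (rule closed_injective_linear_image[OF closed_closure bounded_linear.linear[OF bounded_linear_of_real]])
         (simp add: inj_def)
    from separate_point_closed[OF this nz]
    obtain d where d: "d > 0" "\<forall>w\<in>complex_of_real ` closure (c ` S). d \<le> dist z w"
      by (elim exE conjE)
    define m where "m e = 1 / (complex_of_real (c e) - z)" for e
    have cz: "d \<le> cmod (complex_of_real (c e) - z)" if "e \<in> S" for e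
    proof -
      have "complex_of_real (c e) \<in> complex_of_real ` closure (c ` S)"
        using that by (intro imageI subsetD[OF closure_subset])
      with d(2) show ?thesis by (metis dist_norm dist_commute)
    qed
    have ne: "complex_of_real (c e) - z \<noteq> 0" if "e \<in> S" for e
      using cz[OF that] d(1) by (metis norm_zero not_le)
    have m: "cmod (m e) \<le> 1 / d" if "e \<in> S" for e
      using cz[OF that] d(1) unfolding m_def norm_divide by (simp add: frac_le)
    have "z \<in> resolvent_set M (diagonal c)"
      unfolding resolvent_set_def
    proof (intro CollectI exI conjI ballI allI impI)
      show "bounded_operator M (multiplier m)" by (rule multiplier_bounded_operator[OF m])
      fix h assume h: "h \<in> l2 M"
      note l2 = multiplier_l2[OF h m] and inner = multiplier_inner[OF h m]
      have "1 * w + z * (m e * w) = complex_of_real (c e) * (m e * w)" if "e \<in> S" for e w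
        using ne[OF that] unfolding m_def by (simp add: field_simps)
      then show "diagonal c (multiplier m h) (\<lambda>x. h x + z * multiplier m h x)"
        unfolding diagonal_def
        by (auto intro!: l2_add l2_scale l2 h
            simp: l2_inner_add_left l2_inner_scale_left l2_scale h l2 basis_l2 inner)
    next
      fix f g assume D: "diagonal c f g"
      then have f: "f \<in> l2 M" and g: "g \<in> l2 M" by (auto simp: diagonal_def)
      have h: "(\<lambda>y. g y - z * f y) \<in> l2 M" by (intro l2_diff l2_scale f g)
      show "AE x in M. multiplier m (\<lambda>y. g y - z * f y) x = f x"
      proof (subst eq_AE_iff[OF multiplier_l2[OF h m] f], simp, rule ballI)
        fix e assume e: "e \<in> S"
        have "l2_inner M (multiplier m (\<lambda>y. g y - z * f y)) e = m e * (complex_of_real (c e) * l2_inner M f e - z * l2_inner M f e)"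
          using D e by (subst multiplier_inner[OF h m e])
            (simp_all add: l2_inner_diff_left f g l2_scale basis_l2 l2_inner_scale_left diagonal_def)
        then show "l2_inner M (multiplier m (\<lambda>y. g y - z * f y)) e = l2_inner M f e"
          using ne[OF e] unfolding m_def left_diff_distrib[symmetric] by simp
      qed
    qed
    then show False using z by (simp add: spectrum_def)
  qed
next
  fix z assume "z \<in> complex_of_real ` closure (c ` S)"
  then obtain a where a: "z = complex_of_real a" "a \<in> closure (c ` S)" by blast
  have "z \<notin> resolvent_set M (diagonal c)"
  proof
    assume "z \<in> resolvent_set M (diagonal c)"
    then obtain R where R: "bounded_operator M R" "\<And>h. h \<in> l2 M \<Longrightarrow> diagonal c (R h) (\<lambda>x. h x + z * R h x)"
      unfolding resolvent_set_def by blast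
    from R(1) obtain K where K: "\<And>f. f \<in> l2 M \<Longrightarrow> l2_norm M (R f) \<le> K * l2_norm M f"
      unfolding bounded_operator_def by blast
    have bound: "1 \<le> \<bar>c e - a\<bar> * K" if e: "e \<in> S" for e
    proof -
      have Re: "R e \<in> l2 M" using R(2)[OF basis_l2[OF e]] by (simp add: diagonal_def)
      have "l2_inner M (\<lambda>x. e x + z * R e x) e = complex_of_real (c e) * l2_inner M (R e) e"
        using R(2)[OF basis_l2[OF e]] e by (simp add: diagonal_def)
      then have "1 = (complex_of_real (c e) - z) * l2_inner M (R e) e"
        using e Re by (simp add: l2_inner_add_left l2_scale basis_l2 l2_inner_scale_left
            orthonormal_inner[OF orthonormal] algebra_simps)
      then have "1 = cmod (complex_of_real (c e - a)) * cmod (l2_inner M (R e) e)"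
        by (metis a(1) norm_mult norm_one of_real_diff)
      also have "\<dots> \<le> \<bar>c e - a\<bar> * K"
        unfolding norm_of_real
        using l2_Cauchy_Schwarz[OF Re basis_l2[OF e]] K[OF basis_l2[OF e]] basis_norm[OF e]
        by (intro mult_left_mono) auto
      finally show ?thesis .
    qed
    have "a \<notin> closure (c ` S)"
    proof (cases "S = {}")
      case False
      then obtain e0 where "e0 \<in> S" by blast
      have "K > 0"
      proof (rule ccontr)
        assume "\<not> K > 0"
        then have "\<bar>c e0 - a\<bar> * K \<le> 0" by (simp add: mult_nonneg_nonpos)
        with bound[OF \<open>e0 \<in> S\<close>] show False by linarith
      qed
      have "\<not> dist (c e) a < 1 / K" if "e \<in> S" for e
        using bound[OF that] \<open>K > 0\<close> by (simp add: dist_real_def field_simps)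
      then have "\<not> (\<exists>y\<in>c ` S. dist y a < 1 / K)" by blast
      moreover have "0 < 1 / K" using \<open>K > 0\<close> by simp
      ultimately show ?thesis unfolding closure_approachable by blast
    qed simp
    then show False using a by simp
  qed
  then show "z \<in> spectrum M (diagonal c)" by (simp add: spectrum_def)
qed

end

section \<open>Orthogonal families of finite-dimensional eigenspaces\<close>

text \<open>A vector that depends on its predecessors modulo a null set adds nothing to
  \<open>T\<close>. Hence \<open>T\<close> lies in the exact span of \<open>G\<close>, whereas
  \<open>G\<close> is recovered from \<open>T\<close> only almost everywhere.\<close>

lemma Gram_Schmidt:
  assumes "finite G" "G \<subseteq> l2 M"
  shows "\<exists>T. finite T \<and> orthonormal_set M T \<and> T \<subseteq> lspan G \<and>
    (\<forall>g\<in>G. \<exists>h\<in>lspan T. AE x in M. g x = h x)"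
  using assms
proof (induction G)
  case empty
  show ?case by (rule exI[of _ "{}"]) (simp add: orthonormal_set_def)
next
  case (insert v G)
  then obtain T where T: "finite T" "orthonormal_set M T" "T \<subseteq> lspan G"
    "\<forall>g\<in>G. \<exists>h\<in>lspan T. AE x in M. g x = h x" by auto
  have v: "v \<in> l2 M" using insert by simp
  let ?p = "expansion M v T"
  let ?w = "\<lambda>x. v x - ?p x"
  have p: "?p \<in> l2 M" "?p \<in> lspan T"
    using T by (auto intro: orthonormal_sum_l2 lspan_sum)
  have w: "?w \<in> l2 M" by (intro l2_diff v p)
  have G_sub: "lspan G \<subseteq> lspan (insert v G)" by (rule lspan_least) (auto intro: lspan_base)
  have T_sub: "T \<subseteq> lspan (insert v G)" using T G_sub by blast
  show ?case
  proof (cases "l2_norm M ?w = 0")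
    case True
    then have "AE x in M. ?w x = 0" using w by (simp only: l2_norm_eq_0_iff)
    then have "AE x in M. v x = ?p x" by simp
    with T p T_sub show ?thesis by (intro exI[of _ T]) auto
  next
    case False
    define a where "a = complex_of_real (1 / l2_norm M ?w)"
    define u where "u = (\<lambda>x. a * ?w x)"
    have u: "u \<in> l2 M" unfolding u_def by (intro l2_scale w)
    have uu: "l2_inner M u u = 1"
    proof -
      have "cmod a = 1 / l2_norm M ?w" unfolding a_def norm_of_real by simp
      then show ?thesis unfolding l2_inner_self u_def l2_norm_scale using False by simp
    qed
    have ut: "l2_inner M u t = 0" if t: "t \<in> T" for t
      unfolding u_def l2_inner_scale_left
      using orthonormal_inner_sum[OF T(2,1) subset_refl t, of "l2_inner M v"] t
      by (subst l2_inner_diff_left[OF v p(1) orthonormal_l2[OF T(2) t]]) simp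
    have tu: "l2_inner M t u = 0" if t: "t \<in> T" for t
      by (subst l2_inner_cnj) (simp add: ut[OF t])
    have "orthonormal_set M (insert u T)"
      unfolding orthonormal_set_def
    proof (intro conjI ballI)
      show "insert u T \<subseteq> l2 M" using u T by (auto simp: orthonormal_set_def)
      fix f g assume fg: "f \<in> insert u T" "g \<in> insert u T"
      have "u \<notin> T" using uu ut by force
      then show "l2_inner M f g = (if f = g then 1 else 0)"
        using fg uu ut tu orthonormal_inner[OF T(2), of f g] by auto
    qed
    moreover have pv: "?p \<in> lspan (insert v G)" using T_sub lspan_least[of T "insert v G"] p by blast
    have "(\<lambda>x. v x + (-1) * ?p x) \<in> lspan (insert v G)"
      by (intro lspan_add lspan_scale pv lspan_base) simp
    then have "?w \<in> lspan (insert v G)" by simp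
    then have "u \<in> lspan (insert v G)" unfolding u_def by (rule lspan_scale)
    moreover have "\<forall>g\<in>insert v G. \<exists>h\<in>lspan (insert u T). AE x in M. g x = h x"
    proof
      fix g assume "g \<in> insert v G"
      have sub: "lspan T \<subseteq> lspan (insert u T)" by (rule lspan_least) (auto intro: lspan_base)
      show "\<exists>h\<in>lspan (insert u T). AE x in M. g x = h x"
      proof (cases "g = v")
        case True
        have v_eq: "v x = complex_of_real (l2_norm M ?w) * u x + ?p x" for x
          using False by (simp add: u_def a_def)
        have "(\<lambda>x. complex_of_real (l2_norm M ?w) * u x + ?p x) \<in> lspan (insert u T)"
          using p(2) sub by (intro lspan_add lspan_scale[OF lspan_base]) auto
        then show ?thesis unfolding True by (rule bexI[rotated]) (rule AE_I2, rule v_eq)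
      next
        case False
        then show ?thesis using T(4) \<open>g \<in> insert v G\<close> sub by blast
      qed
    qed
    ultimately show ?thesis using T(1) T_sub by (intro exI[of _ "insert u T"] conjI) simp_all
  qed
qed

lemma bounded_operator_l2: "bounded_operator M P \<Longrightarrow> f \<in> l2 M \<Longrightarrow> P f \<in> l2 M"
  by (simp add: bounded_operator_def)

lemma bounded_operator_linear:
  "bounded_operator M P \<Longrightarrow> f \<in> l2 M \<Longrightarrow> g \<in> l2 M \<Longrightarrow>
    AE x in M. P (\<lambda>y. a * f y + b * g y) x = a * P f x + b * P g x"
  by (simp add: bounded_operator_def)

lemma bounded_operator_sum:
  assumes P: "bounded_operator M P" and f: "\<And>i. i \<in> F \<Longrightarrow> f i \<in> l2 M" and F: "finite F"
  shows "AE x in M. P (\<lambda>y. \<Sum>i\<in>F. a i * f i y) x = (\<Sum>i\<in>F. a i * P (f i) x)"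
  using F f
proof (induction F)
  case empty
  \<comment> \<open>Linearity with both coefficients 0 says that \<open>P\<close> maps 0 to 0 almost
    everywhere.\<close>
  show ?case using bounded_operator_linear[OF P l2_zero l2_zero, of 0 0] by simp
next
  case (insert i F)
  have "AE x in M. P (\<lambda>y. a i * f i y + 1 * (\<Sum>i\<in>F. a i * f i y)) x
      = a i * P (f i) x + 1 * P (\<lambda>y. \<Sum>i\<in>F. a i * f i y) x"
    using insert.prems by (intro bounded_operator_linear[OF P] l2_sum l2_scale) auto
  moreover have "AE x in M. P (\<lambda>y. \<Sum>i\<in>F. a i * f i y) x = (\<Sum>i\<in>F. a i * P (f i) x)"
    using insert by simp
  ultimately have "AE x in M. P (\<lambda>y. a i * f i y + 1 * (\<Sum>i\<in>F. a i * f i y)) x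
      = a i * P (f i) x + (\<Sum>i\<in>F. a i * P (f i) x)"
    by eventually_elim simp
  then show ?case using insert(1,2) by simp
qed

text \<open>The index type is free, so that the constants can join the balls as one more index.
  Distinct indices may share an eigenvalue, as balls of equal radius do, so orthogonality is assumed
  separately from \<open>eigen\<close>.\<close>

locale l2_eigenspaces =
  fixes M :: "'a measure" and I :: "'i set" and H :: "'i \<Rightarrow> ('a \<Rightarrow> complex) set"
    and P :: "('a \<Rightarrow> complex) \<Rightarrow> 'a \<Rightarrow> complex" and ev :: "'i \<Rightarrow> real"
  assumes finite_dim: "\<And>i. i \<in> I \<Longrightarrow> \<exists>G. finite G \<and> G \<subseteq> l2 M \<and> H i = lspan G"
    and orthogonal: "\<And>i j f g. i \<in> I \<Longrightarrow> j \<in> I \<Longrightarrow> i \<noteq> j \<Longrightarrow> f \<in> H i \<Longrightarrow> g \<in> H j \<Longrightarrow> l2_inner M f g = 0"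
    and nontrivial: "\<And>i. i \<in> I \<Longrightarrow> \<exists>f\<in>H i. \<not> (AE x in M. f x = 0)"
    and complete: "\<And>f. f \<in> l2 M \<Longrightarrow> (\<And>i h. i \<in> I \<Longrightarrow> h \<in> H i \<Longrightarrow> l2_inner M f h = 0) \<Longrightarrow> AE x in M. f x = 0"
    and bounded: "bounded_operator M P"
    and eigen: "\<And>i f. i \<in> I \<Longrightarrow> f \<in> H i \<Longrightarrow> AE x in M. P f x = complex_of_real (ev i) * f x"
begin

lemma H_l2: "i \<in> I \<Longrightarrow> H i \<subseteq> l2 M"
  by (drule finite_dim, elim exE conjE) (simp add: lspan_subset_l2)

lemma ex_basis:
  assumes i: "i \<in> I"
  shows "\<exists>T. finite T \<and> orthonormal_set M T \<and> T \<subseteq> H i \<and>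
    (\<forall>g\<in>H i. \<exists>h\<in>lspan T. AE x in M. g x = h x)"
proof -
  obtain G where G: "finite G" "G \<subseteq> l2 M" "H i = lspan G" using finite_dim[OF i] by blast
  obtain T where T: "finite T" "orthonormal_set M T" "T \<subseteq> lspan G"
    and span: "\<forall>g\<in>G. \<exists>h\<in>lspan T. AE x in M. g x = h x"
    using Gram_Schmidt[OF G(1,2)] by blast
  have "\<exists>h\<in>lspan T. AE x in M. g x = h x" if "g \<in> lspan G" for g
    using that
  proof (induction rule: lspan_induct)
    case zero
    show ?case using lspan_zero by (intro bexI[of _ "\<lambda>x. 0"]) auto
  next
    case (add f g)
    then obtain h k where "h \<in> lspan T" "AE x in M. f x = h x" "k \<in> lspan T" "AE x in M. g x = k x" by blast
    then show ?case by (intro bexI[of _ "\<lambda>x. h x + k x"] lspan_add) auto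
  next
    case (scale a g)
    then obtain h where "h \<in> lspan T" "AE x in M. g x = h x" using span by blast
    then show ?case by (intro bexI[of _ "\<lambda>x. a * h x"] lspan_scale) auto
  qed
  then show ?thesis unfolding G(3) using T by (intro exI[of _ T] conjI ballI)
qed

definition basis :: "'i \<Rightarrow> ('a \<Rightarrow> complex) set" where
  "basis i = (SOME T. finite T \<and> orthonormal_set M T \<and> T \<subseteq> H i \<and>
    (\<forall>g\<in>H i. \<exists>h\<in>lspan T. AE x in M. g x = h x))"

lemma basis:
  assumes "i \<in> I"
  shows "finite (basis i)" "orthonormal_set M (basis i)" "basis i \<subseteq> H i"
    "\<forall>g\<in>H i. \<exists>h\<in>lspan (basis i). AE x in M. g x = h x"
proof -
  have *: "finite (basis i) \<and> orthonormal_set M (basis i) \<and> basis i \<subseteq> H i \<and>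
      (\<forall>g\<in>H i. \<exists>h\<in>lspan (basis i). AE x in M. g x = h x)"
    unfolding basis_def by (rule someI_ex[OF ex_basis[OF assms]])
  show "finite (basis i)" by (rule *[THEN conjunct1])
  show "orthonormal_set M (basis i)" by (rule *[THEN conjunct2, THEN conjunct1])
  show "basis i \<subseteq> H i" by (rule *[THEN conjunct2, THEN conjunct2, THEN conjunct1])
  show "\<forall>g\<in>H i. \<exists>h\<in>lspan (basis i). AE x in M. g x = h x"
    by (rule *[THEN conjunct2, THEN conjunct2, THEN conjunct2])
qed

abbreviation whole_basis :: "('a \<Rightarrow> complex) set" where
  "whole_basis \<equiv> \<Union>i\<in>I. basis i"

lemma basis_self: "i \<in> I \<Longrightarrow> e \<in> basis i \<Longrightarrow> l2_inner M e e = 1"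
  using orthonormal_inner[OF basis(2)] by simp

lemma basis_disjoint:
  assumes "i \<in> I" "j \<in> I" "e \<in> basis i" "e \<in> basis j" shows "i = j"
proof (rule ccontr)
  assume "i \<noteq> j"
  then have "l2_inner M e e = 0" using orthogonal[of i j e e] basis(3) assms by blast
  then show False using basis_self[OF assms(1,3)] by simp
qed

lemma orthonormal_whole_basis: "orthonormal_set M whole_basis"
  unfolding orthonormal_set_def
proof (intro conjI ballI)
  show "whole_basis \<subseteq> l2 M" using basis(3) H_l2 by blast
  fix e e' assume "e \<in> whole_basis" "e' \<in> whole_basis"
  then obtain i j where ij: "i \<in> I" "e \<in> basis i" "j \<in> I" "e' \<in> basis j" by blast
  show "l2_inner M e e' = (if e = e' then 1 else 0)"
  proof (cases "i = j")
    case True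
    then show ?thesis using ij orthonormal_inner[OF basis(2)[OF ij(1)]] by simp
  next
    case False
    then have "l2_inner M e e' = 0" using ij basis(3) orthogonal[of i j e e'] by blast
    moreover have "e \<noteq> e'" using ij False basis_disjoint by blast
    ultimately show ?thesis by simp
  qed
qed

text \<open>\<open>basis i\<close> spans \<open>H i\<close> up to null sets only, which the inner
  product does not see.\<close>

lemma inner_eq_0:
  assumes f: "f \<in> l2 M" and i: "i \<in> I" and z: "\<And>e. e \<in> basis i \<Longrightarrow> l2_inner M f e = 0" and h: "h \<in> H i"
  shows "l2_inner M f h = 0"
proof -
  have sub: "lspan (basis i) \<subseteq> l2 M" using basis(3)[OF i] H_l2[OF i] by (intro lspan_subset_l2) blast
  have "g \<in> l2 M \<and> l2_inner M f g = 0" if "g \<in> lspan (basis i)" for g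
    using that
  proof (induction rule: lspan_induct)
    case (scale a g)
    then show ?case using z sub lspan_base[of g "basis i"]
      by (auto simp: l2_inner_scale_right intro: l2_scale)
  qed (auto simp: l2_inner_add_right f intro: l2_add)
  moreover obtain g where "g \<in> lspan (basis i)" "AE x in M. h x = g x" using basis(4)[OF i] h by blast
  ultimately show ?thesis
    using l2_inner_cong_AE[OF f f, of h g] subsetD[OF H_l2[OF i] h] by simp
qed

sublocale l2_basis M whole_basis
proof
  show "orthonormal_set M whole_basis" by (rule orthonormal_whole_basis)
  fix f assume f: "f \<in> l2 M" and z: "\<And>e. e \<in> whole_basis \<Longrightarrow> l2_inner M f e = 0"
  show "AE x in M. f x = 0"
  proof (rule complete[OF f])
    fix i h assume i: "i \<in> I" and h: "h \<in> H i"
    show "l2_inner M f h = 0"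
    proof (rule inner_eq_0[OF f i _ h])
      fix e assume "e \<in> basis i"
      with i show "l2_inner M f e = 0" by (intro z UN_I)
    qed
  qed
qed

text \<open>Diagonal operators take their eigenvalues as a function of the basis vector;
  \<open>basis_disjoint\<close> makes the index of a vector unique.\<close>

definition eigenvalue_of :: "('a \<Rightarrow> complex) \<Rightarrow> real" where
  "eigenvalue_of e = ev (THE i. i \<in> I \<and> e \<in> basis i)"

lemma eigenvalue_of: assumes "i \<in> I" "e \<in> basis i" shows "eigenvalue_of e = ev i"
proof -
  have "(THE i. i \<in> I \<and> e \<in> basis i) = i" using assms basis_disjoint by (intro the_equality) auto
  then show ?thesis by (simp add: eigenvalue_of_def)
qed

lemma P_basis:
  assumes "e \<in> whole_basis" shows "AE x in M. P e x = complex_of_real (eigenvalue_of e) * e x"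
proof -
  obtain i where i: "i \<in> I" "e \<in> basis i" using assms by blast
  show ?thesis unfolding eigenvalue_of[OF i] using i basis(3) by (intro eigen) auto
qed

text \<open>Boundedness of \<open>P\<close> carries the identity from finite expansions to
  \<open>f\<close>: the coefficient at \<open>e\<close> of the image of an expansion over
  \<open>G\<close> has its final value as soon as \<open>e\<close> belongs to
  \<open>G\<close>.\<close>

lemma P_inner:
  assumes f: "f \<in> l2 M" and e: "e \<in> whole_basis"
  shows "l2_inner M (P f) e = complex_of_real (eigenvalue_of e) * l2_inner M f e"
proof -
  let ?p = "expansion M f" and ?A = "finite_subsets_at_top whole_basis"
  note Pl2 = bounded_operator_l2[OF bounded]
  have p: "?p G \<in> l2 M" if "G \<subseteq> whole_basis" for G by (rule orthonormal_sum_l2[OF orthonormal_whole_basis that])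
  obtain K where K: "\<And>f. f \<in> l2 M \<Longrightarrow> l2_norm M (P f) \<le> K * l2_norm M f"
    using bounded unfolding bounded_operator_def by blast
  have "((\<lambda>G. l2_norm M (\<lambda>x. P (?p G) x - P f x)) \<longlongrightarrow> 0) ?A"
  proof (rule Lim_null_comparison)
    show "((\<lambda>G. K * l2_norm M (\<lambda>x. ?p G x - f x)) \<longlongrightarrow> 0) ?A"
      using tendsto_mult_left[OF expansion_tendsto[OF f]] by simp
    show "\<forall>\<^sub>F G in ?A. norm (l2_norm M (\<lambda>x. P (?p G) x - P f x)) \<le> K * l2_norm M (\<lambda>x. ?p G x - f x)"
    proof (rule eventually_finite_subsets_at_top_weakI)
      fix G assume G: "G \<subseteq> whole_basis"
      have "AE x in M. P (\<lambda>y. 1 * ?p G y + (-1) * f y) x = 1 * P (?p G) x + (-1) * P f x"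
        by (rule bounded_operator_linear[OF bounded p[OF G] f])
      then have "l2_norm M (\<lambda>x. P (?p G) x - P f x) = l2_norm M (P (\<lambda>y. ?p G y - f y))"
        by (intro l2_norm_cong_AE l2_diff Pl2 p[OF G] f) (simp add: eq_commute)
      then show "norm (l2_norm M (\<lambda>x. P (?p G) x - P f x)) \<le> K * l2_norm M (\<lambda>x. ?p G x - f x)"
        using K[OF l2_diff[OF p[OF G] f]] by simp
    qed
  qed
  then have lim: "((\<lambda>G. l2_inner M (P (?p G)) e) \<longlongrightarrow> l2_inner M (P f) e) ?A"
    by (intro l2_inner_tendsto eventually_finite_subsets_at_top_weakI Pl2 p f basis_l2 e)
  have const: "\<forall>\<^sub>F G in ?A. l2_inner M (P (?p G)) e = complex_of_real (eigenvalue_of e) * l2_inner M f e"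
    unfolding eventually_finite_subsets_at_top
  proof (rule exI[of _ "{e}"], intro conjI allI impI)
    fix G assume "finite G \<and> {e} \<subseteq> G \<and> G \<subseteq> whole_basis"
    then have G: "finite G" "G \<subseteq> whole_basis" "e \<in> G" by auto
    let ?c = "\<lambda>h. l2_inner M f h * complex_of_real (eigenvalue_of h)"
    have "AE x in M. P (?p G) x = (\<Sum>h\<in>G. l2_inner M f h * P h x)"
      using G by (intro bounded_operator_sum[OF bounded] basis_l2) auto
    moreover have "AE x in M. \<forall>h\<in>G. P h x = complex_of_real (eigenvalue_of h) * h x"
      using G P_basis by (intro AE_finite_allI) auto
    ultimately have "AE x in M. P (?p G) x = (\<Sum>h\<in>G. ?c h * h x)"
      by eventually_elim (simp add: mult.assoc)
    then have "l2_inner M (P (?p G)) e = l2_inner M (\<lambda>x. \<Sum>h\<in>G. ?c h * h x) e"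
      using e by (intro l2_inner_cong_AE Pl2 p orthonormal_sum_l2[OF orthonormal_whole_basis] G(2) basis_l2) auto
    also have "\<dots> = complex_of_real (eigenvalue_of e) * l2_inner M f e"
      using orthonormal_inner_sum[OF orthonormal_whole_basis G(1,2) e, of ?c] G(3) by (simp add: mult.commute)
    finally show "l2_inner M (P (?p G)) e = complex_of_real (eigenvalue_of e) * l2_inner M f e" .
  qed (use e in auto)
  show ?thesis
    by (rule tendsto_unique[OF finite_subsets_at_top_neq_bot lim tendsto_eventually[OF const]])
qed

lemma graph_of_diagonal: "graph_of M P = diagonal eigenvalue_of"
proof (intro ext)
  fix f g
  show "graph_of M P f g = diagonal eigenvalue_of f g"
  proof (cases "f \<in> l2 M \<and> g \<in> l2 M")
    case True
    then have f: "f \<in> l2 M" and g: "g \<in> l2 M" by auto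
    have "(AE x in M. g x = P f x) \<longleftrightarrow>
        (\<forall>e\<in>whole_basis. l2_inner M g e = complex_of_real (eigenvalue_of e) * l2_inner M f e)"
      unfolding eq_AE_iff[OF g bounded_operator_l2[OF bounded f]]
      by (rule ball_cong[OF refl]) (simp only: P_inner[OF f])
    then show ?thesis unfolding graph_of_def diagonal_def by simp
  next
    case False
    then show ?thesis unfolding graph_of_def diagonal_def by blast
  qed
qed

lemma functional_calculus_graph_of:
  "\<phi> \<in> borel_measurable borel \<Longrightarrow>
    functional_calculus M \<phi> (graph_of M P) = diagonal (\<lambda>e. \<phi> (eigenvalue_of e))"
  unfolding graph_of_diagonal by (rule functional_calculus_diagonal)

lemma pure_point_spectrum_calculus:
  "\<phi> \<in> borel_measurable borel \<Longrightarrow> pure_point_spectrum M (functional_calculus M \<phi> (graph_of M P))"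
  by (simp only: functional_calculus_graph_of pure_point_spectrum_diagonal)

text \<open>Every index thus contributes its eigenvalue to the spectrum.\<close>

lemma basis_nonempty: assumes i: "i \<in> I" shows "basis i \<noteq> {}"
proof
  assume "basis i = {}"
  then have "lspan (basis i) = {\<lambda>x. 0}" by (simp add: lspan_finite)
  then have "\<forall>g\<in>H i. AE x in M. g x = 0" using basis(4)[OF i] by simp
  then show False using nontrivial[OF i] by blast
qed

lemma spectrum_calculus:
  assumes "\<phi> \<in> borel_measurable borel"
  shows "spectrum M (functional_calculus M \<phi> (graph_of M P)) = complex_of_real ` closure ((\<lambda>i. \<phi> (ev i)) ` I)"
proof -
  have "(\<lambda>e. \<phi> (eigenvalue_of e)) ` whole_basis = (\<lambda>i. \<phi> (ev i)) ` I"
  proof (intro equalityI subsetI)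
    fix t assume "t \<in> (\<lambda>e. \<phi> (eigenvalue_of e)) ` whole_basis"
    then show "t \<in> (\<lambda>i. \<phi> (ev i)) ` I" by (auto simp: eigenvalue_of)
  next
    fix t assume "t \<in> (\<lambda>i. \<phi> (ev i)) ` I"
    then obtain i where i: "i \<in> I" "t = \<phi> (ev i)" by blast
    obtain e where "e \<in> basis i" using basis_nonempty[OF i(1)] by blast
    then show "t \<in> (\<lambda>e. \<phi> (eigenvalue_of e)) ` whole_basis"
      using i by (intro image_eqI[of _ _ e]) (auto simp: eigenvalue_of)
  qed
  then show ?thesis
    by (simp only: functional_calculus_graph_of[OF assms] spectrum_diagonal)
qed

text \<open>By orthogonality an element of \<open>H i\<close> has nonzero coefficients only at
  \<open>basis i\<close>, where the transformed eigenvalue is constant.\<close>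

lemma eigenspace_calculus:
  assumes \<phi>: "\<phi> \<in> borel_measurable borel" and i: "i \<in> I"
  shows "H i \<subseteq> eigenspace M (functional_calculus M \<phi> (graph_of M P)) (complex_of_real (\<phi> (ev i)))"
proof
  fix f assume f: "f \<in> H i"
  show "f \<in> eigenspace M (functional_calculus M \<phi> (graph_of M P)) (complex_of_real (\<phi> (ev i)))"
    unfolding functional_calculus_graph_of[OF \<phi>]
  proof (rule eigenspace_diagonalI)
    show "f \<in> l2 M" using f H_l2[OF i] by blast
    fix e assume "e \<in> whole_basis"
    then obtain j where j: "j \<in> I" "e \<in> basis j" by blast
    show "l2_inner M f e = 0 \<or> \<phi> (eigenvalue_of e) = \<phi> (ev i)"
    proof (cases "j = i")
      case True then show ?thesis using j by (simp add: eigenvalue_of)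
    next
      case False
      then have "l2_inner M f e = 0"
        by (intro orthogonal[OF i j(1) _ f] subsetD[OF basis(3) j(2)] j(1)) simp
      then show ?thesis ..
    qed
  qed
qed

text \<open>The Fourier expansion with its terms grouped by index. Its convergence along finite
  subsets of the whole basis passes to the blocks because each block is finite.\<close>

lemma decomposition: "orthogonal_sum_decomposition M I H"
  unfolding orthogonal_sum_decomposition_def
proof (intro conjI ballI impI)
  show "H i \<subseteq> l2 M" if "i \<in> I" for i using that by (rule H_l2)
  show "l2_inner M f g = 0" if "i \<in> I" "j \<in> I" "i \<noteq> j" "f \<in> H i" "g \<in> H j" for i j f g
    using that by (rule orthogonal)
  fix f assume f: "f \<in> l2 M"
  define g where "g i x = (\<Sum>e\<in>basis i. l2_inner M f e * e x)" for i x
  have "g i \<in> H i" if i: "i \<in> I" for i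
  proof -
    obtain G where G: "H i = lspan G" using finite_dim[OF i] by blast
    show ?thesis unfolding g_def[abs_def] G
      by (intro lspan_sums lspan_scale) (use basis(3)[OF i] G in auto)
  qed
  moreover have "((\<lambda>J. l2_norm M (\<lambda>x. f x - (\<Sum>i\<in>J. g i x))) \<longlongrightarrow> 0) (finite_subsets_at_top I)"
    unfolding tendsto_iff eventually_finite_subsets_at_top
  proof (intro allI impI)
    fix r :: real assume "r > 0"
    obtain F where F: "finite F" "F \<subseteq> whole_basis" "\<forall>G. finite G \<and> F \<subseteq> G \<and> G \<subseteq> whole_basis \<longrightarrow>
        l2_norm M (\<lambda>x. f x - expansion M f G x) < r"
      using finite_approximation[OF f \<open>r > 0\<close>] by (elim exE conjE)
    have "\<forall>e\<in>F. \<exists>i. i \<in> I \<and> e \<in> basis i" using F by blast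
    \<comment> \<open>\<open>k\<close> sends a basis vector to the index of its block, so the blocks
      of any index set containing the image of \<open>F\<close> cover \<open>F\<close>.\<close>
    then obtain k where k: "\<And>e. e \<in> F \<Longrightarrow> k e \<in> I \<and> e \<in> basis (k e)" by metis
    show "\<exists>X. finite X \<and> X \<subseteq> I \<and> (\<forall>Y. finite Y \<and> X \<subseteq> Y \<and> Y \<subseteq> I \<longrightarrow>
        dist (l2_norm M (\<lambda>x. f x - (\<Sum>i\<in>Y. g i x))) 0 < r)"
    proof (rule exI[of _ "k ` F"], intro conjI allI impI)
      show "finite (k ` F)" "k ` F \<subseteq> I" using F k by auto
      fix Y assume Y: "finite Y \<and> k ` F \<subseteq> Y \<and> Y \<subseteq> I"
      have "(\<Sum>i\<in>Y. g i x) = (\<Sum>h\<in>(\<Union>i\<in>Y. basis i). l2_inner M f h * h x)" for x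
        unfolding g_def
      proof (rule sum.UNION_disjoint[symmetric])
        show "finite Y" using Y by simp
        show "\<forall>i\<in>Y. finite (basis i)" using Y basis(1) by auto
        show "\<forall>i\<in>Y. \<forall>j\<in>Y. i \<noteq> j \<longrightarrow> basis i \<inter> basis j = {}"
        proof (intro ballI impI)
          fix i j assume "i \<in> Y" "j \<in> Y" "i \<noteq> j"
          then show "basis i \<inter> basis j = {}" using basis_disjoint[of i j] Y by auto
        qed
      qed
      moreover have "finite (\<Union>i\<in>Y. basis i)" using Y basis(1) by auto
      moreover have "F \<subseteq> (\<Union>i\<in>Y. basis i)" using Y k by auto
      moreover have "(\<Union>i\<in>Y. basis i) \<subseteq> whole_basis" using Y by auto
      ultimately show "dist (l2_norm M (\<lambda>x. f x - (\<Sum>i\<in>Y. g i x))) 0 < r"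
        using F(3) by simp
    qed
  qed
  ultimately show "\<exists>g. (\<forall>i\<in>I. g i \<in> H i) \<and>
      ((\<lambda>J. l2_norm M (\<lambda>x. f x - (\<Sum>i\<in>J. g i x))) \<longlongrightarrow> 0) (finite_subsets_at_top I)"
    by (intro exI[of _ g]) simp
qed

end

section \<open>Balls in a proper ultrametric space\<close>

locale proper_ultrametric_measure =
  fixes \<mu> :: "'a::metric_space measure"
  assumes ultra: "\<And>x y z :: 'a. dist x z \<le> max (dist x y) (dist y z)"
    and separable: "\<exists>D :: 'a set. countable D \<and> closure D = UNIV"
    and proper: "\<And>(x :: 'a) r. compact (cball x r)"
    and radon: "radon_measure \<mu>"
    and support: "full_support \<mu>"
begin

section \<open>Clopen balls, attained radii and children\<close>

lemma dist_lt: "dist x y < r \<Longrightarrow> dist y z < r \<Longrightarrow> dist x z < r" for x y z :: 'a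
  using ultra[of x z y] by linarith

lemma dist_le: "dist x y \<le> r \<Longrightarrow> dist y z \<le> r \<Longrightarrow> dist x z \<le> r" for x y z :: 'a
  using ultra[of x z y] by linarith

lemma ball_eq:
  fixes x y :: 'a
  assumes "dist x y < r"
  shows "ball x r = ball y r"
  using assms dist_lt[of x y r] dist_lt[of y x r] by (auto simp: dist_commute)

lemma cball_eq:
  fixes x y :: 'a
  assumes "dist x y \<le> r"
  shows "cball x r = cball y r"
  using assms dist_le[of x y r] dist_le[of y x r] by (auto simp: dist_commute)

text \<open>With each of its points a closed ball contains the open ball of the same radius around
  that point.\<close>

lemma open_cball:
  fixes x :: 'a
  assumes "0 < r"
  shows "open (cball x r)"
proof -
  have "cball x r = (\<Union>y\<in>cball x r. ball y r)"
  proof (intro equalityI subsetI)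
    fix z assume "z \<in> (\<Union>y\<in>cball x r. ball y r)"
    then obtain y where "dist x y \<le> r" "dist y z < r" by auto
    then show "z \<in> cball x r" using dist_le[of x y r z] by simp
  next
    fix z assume "z \<in> cball x r"
    then show "z \<in> (\<Union>y\<in>cball x r. ball y r)" using assms by (intro UN_I[of z]) auto
  qed
  then show ?thesis by (metis open_UN open_ball)
qed

lemma closed_ball: "closed (ball x r)" for x :: 'a
proof (cases "0 < r")
  case True
  have "- ball x r = (\<Union>y\<in>- ball x r. ball y r)"
  proof (intro equalityI subsetI)
    fix z assume "z \<in> (\<Union>y\<in>- ball x r. ball y r)"
    then obtain y where "\<not> dist x y < r" "dist y z < r" by auto
    then show "z \<in> - ball x r" using dist_lt[of x z r y] by (auto simp: dist_commute)
  next
    fix z assume "z \<in> - ball x r"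
    then show "z \<in> (\<Union>y\<in>- ball x r. ball y r)" using True by (intro UN_I[of z]) auto
  qed
  then have "open (- ball x r)" by (metis open_UN open_ball)
  then show ?thesis by (simp add: closed_def)
qed (simp add: ball_empty)

lemma compact_ball: "compact (ball x r)" for x :: 'a
  using compact_Int_closed[OF proper[of x r] closed_ball[of x r]] by (simp add: inf_absorb2 ball_subset_cball)

lemma farthest_point:
  fixes x :: 'a
  assumes "compact C" "C \<noteq> {}"
  shows "\<exists>y\<in>C. \<forall>z\<in>C. dist x z \<le> dist x y"
  using assms by (intro continuous_attains_sup continuous_intros)

lemma is_ball_cball: "0 \<le> r \<Longrightarrow> is_ball (cball x r)" for x :: 'a
  unfolding is_ball_def by blast

text \<open>By compactness the distance from the centre attains its maximum on the ball. This normal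
  form, with an attained distance as radius, is the one in which balls are handled from here
  on.\<close>

lemma cball_eq_dist:
  fixes x :: 'a
  assumes "0 \<le> r"
  shows "\<exists>y. cball x r = cball x (dist x y)"
proof -
  obtain y where y: "y \<in> cball x r" "\<forall>z\<in>cball x r. dist x z \<le> dist x y"
    using farthest_point[OF proper[of x r]] assms by (metis centre_in_cball empty_iff)
  then have "cball x r = cball x (dist x y)" by auto
  then show ?thesis by blast
qed

text \<open>Open balls are compact too, so their largest distance from the centre is attained and
  strictly below \<open>r\<close>. It may be 0, when the centre is isolated.\<close>

lemma ball_eq_dist:
  fixes x :: 'a
  assumes "0 < r"
  shows "\<exists>y. dist x y < r \<and> ball x r = cball x (dist x y)"
proof -
  obtain y where y: "y \<in> ball x r" "\<forall>z\<in>ball x r. dist x z \<le> dist x y"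
    using farthest_point[OF compact_ball[of x r]] assms by (metis centre_in_ball empty_iff)
  have "dist x y < r" using y(1) by simp
  moreover from y have "ball x r = cball x (dist x y)" by auto
  ultimately show ?thesis by blast
qed

lemma is_ball_ball:
  fixes x :: 'a
  assumes "0 < r"
  shows "is_ball (ball x r)"
  using ball_eq_dist[OF assms, of x] is_ball_cball by (metis zero_le_dist)

lemma is_ball_centre:
  fixes z :: 'a
  assumes "is_ball B" "z \<in> B"
  shows "\<exists>r\<ge>0. B = cball z r"
proof -
  obtain x r where "0 \<le> r" "B = cball x r" using assms(1) by (auto simp: is_ball_def)
  then show ?thesis using assms(2) cball_eq[of x z r] by auto
qed

lemma is_ballE:
  assumes "is_ball B"
  obtains x y :: 'a where "B = cball x (dist x y)"
proof -
  obtain x r where r: "0 \<le> r" "B = cball x r" using assms by (auto simp: is_ball_def)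
  obtain y where "cball x r = cball x (dist x y)" using cball_eq_dist[OF r(1)] by blast
  with r(2) show ?thesis using that by simp
qed

text \<open>Any ball that contains a point \<open>z\<close> is centred there. If its radius is below
  \<open>dist x y\<close> it lies in the open ball around \<open>z\<close>, otherwise it contains
  the whole ball; nothing fits strictly in between.\<close>

lemma child_ball_iff:
  fixes x y :: 'a
  assumes "x \<noteq> y"
  shows "child_ball C (cball x (dist x y)) \<longleftrightarrow> (\<exists>z\<in>cball x (dist x y). C = ball z (dist x y))"
proof -
  let ?R = "dist x y" let ?B = "cball x ?R"
  have R: "0 < ?R" using assms by simp
  have B: "?B = cball z ?R" if "z \<in> ?B" for z using that by (intro cball_eq) simp
  have psub: "ball z ?R \<subset> ?B" if z: "z \<in> ?B" for z
  proof -
    have "ball z ?R \<subseteq> ?B" unfolding B[OF z] by auto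
    \<comment> \<open>Strictness of the inclusion comes from the radius being attained: two points
      of one open ball of this radius are closer than \<open>dist x y\<close>.\<close>
    moreover have "\<not> (x \<in> ball z ?R \<and> y \<in> ball z ?R)"
      using dist_lt[of x z ?R y] by (auto simp: dist_commute)
    moreover have "x \<in> ?B" "y \<in> ?B" by auto
    ultimately show ?thesis by blast
  qed
  have between: "A = ball z ?R \<or> A = ?B" if A: "is_ball A" "ball z ?R \<subseteq> A" "A \<subseteq> ?B" and z: "z \<in> ?B" for A z
  proof -
    have "z \<in> A" using A(2) R by auto
    then obtain s where s: "0 \<le> s" "A = cball z s" using is_ball_centre[OF A(1)] by blast
    show ?thesis
    proof (cases "s < ?R")
      case True
      then have "A \<subseteq> ball z ?R" using s by auto
      with A show ?thesis by blast
    next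
      case False
      then have "?B \<subseteq> A" unfolding B[OF z] using s by auto
      with A show ?thesis by blast
    qed
  qed
  show ?thesis
  proof
    assume C: "child_ball C ?B"
    then have C': "is_ball C" "C \<subset> ?B" by (auto simp: child_ball_def)
    then have "C \<noteq> {}" by (auto simp: is_ball_def)
    then obtain z where z: "z \<in> C" by blast
    then have zB: "z \<in> ?B" using C' by blast
    obtain s where s: "0 \<le> s" "C = cball z s" using is_ball_centre[OF C'(1) z] by blast
    have "s < ?R"
    proof (rule ccontr)
      assume "\<not> s < ?R"
      then have "?B \<subseteq> C" unfolding B[OF zB] using s by auto
      with C' show False by blast
    qed
    then have "C \<subseteq> ball z ?R" using s by auto
    then have "ball z ?R = C \<or> ball z ?R = ?B"
      using C is_ball_ball[OF R, of z] psub[OF zB] unfolding child_ball_def by blast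
    then show "\<exists>z\<in>?B. C = ball z ?R" using psub[OF zB] zB by blast
  next
    assume "\<exists>z\<in>?B. C = ball z ?R"
    then obtain z where z: "z \<in> ?B" "C = ball z ?R" by blast
    show "child_ball C ?B"
      unfolding child_ball_def z(2)
      using is_ball_ball[OF R, of z] is_ball_cball[of ?R x] psub[OF z(1)] between[OF _ _ _ z(1)] by auto
  qed
qed

text \<open>Balls of equal radius that meet are equal, so a finite subcover already contains all of
  them.\<close>

lemma finite_subballs:
  fixes K :: "'a set"
  assumes "0 < r" "compact K" shows "finite ((\<lambda>z. ball z r) ` K)"
proof -
  have "K \<subseteq> \<Union>((\<lambda>z. ball z r) ` K)" using assms(1) by auto
  then obtain T where T: "T \<subseteq> (\<lambda>z. ball z r) ` K" "finite T" "K \<subseteq> \<Union>T"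
    by (rule compactE[OF assms(2)]) auto
  have "(\<lambda>z. ball z r) ` K \<subseteq> T"
  proof
    fix C assume "C \<in> (\<lambda>z. ball z r) ` K"
    then obtain z where z: "z \<in> K" "C = ball z r" by blast
    from subsetD[OF T(3) z(1)] obtain B where B: "z \<in> B" "B \<in> T" by (rule UnionE)
    from subsetD[OF T(1) B(2)] obtain w where w: "B = ball w r" by (rule imageE)
    have "B = ball z r" unfolding w by (rule ball_eq) (use B w in simp)
    then show "C \<in> T" using B z by simp
  qed
  then show ?thesis using T(2) finite_subset by blast
qed

text \<open>If \<open>dist x y\<close> is at least \<open>r\<close>, the distance from
  \<open>x\<close> is constant on \<open>ball y r\<close>, and any point of that ball shows it. The
  annulus is compact, so only finitely many such balls occur. This makes chains of children
  finite.\<close>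

lemma finite_distances:
  fixes x :: 'a
  assumes "0 < r"
  shows "finite {dist x y | y. r \<le> dist x y \<and> dist x y \<le> s}"
proof -
  let ?K = "cball x s - ball x r"
  have "compact ?K" by (intro compact_diff proper) simp
  then have fin: "finite ((\<lambda>z. ball z r) ` ?K)" by (rule finite_subballs[OF assms])
  define g where "g C = dist x (SOME y. y \<in> C)" for C :: "'a set"
  have "{dist x y | y. r \<le> dist x y \<and> dist x y \<le> s} \<subseteq> g ` (\<lambda>z. ball z r) ` ?K"
  proof
    fix t assume "t \<in> {dist x y | y. r \<le> dist x y \<and> dist x y \<le> s}"
    then obtain y where y: "t = dist x y" "r \<le> dist x y" "dist x y \<le> s" by blast
    define w where "w = (SOME w. w \<in> ball y r)"
    have "w \<in> ball y r" unfolding w_def using assms by (intro someI[of "\<lambda>w. w \<in> ball y r" y]) simp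
    then have "dist x w = dist x y" using ultra[of x w y] ultra[of x y w] y(2) by (simp add: dist_commute)
    then have "t = g (ball y r)" by (simp add: g_def w_def y(1))
    then show "t \<in> g ` (\<lambda>z. ball z r) ` ?K" using y by auto
  qed
  then show ?thesis using fin finite_subset by blast
qed

section \<open>Measures of balls\<close>

lemma sets_\<mu> [simp, measurable_cong]: "sets \<mu> = sets borel"
  by (rule radon[unfolded radon_measure_def, THEN conjunct1])

lemma space_\<mu> [simp]: "space \<mu> = UNIV"
  using sets_eq_imp_space_eq[OF sets_\<mu>] by simp

lemma emeasure_compact_finite: "compact K \<Longrightarrow> emeasure \<mu> K < \<infinity>"
  by (rule radon[unfolded radon_measure_def, THEN conjunct2, THEN conjunct1, rule_format])

lemma emeasure_cball_finite: "emeasure \<mu> (cball x r) < \<infinity>"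
  by (rule emeasure_compact_finite[OF proper])

lemma emeasure_ball_finite: "emeasure \<mu> (ball x r) < \<infinity>"
  by (rule emeasure_compact_finite[OF compact_ball])

lemma emeasure_cball: "emeasure \<mu> (cball x r) = ennreal (measure \<mu> (cball x r))"
  using emeasure_cball_finite[of x r] by (intro emeasure_eq_ennreal_measure) simp

lemma emeasure_ball: "emeasure \<mu> (ball x r) = ennreal (measure \<mu> (ball x r))"
  using emeasure_ball_finite[of x r] by (intro emeasure_eq_ennreal_measure) simp

lemma measure_cball_pos: assumes "0 < r" shows "0 < measure \<mu> (cball x r)"
proof -
  have "0 < emeasure \<mu> (cball x r)"
    using support open_cball[OF assms] assms by (auto simp: full_support_def)
  then show ?thesis by (simp add: emeasure_cball)
qed

lemma measure_ball_pos: assumes "0 < r" shows "0 < measure \<mu> (ball x r)"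
proof -
  have "0 < emeasure \<mu> (ball x r)"
    using support assms by (auto simp: full_support_def)
  then show ?thesis by (simp add: emeasure_ball)
qed

lemma cover_cball: "(\<Union>n. cball x (real n + 1)) = (UNIV :: 'a set)"
proof -
  have "\<exists>n. dist x y \<le> real n + 1" for y :: 'a
    using real_arch_simple[of "dist x y"] by (metis add_increasing2 zero_le_one)
  then show ?thesis by auto
qed

lemma sigma_finite_\<mu>: "sigma_finite_measure \<mu>"
proof
  fix x0 :: 'a
  show "\<exists>A. countable A \<and> A \<subseteq> sets \<mu> \<and> \<Union>A = space \<mu> \<and> (\<forall>a\<in>A. emeasure \<mu> a \<noteq> \<infinity>)"
    using cover_cball[of x0] emeasure_cball_finite[of x0]
    by (intro exI[of _ "range (\<lambda>n::nat. cball x0 (real n + 1))"]) (auto simp: less_top)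
qed

text \<open>A point \<open>p\<close> of the dense set closer than \<open>q\<close> to
  \<open>u\<close> is a centre of \<open>cball u q\<close>, so centres in a countable set and
  rational radii are enough. Radii are positive because averages are controlled on such balls
  only.\<close>

lemma sets_generated_by_cballs:
  "sets borel = sigma_sets UNIV (insert {} {cball x r | (x :: 'a) r. 0 < r})" (is "_ = sigma_sets UNIV ?E")
proof (intro equalityI)
  obtain D :: "'a set" where D: "countable D" "closure D = UNIV" using separable by blast
  have "U \<in> sigma_sets UNIV ?E" if U: "open U" for U :: "'a set"
  proof -
    let ?P = "{(p, q). p \<in> D \<and> q \<in> \<rat> \<and> 0 < q \<and> cball p q \<subseteq> U}"
    have "?P \<subseteq> D \<times> \<rat>" by auto
    then have "countable ?P" using D(1) countable_rat by (meson countable_SIGMA countable_subset)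
    then have c: "countable ((\<lambda>(p, q). cball p q) ` ?P)" by (rule countable_image)
    have "(\<lambda>(p, q). cball p q) ` ?P \<subseteq> sigma_sets UNIV ?E" by (auto intro: sigma_sets.Basic)
    then have "\<Union>((\<lambda>(p, q). cball p q) ` ?P) \<in> sigma_sets UNIV ?E"
      by (intro sigma_sets_UNION[OF c]) (erule subsetD)
    moreover have "U = \<Union>((\<lambda>(p, q). cball p q) ` ?P)"
    proof (rule subset_antisym, rule subsetI)
      fix u assume "u \<in> U"
      then obtain e where e: "0 < e" "cball u e \<subseteq> U" using U open_contains_cball by blast
      obtain q where q: "q \<in> \<rat>" "0 < q" "q < e" using Rats_dense_in_real[OF e(1)] by blast
      have "u \<in> closure D" using D by simp
      then obtain p where p: "p \<in> D" "dist p u < q" using q(2) by (auto simp: closure_approachable)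
      then have "cball p q = cball u q" by (intro cball_eq) simp
      then have "cball p q \<subseteq> U" "u \<in> cball p q" using e q by auto
      then show "u \<in> \<Union>((\<lambda>(p, q). cball p q) ` ?P)" using p q by blast
    next
      show "\<Union>((\<lambda>(p, q). cball p q) ` ?P) \<subseteq> U" by auto
    qed
    ultimately show ?thesis by (simp only:)
  qed
  then show "sets borel \<subseteq> sigma_sets UNIV ?E"
    unfolding borel_def by (subst sets_measure_of) (auto intro!: sigma_sets_mono)
  have "?E \<subseteq> sets borel" by auto
  then show "sigma_sets UNIV ?E \<subseteq> sets borel"
    using sets.sigma_sets_subset[of ?E "borel :: 'a measure"] by simp
qed

text \<open>Balls that meet share a centre, so their intersection is the smaller one; disjoint balls
  account for the inserted empty set.\<close>

lemma Int_stable_cballs: "Int_stable (insert {} {cball x r | (x :: 'a) r. 0 < r})"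
proof (rule Int_stableI)
  fix a b assume ab: "a \<in> insert {} {cball x r | (x :: 'a) r. 0 < r}" "b \<in> insert {} {cball x r | (x :: 'a) r. 0 < r}"
  show "a \<inter> b \<in> insert {} {cball x r | (x :: 'a) r. 0 < r}"
  proof (cases "a \<inter> b = {}")
    case False
    then obtain p where p: "p \<in> a" "p \<in> b" by blast
    obtain x r where a: "0 < r" "a = cball x r" using ab p by blast
    obtain y s where b: "0 < s" "b = cball y s" using ab p by blast
    have "a = cball p r" "b = cball p s" using p a b cball_eq[of x p r] cball_eq[of y p s] by auto
    then have "a \<inter> b = cball p (min r s)" by auto
    moreover have "0 < min r s" using a b by simp
    ultimately show ?thesis by blast
  qed simp
qed

text \<open>As \<open>ennreal\<close> cuts negative reals off at 0, \<open>?p\<close> and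
  \<open>?n\<close> have the positive and the negative part of \<open>u\<close> as densities. They
  are finite and equal on balls, hence equal as measures, and so are their densities almost
  everywhere.\<close>

lemma AE_zero_real:
  fixes u :: "'a \<Rightarrow> real"
  assumes u[measurable]: "u \<in> borel_measurable \<mu>"
    and int: "\<And>x r. integrable \<mu> (\<lambda>y. indicator (cball x r) y * u y)"
    and zero: "\<And>x r. 0 < r \<Longrightarrow> (LINT y|\<mu>. indicator (cball x r) y * u y) = 0"
  shows "AE y in \<mu>. u y = 0"
proof -
  interpret sigma_finite_measure \<mu> by (rule sigma_finite_\<mu>)
  let ?E = "insert {} {cball x r | (x :: 'a) r. 0 < r}"
  let ?p = "density \<mu> (\<lambda>y. ennreal (u y))" and ?n = "density \<mu> (\<lambda>y. ennreal (- u y))"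
  have emp: "emeasure ?p (cball x r) = (\<integral>\<^sup>+y. ennreal (indicator (cball x r) y * u y) \<partial>\<mu>)"
    and emn: "emeasure ?n (cball x r) = (\<integral>\<^sup>+y. ennreal (- (indicator (cball x r) y * u y)) \<partial>\<mu>)" for x r
    by (auto simp: emeasure_density indicator_def intro!: nn_integral_cong)
  have fin: "(\<integral>\<^sup>+y. ennreal (indicator (cball x r) y * u y) \<partial>\<mu>) \<noteq> \<infinity>"
    "(\<integral>\<^sup>+y. ennreal (- (indicator (cball x r) y * u y)) \<partial>\<mu>) \<noteq> \<infinity>" for x r
    using int[of x r] by (auto simp: real_integrable_def)
  have "?p = ?n"
  proof (rule measure_eqI_generator_eq[OF Int_stable_cballs])
    fix X assume "X \<in> ?E"
    then consider "X = {}" | x r where "X = cball x r" "0 < r" by blast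
    then show "emeasure ?p X = emeasure ?n X"
    proof cases
      case 2
      let ?a = "\<integral>\<^sup>+y. ennreal (indicator (cball x r) y * u y) \<partial>\<mu>"
      let ?b = "\<integral>\<^sup>+y. ennreal (- (indicator (cball x r) y * u y)) \<partial>\<mu>"
      have eq: "enn2real ?a = enn2real ?b"
        using real_lebesgue_integral_def[OF int[of x r]] zero[OF 2(2), of x] by simp
      have a: "ennreal (enn2real ?a) = ?a"
        by (rule ennreal_enn2real[OF fin(1)[unfolded infinity_ennreal_def less_top]])
      have b: "ennreal (enn2real ?b) = ?b"
        by (rule ennreal_enn2real[OF fin(2)[unfolded infinity_ennreal_def less_top]])
      have "?a = ?b" by (rule trans[OF trans[OF a[symmetric] arg_cong[OF eq, of ennreal]] b])
      then show ?thesis unfolding 2(1) emp emn .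
    qed simp
  next
    fix x0 :: 'a
    show "range (\<lambda>n::nat. cball x0 (real n + 1)) \<subseteq> ?E" by force
    show "(\<Union>n. cball x0 (real n + 1)) = UNIV" by (rule cover_cball)
    show "emeasure ?p (cball x0 (real n + 1)) \<noteq> \<infinity>" for n unfolding emp by (rule fin)
  qed (simp_all add: sets_generated_by_cballs)
  then have "AE y in \<mu>. ennreal (u y) = ennreal (- u y)"
    by (subst (asm) density_unique_iff) auto
  then show ?thesis
  proof (rule eventually_mono)
    fix y assume eq: "ennreal (u y) = ennreal (- u y)"
    show "u y = 0"
    proof (cases "0 \<le> u y")
      case True
      then have "ennreal (u y) = 0" unfolding eq by (simp add: ennreal_neg)
      with True show ?thesis by (simp add: ennreal_eq_0_iff)
    next
      case False
      then have "ennreal (- u y) = 0" unfolding eq[symmetric] by (simp add: ennreal_neg)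
      with False show ?thesis by (simp add: ennreal_eq_0_iff)
    qed
  qed
qed

end

section \<open>The spaces spanned by child functions\<close>

context proper_ultrametric_measure
begin

abbreviation ind :: "'a set \<Rightarrow> 'a \<Rightarrow> complex" where
  "ind A \<equiv> \<lambda>w. complex_of_real (indicator A w)"

lemma integrable_indicator_finite:
  "A \<in> sets borel \<Longrightarrow> emeasure \<mu> A < \<infinity> \<Longrightarrow> integrable \<mu> (indicator A :: 'a \<Rightarrow> real)"
  by simp

lemma ind_l2: assumes "A \<in> sets borel" "emeasure \<mu> A < \<infinity>" shows "ind A \<in> l2 \<mu>"
proof -
  have "(cmod (ind A w))\<^sup>2 = indicator A w" for w by (simp add: indicator_def)
  then show ?thesis unfolding l2_def using assms by simp
qed

lemma ind_cball_l2: "ind (cball x r) \<in> l2 \<mu>"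
  using emeasure_cball_finite[of x r] by (intro ind_l2) auto

lemma ind_ball_l2: "ind (ball x r) \<in> l2 \<mu>"
  using emeasure_ball_finite[of x r] by (intro ind_l2) auto

lemma ind_norm: "A \<in> sets borel \<Longrightarrow> (l2_norm \<mu> (ind A))\<^sup>2 = measure \<mu> A"
proof -
  assume A: "A \<in> sets borel"
  have "(cmod (ind A w))\<^sup>2 = indicator A w" for w by (simp add: indicator_def)
  then show ?thesis unfolding l2_norm_squared using A by simp
qed

lemma child_function_eq:
  "child_function \<mu> B C = (\<lambda>w. complex_of_real (1 / measure \<mu> C) * ind C w - complex_of_real (1 / measure \<mu> B) * ind B w)"
  by (rule ext) (simp add: child_function_def)

lemma ball_space_eq:
  fixes x y :: 'a
  assumes "x \<noteq> y"
  shows "ball_space \<mu> (cball x (dist x y)) = lspan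
    (child_function \<mu> (cball x (dist x y)) ` (\<lambda>z. ball z (dist x y)) ` cball x (dist x y))"
proof -
  have "{child_function \<mu> (cball x (dist x y)) C | C. child_ball C (cball x (dist x y))} =
      child_function \<mu> (cball x (dist x y)) ` (\<lambda>z. ball z (dist x y)) ` cball x (dist x y)"
    unfolding child_ball_iff[OF assms] by auto
  then show ?thesis by (simp only: ball_space_def)
qed

lemma finite_child_functions:
  fixes x y :: 'a
  assumes "x \<noteq> y"
  shows "finite (child_function \<mu> (cball x (dist x y)) ` (\<lambda>z. ball z (dist x y)) ` cball x (dist x y))"
  by (intro finite_imageI finite_subballs proper) (use assms in simp)

lemma child_function_l2: "child_function \<mu> (cball x r) (ball z s) \<in> l2 \<mu>"
  unfolding child_function_eq by (intro l2_diff l2_scale ind_cball_l2 ind_ball_l2)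

lemma child_function_integral:
  assumes "0 < r" "0 < s"
  shows "integrable \<mu> (child_function \<mu> (cball x r) (ball z s))"
    and "(LINT w|\<mu>. child_function \<mu> (cball x r) (ball z s) w) = 0"
proof -
  have i: "integrable \<mu> (indicator (ball z s) :: 'a \<Rightarrow> real)" "integrable \<mu> (indicator (cball x r) :: 'a \<Rightarrow> real)"
    using emeasure_cball_finite[of x r] emeasure_ball_finite[of z s] by (auto intro: integrable_indicator_finite)
  let ?f = "\<lambda>w. indicator (ball z s) w / measure \<mu> (ball z s) - indicator (cball x r) w / measure \<mu> (cball x r)"
  have "integrable \<mu> ?f" using i by (intro Bochner_Integration.integrable_diff integrable_divide)
  then show "integrable \<mu> (child_function \<mu> (cball x r) (ball z s))"
    unfolding child_function_def[abs_def] by (rule integrable_of_real)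
  have "(LINT w|\<mu>. ?f w) = (LINT w|\<mu>. indicator (ball z s) w / measure \<mu> (ball z s)) - (LINT w|\<mu>. indicator (cball x r) w / measure \<mu> (cball x r))"
    using i by (intro Bochner_Integration.integral_diff integrable_divide)
  also have "\<dots> = 0"
    using measure_ball_pos[OF assms(2), of z] measure_cball_pos[OF assms(1), of x] by simp
  finally show "(LINT w|\<mu>. child_function \<mu> (cball x r) (ball z s) w) = 0"
    unfolding child_function_def[abs_def] integral_complex_of_real by simp
qed

text \<open>The properties that give orthogonality and the action of averages, proved in one
  induction. Integrability is carried along because the integral of a sum splits only for integrable
  terms.\<close>

lemma
  fixes x y :: 'a
  assumes xy: "x \<noteq> y" and f: "f \<in> ball_space \<mu> (cball x (dist x y))"
  shows ball_space_l2: "f \<in> l2 \<mu>"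
    and ball_space_support: "w \<notin> cball x (dist x y) \<Longrightarrow> f w = 0"
    and ball_space_locally_const: "dist z w < dist x y \<Longrightarrow> f z = f w"
    and ball_space_mean: "(LINT w|\<mu>. f w) = 0"
proof -
  let ?R = "dist x y" let ?B = "cball x ?R"
  have R: "0 < ?R" using xy by simp
  have "f \<in> l2 \<mu> \<and> (\<forall>w. w \<notin> ?B \<longrightarrow> f w = 0) \<and> (\<forall>z w. dist z w < ?R \<longrightarrow> f z = f w) \<and>
      integrable \<mu> f \<and> (LINT w|\<mu>. f w) = 0"
    using f unfolding ball_space_eq[OF xy]
  proof (induction rule: lspan_induct)
    case zero
    show ?case by simp
  next
    case (add f g)
    have "f z + g z = f w + g w" if "dist z w < ?R" for z w
      using add that by metis
    then show ?case using add by (auto intro: l2_add)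
  next
    case (scale a h)
    then obtain c where c: "c \<in> ?B" "h = child_function \<mu> ?B (ball c ?R)" by blast
    have sub: "ball c ?R \<subseteq> ?B" using c(1) cball_eq[of x c ?R] by auto
    have "h w = 0" if "w \<notin> ?B" for w
      using that sub unfolding c(2) child_function_def by (auto simp: indicator_def)
    moreover have "h z = h w" if "dist z w < ?R" for z w
    proof -
      have "z \<in> ball c ?R \<longleftrightarrow> w \<in> ball c ?R"
        using dist_lt[of c z ?R w] dist_lt[of c w ?R z] that by (auto simp: dist_commute)
      moreover have "z \<in> ?B \<longleftrightarrow> w \<in> ?B"
        using dist_le[of x z ?R w] dist_le[of x w ?R z] that by (auto simp: dist_commute)
      ultimately show ?thesis unfolding c(2) child_function_def by (simp add: indicator_def)
    qed
    ultimately show ?case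
      using child_function_integral[OF R R, of x c] child_function_l2[of x ?R c ?R]
      unfolding c(2) by (auto intro: l2_scale)
  qed
  then show "f \<in> l2 \<mu>" "w \<notin> ?B \<Longrightarrow> f w = 0" "dist z w < ?R \<Longrightarrow> f z = f w"
    "(LINT w|\<mu>. f w) = 0" by auto
qed

lemma ball_space_finite_dim:
  fixes x y :: 'a
  assumes "x \<noteq> y"
  shows "\<exists>G. finite G \<and> G \<subseteq> l2 \<mu> \<and> ball_space \<mu> (cball x (dist x y)) = lspan G"
  unfolding ball_space_eq[OF assms] using finite_child_functions[OF assms]
  by (intro exI conjI) (auto simp: child_function_l2)

text \<open>On the child around \<open>y\<close>, which is disjoint from the child around
  \<open>x\<close> and has positive measure, the function is a nonzero constant.\<close>

lemma ball_space_nontrivial: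
  fixes x y :: 'a
  assumes xy: "x \<noteq> y"
  shows "\<exists>f\<in>ball_space \<mu> (cball x (dist x y)). \<not> (AE w in \<mu>. f w = 0)"
proof
  let ?R = "dist x y" let ?B = "cball x ?R" let ?f = "child_function \<mu> ?B (ball x ?R)"
  have R: "0 < ?R" using xy by simp
  show "?f \<in> ball_space \<mu> ?B"
    unfolding ball_space_eq[OF xy] by (intro lspan_base imageI) simp
  show "\<not> (AE w in \<mu>. ?f w = 0)"
  proof
    assume "AE w in \<mu>. ?f w = 0"
    then have "AE w in \<mu>. w \<notin> ball y ?R"
    proof (rule eventually_mono)
      fix w assume z: "?f w = 0"
      show "w \<notin> ball y ?R"
      proof
        assume w: "w \<in> ball y ?R"
        then have "w \<notin> ball x ?R" using dist_lt[of x w ?R y] by (auto simp: dist_commute)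
        moreover have "w \<in> ?B" using w dist_le[of x y ?R w] by simp
        ultimately have "?f w = - complex_of_real (1 / measure \<mu> ?B)"
          unfolding child_function_def by simp
        then show False using z measure_cball_pos[OF R, of x] by simp
      qed
    qed
    then have "emeasure \<mu> (ball y ?R) = 0" by (subst (asm) AE_iff_measurable[of "ball y ?R"]) auto
    then show False using measure_ball_pos[OF R, of y] by (simp add: emeasure_ball)
  qed
qed

text \<open>Disjoint balls give a vanishing product. Otherwise the balls are concentric around a
  common point and the first is strictly smaller, so \<open>g\<close> is constant on it while
  \<open>f\<close> has mean zero.\<close>

lemma ball_space_orthogonal_smaller:
  fixes x y x' y' :: 'a
  assumes xy: "x \<noteq> y" and xy': "x' \<noteq> y'" and ne: "cball x (dist x y) \<noteq> cball x' (dist x' y')"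
    and f: "f \<in> ball_space \<mu> (cball x (dist x y))" and g: "g \<in> ball_space \<mu> (cball x' (dist x' y'))"
    and le: "dist x y \<le> dist x' y'"
  shows "l2_inner \<mu> f g = 0"
proof (cases "cball x (dist x y) \<inter> cball x' (dist x' y') = {}")
  case True
  then have "f w = 0 \<or> g w = 0" for w
    using ball_space_support[OF xy f, of w] ball_space_support[OF xy' g, of w] by blast
  then have "(\<lambda>w. f w * cnj (g w)) = (\<lambda>w. 0)" by (intro ext) (metis complex_cnj_zero mult_zero_left mult_zero_right)
  then show ?thesis unfolding l2_inner_def by (simp only: integral_zero)
next
  case False
  then obtain p where p: "p \<in> cball x (dist x y)" "p \<in> cball x' (dist x' y')" by blast
  have B: "cball x (dist x y) = cball p (dist x y)" "cball x' (dist x' y') = cball p (dist x' y')"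
    using p cball_eq[of x p "dist x y"] cball_eq[of x' p "dist x' y'"] by auto
  have lt: "dist x y < dist x' y'" using le ne unfolding B by (cases "dist x y = dist x' y'") auto
  have h: "f w * cnj (g w) = cnj (g p) * f w" for w
  proof (cases "w \<in> cball x (dist x y)")
    case True
    then have "dist w p < dist x' y'" unfolding B using lt by (simp add: dist_commute)
    then show ?thesis using ball_space_locally_const[OF xy' g, of w p] by simp
  next
    case False
    then show ?thesis using ball_space_support[OF xy f, of w] by simp
  qed
  show ?thesis unfolding l2_inner_def h by (simp add: ball_space_mean[OF xy f])
qed

lemma ball_space_orthogonal:
  fixes x y x' y' :: 'a
  assumes xy: "x \<noteq> y" and xy': "x' \<noteq> y'" and ne: "cball x (dist x y) \<noteq> cball x' (dist x' y')"
    and f: "f \<in> ball_space \<mu> (cball x (dist x y))" and g: "g \<in> ball_space \<mu> (cball x' (dist x' y'))"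
  shows "l2_inner \<mu> f g = 0"
proof (cases "dist x y \<le> dist x' y'")
  case True
  then show ?thesis by (rule ball_space_orthogonal_smaller[OF xy xy' ne f g])
next
  case False
  then have "l2_inner \<mu> g f = 0"
    by (intro ball_space_orthogonal_smaller[OF xy' xy ne[symmetric] g f]) simp
  then show ?thesis by (subst l2_inner_cnj) simp
qed

section \<open>Completeness of the system of child functions\<close>

text \<open>The mean value over \<open>A\<close>, written as an inner product so that orthogonality
  to a child function reads directly as equality of two averages.\<close>

definition average :: "('a \<Rightarrow> complex) \<Rightarrow> 'a set \<Rightarrow> complex" where
  "average f A = l2_inner \<mu> f (ind A) / complex_of_real (measure \<mu> A)"

lemma inner_child_function:
  assumes "f \<in> l2 \<mu>"
  shows "l2_inner \<mu> f (child_function \<mu> (cball x r) (ball z s)) = average f (ball z s) - average f (cball x r)"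
  unfolding child_function_eq average_def
    l2_inner_diff_right[OF l2_scale[OF ind_ball_l2] l2_scale[OF ind_cball_l2] assms] l2_inner_scale_right
  by simp

text \<open>Induction on the number of distances from \<open>x\<close> in the interval from
  \<open>r\<close> to \<open>s\<close>, finite by \<open>finite_distances\<close>; each step
  descends from a ball to its child around \<open>x\<close>.\<close>

lemma average_chain:
  assumes f: "f \<in> l2 \<mu>"
    and z: "\<And>x y h. x \<noteq> y \<Longrightarrow> h \<in> ball_space \<mu> (cball x (dist x y)) \<Longrightarrow> l2_inner \<mu> f h = 0"
    and r: "0 < r" "r \<le> s"
  shows "average f (cball x s) = average f (cball x r)"
  using r(2)
proof (induction "card {dist x y | y. r < dist x y \<and> dist x y \<le> s}" arbitrary: s rule: less_induct)
  case less
  let ?D = "\<lambda>s. {dist x y | y. r < dist x y \<and> dist x y \<le> s}"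
  have fin: "finite (?D s)" for s
    by (rule finite_subset[OF _ finite_distances[OF r(1), of x s]]) auto
  show ?case
  proof (cases "?D s = {}")
    case True
    then have "cball x s = cball x r" using less.prems by force
    then show ?thesis by simp
  next
    case False
    define R where "R = Max (?D s)"
    have "R \<in> ?D s" unfolding R_def by (rule Max_in[OF fin False])
    then obtain y where y: "R = dist x y" "r < dist x y" "dist x y \<le> s" by blast
    have ub: "dist x w \<le> R" if "r < dist x w" "dist x w \<le> s" for w
      unfolding R_def by (rule Max_ge[OF fin]) (use that in blast)
    have xy: "x \<noteq> y" using y r by auto
    have sR: "cball x s = cball x (dist x y)"
    proof (intro equalityI subsetI)
      fix w assume w: "w \<in> cball x s"
      show "w \<in> cball x (dist x y)"
      proof (cases "r < dist x w")
        case True then show ?thesis using ub[of w] w y(1) by simp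
      next
        case False then show ?thesis using y by simp
      qed
    qed (use y in auto)
    have "child_function \<mu> (cball x (dist x y)) (ball x (dist x y)) \<in> ball_space \<mu> (cball x (dist x y))"
      unfolding ball_space_eq[OF xy] by (intro lspan_base imageI) simp
    from z[OF xy this] have 1: "average f (cball x s) = average f (ball x (dist x y))"
      unfolding sR by (simp add: inner_child_function[OF f])
    obtain v where v: "dist x v < dist x y" "ball x (dist x y) = cball x (dist x v)"
      using ball_eq_dist[of "dist x y" x] xy by auto
    \<comment> \<open>The attained radius of the child can fall below \<open>r\<close>; the maximum
      describes the same child by a radius to which the induction hypothesis applies.\<close>
    define t where "t = max r (dist x v)"
    have t: "r \<le> t" "t < dist x y" using v y by (auto simp: t_def)
    have bt: "ball x (dist x y) = cball x t"
    proof (intro equalityI subsetI)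
      fix w assume "w \<in> ball x (dist x y)"
      then have "w \<in> cball x (dist x v)" using v(2) by simp
      then show "w \<in> cball x t" by (simp add: t_def)
    qed (use t in auto)
    have "?D t \<subset> ?D s"
    proof
      show "?D t \<subseteq> ?D s" using t y by auto
      have "R \<in> ?D s" "R \<notin> ?D t" using y t by auto
      then show "?D t \<noteq> ?D s" by blast
    qed
    then have "card (?D t) < card (?D s)" by (rule psubset_card_mono[OF fin])
    then have "average f (cball x t) = average f (cball x r)" using t(1) by (rule less.hyps)
    then show ?thesis using 1 bt by simp
  qed
qed

lemma inner_ind_proportional:
  assumes f: "f \<in> l2 \<mu>"
    and z: "\<And>x y h. x \<noteq> y \<Longrightarrow> h \<in> ball_space \<mu> (cball x (dist x y)) \<Longrightarrow> l2_inner \<mu> f h = 0"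
  shows "\<exists>c. \<forall>x r. 0 < r \<longrightarrow> l2_inner \<mu> f (ind (cball x r)) = c * complex_of_real (measure \<mu> (cball x r))"
proof -
  fix x0 :: 'a
  define c where "c = average f (cball x0 1)"
  have "l2_inner \<mu> f (ind (cball x r)) = c * complex_of_real (measure \<mu> (cball x r))" if r: "0 < r" for x r
  proof -
    \<comment> \<open>Large enough to make \<open>x\<close> and \<open>x0\<close> centres of one
      ball and to lie above both initial radii, \<open>r\<close> and 1.\<close>
    define t where "t = max (max 1 r) (dist x0 x)"
    have "average f (cball x r) = average f (cball x t)"
      by (rule average_chain[OF f z r, symmetric]) (auto simp: t_def)
    also have "cball x t = cball x0 t" by (rule cball_eq[symmetric]) (simp add: t_def)
    also have "average f (cball x0 t) = c"
      unfolding c_def by (rule average_chain[OF f z]) (auto simp: t_def)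
    finally show ?thesis using measure_cball_pos[OF r, of x] by (simp add: average_def field_simps)
  qed
  then show ?thesis by (intro exI[of _ c]) simp
qed

lemma AE_zero_inner_ind:
  assumes f: "f \<in> l2 \<mu>" and z: "\<And>x r. 0 < r \<Longrightarrow> l2_inner \<mu> f (ind (cball x r)) = 0"
  shows "AE w in \<mu>. f w = 0"
proof -
  have [measurable]: "f \<in> borel_measurable \<mu>" using f by (rule l2_measurable)
  have int: "integrable \<mu> (\<lambda>w. f w * cnj (ind (cball x r) w))" for x r
    by (rule l2_inner_integrable[OF f ind_cball_l2])
  have Re_eq: "Re (f w * cnj (ind (cball x r) w)) = indicator (cball x r) w * Re (f w)"
    and Im_eq: "Im (f w * cnj (ind (cball x r) w)) = indicator (cball x r) w * Im (f w)" for x r w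
    by (simp_all add: mult.commute)
  have "AE w in \<mu>. Re (f w) = 0"
  proof (rule AE_zero_real)
    show "integrable \<mu> (\<lambda>w. indicator (cball x r) w * Re (f w))" for x r
      using integrable_Re[OF int[of x r]] unfolding Re_eq .
    fix x :: 'a and r :: real assume "0 < r"
    then show "(LINT w|\<mu>. indicator (cball x r) w * Re (f w)) = 0"
      using integral_Re[OF int[of x r]] z[of r x] unfolding Re_eq l2_inner_def by simp
  qed simp
  moreover have "AE w in \<mu>. Im (f w) = 0"
  proof (rule AE_zero_real)
    show "integrable \<mu> (\<lambda>w. indicator (cball x r) w * Im (f w))" for x r
      using integrable_Im[OF int[of x r]] unfolding Im_eq .
    fix x :: 'a and r :: real assume "0 < r"
    then show "(LINT w|\<mu>. indicator (cball x r) w * Im (f w)) = 0"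
      using integral_Im[OF int[of x r]] z[of r x] unfolding Im_eq l2_inner_def by simp
  qed simp
  ultimately show ?thesis by eventually_elim (simp add: complex_eq_iff)
qed

lemma complete_infinite:
  assumes inf: "emeasure \<mu> UNIV = \<infinity>" and f: "f \<in> l2 \<mu>"
    and z: "\<And>x y h. x \<noteq> y \<Longrightarrow> h \<in> ball_space \<mu> (cball x (dist x y)) \<Longrightarrow> l2_inner \<mu> f h = 0"
  shows "AE w in \<mu>. f w = 0"
proof -
  from inner_ind_proportional[OF f z]
  obtain c where "\<forall>x r. 0 < r \<longrightarrow> l2_inner \<mu> f (ind (cball x r)) = c * complex_of_real (measure \<mu> (cball x r))"
    by (rule exE)
  note c = this[rule_format]
  have "c = 0"
  proof (rule ccontr)
    assume "c \<noteq> 0"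
    fix x0 :: 'a
    let ?A = "\<lambda>n::nat. cball x0 (real n + 1)"
    \<comment> \<open>Cauchy-Schwarz bounds \<bar>c\<bar> m by the norm of \<open>f\<close> times
      the square root of \<open>m\<close>, for the measure \<open>m\<close> of a ball; solved for
      \<open>m\<close> this is the constant \<open>K\<close>.\<close>
    define K where "K = (l2_norm \<mu> f)\<^sup>2 / (cmod c)\<^sup>2"
    have "emeasure \<mu> (?A n) \<le> ennreal K" for n
    proof -
      let ?m = "measure \<mu> (?A n)"
      have m: "0 < ?m" by (rule measure_cball_pos) simp
      have "(cmod c * ?m)\<^sup>2 \<le> (l2_norm \<mu> f * l2_norm \<mu> (ind (?A n)))\<^sup>2"
        using l2_Cauchy_Schwarz[OF f ind_cball_l2[of x0 "real n + 1"]] c[of "real n + 1" x0]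
        by (intro power_mono) (auto simp: norm_mult)
      also have "\<dots> = (l2_norm \<mu> f)\<^sup>2 * ?m" unfolding power_mult_distrib by (subst ind_norm) auto
      finally have "((cmod c)\<^sup>2 * ?m) * ?m \<le> (l2_norm \<mu> f)\<^sup>2 * ?m"
        by (simp add: power2_eq_square mult_ac)
      then have "(cmod c)\<^sup>2 * ?m \<le> (l2_norm \<mu> f)\<^sup>2" using m by simp
      then have "?m \<le> K" using \<open>c \<noteq> 0\<close> by (simp add: K_def field_simps)
      then show ?thesis unfolding emeasure_cball by (rule ennreal_leI)
    qed
    then have "(SUP n. emeasure \<mu> (?A n)) \<le> ennreal K" by (rule SUP_least)
    moreover have "(SUP n. emeasure \<mu> (?A n)) = emeasure \<mu> (\<Union>n. ?A n)"
      by (rule SUP_emeasure_incseq) (auto simp: incseq_def)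
    ultimately show False using inf by (simp add: cover_cball top_unique)
  qed
  then show ?thesis using c by (intro AE_zero_inner_ind[OF f]) simp
qed

lemma const_l2: "emeasure \<mu> UNIV < \<infinity> \<Longrightarrow> (\<lambda>_. c) \<in> l2 \<mu>"
  by (simp add: l2_iff_nn_integral ennreal_mult_less_top)

lemma complete_finite:
  assumes fin: "emeasure \<mu> UNIV < \<infinity>" and f: "f \<in> l2 \<mu>"
    and z: "\<And>x y h. x \<noteq> y \<Longrightarrow> h \<in> ball_space \<mu> (cball x (dist x y)) \<Longrightarrow> l2_inner \<mu> f h = 0"
    and const: "l2_inner \<mu> f (\<lambda>_. 1) = 0"
  shows "AE w in \<mu>. f w = 0"
proof -
  from inner_ind_proportional[OF f z]
  obtain c where "\<forall>x r. 0 < r \<longrightarrow> l2_inner \<mu> f (ind (cball x r)) = c * complex_of_real (measure \<mu> (cball x r))"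
    by (rule exE)
  note c = this[rule_format]
  have cl2: "(\<lambda>_. c) \<in> l2 \<mu>" "(\<lambda>_. 1) \<in> l2 \<mu>" using const_l2[OF fin] by auto
  have "AE w in \<mu>. f w - c = 0"
  proof (rule AE_zero_inner_ind)
    show "(\<lambda>w. f w - c) \<in> l2 \<mu>" by (intro l2_diff f cl2)
    fix x :: 'a and r :: real assume r: "0 < r"
    have "l2_inner \<mu> (\<lambda>_. c) (ind (cball x r)) = c * complex_of_real (measure \<mu> (cball x r))"
      unfolding l2_inner_def by (simp add: emeasure_cball)
    then show "l2_inner \<mu> (\<lambda>w. f w - c) (ind (cball x r)) = 0"
      by (simp add: l2_inner_diff_left[OF f cl2(1) ind_cball_l2] c[OF r])
  qed
  then have fc: "AE w in \<mu>. f w = c" by simp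
  then have "l2_inner \<mu> f (\<lambda>_. 1) = l2_inner \<mu> (\<lambda>_. c) (\<lambda>_. 1)"
    by (intro l2_inner_cong_AE f cl2) auto
  also have "\<dots> = c * complex_of_real (measure \<mu> UNIV)"
    unfolding l2_inner_def by (simp add: scaleR_conv_of_real mult.commute)
  finally have "c * complex_of_real (measure \<mu> UNIV) = 0" using const by simp
  moreover have "measure \<mu> UNIV \<noteq> 0"
  proof -
    fix x0 :: 'a
    have "0 < emeasure \<mu> UNIV" using support by (auto simp: full_support_def)
    then have "emeasure \<mu> UNIV \<noteq> 0" "emeasure \<mu> UNIV \<noteq> top" using fin by auto
    then show ?thesis by (simp add: measure_def enn2real_eq_0_iff)
  qed
  ultimately have "c = 0" by simp
  then show ?thesis using fc by simp
qed

end

section \<open>The Stieltjes measure of a distance distribution\<close>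

locale distance_distribution_function =
  fixes \<sigma> :: "ennreal \<Rightarrow> real"
  assumes sigma: "distance_distribution \<sigma>"
begin

lemma sigma_range: "0 \<le> \<sigma> t" "\<sigma> t \<le> 1"
  using subsetD[OF sigma[unfolded distance_distribution_def, THEN conjunct1] rangeI[of \<sigma> t]] by auto

lemma sigma_strict_mono: "strict_mono \<sigma>"
  by (rule sigma[unfolded distance_distribution_def, THEN conjunct2, THEN conjunct1])

lemma sigma_mono: "s \<le> t \<Longrightarrow> \<sigma> s \<le> \<sigma> t"
  using strict_mono_mono[OF sigma_strict_mono] by (rule monoD)

lemma sigma_less: "s < t \<Longrightarrow> \<sigma> s < \<sigma> t"
  by (rule strict_monoD[OF sigma_strict_mono])

lemma sigma_left: "(\<sigma> \<longlongrightarrow> \<sigma> t) (at_left t)"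
  by (rule sigma[unfolded distance_distribution_def, THEN conjunct2, THEN conjunct2, THEN conjunct1, rule_format])

lemma sigma_right_0: "(\<sigma> \<longlongrightarrow> 0) (at_right 0)"
  by (rule sigma[unfolded distance_distribution_def, THEN conjunct2, THEN conjunct2, THEN conjunct2, THEN conjunct1])

lemma sigma_top: "\<sigma> top = 1"
  using sigma[unfolded distance_distribution_def, THEN conjunct2, THEN conjunct2, THEN conjunct2, THEN conjunct2]
  by simp

lemma sigma_small: assumes "0 < e" shows "\<exists>t>0. \<sigma> (ennreal t) < e"
proof -
  have "\<forall>\<^sub>F t in at_right 0. \<sigma> t < e" using order_tendstoD(2)[OF sigma_right_0 assms] .
  then obtain b where b: "b > 0" "\<And>t. 0 < t \<Longrightarrow> t < b \<Longrightarrow> \<sigma> t < e"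
    unfolding eventually_at_right[OF ennreal_zero_less_one] by blast
  obtain c where c: "0 < c" "c < b" using dense[OF b(1)] by blast
  have "c < top" by (rule less_le_trans[OF c(2) top_greatest])
  then obtain t where t: "c = ennreal t" "0 \<le> t" by (cases c) auto
  have "0 < t" using c(1) t by simp
  then show ?thesis using b(2)[OF c] t(1) by auto
qed

lemma sigma_0: "\<sigma> 0 = 0"
proof (rule antisym)
  show "\<sigma> 0 \<le> 0"
  proof (rule ccontr)
    assume "\<not> \<sigma> 0 \<le> 0"
    then obtain t where "0 < t" "\<sigma> (ennreal t) < \<sigma> 0" using sigma_small[of "\<sigma> 0"] by auto
    then show False using sigma_mono[of 0 "ennreal t"] by simp
  qed
qed (rule sigma_range)

lemma sigma_pos: "0 < t \<Longrightarrow> 0 < \<sigma> (ennreal t)"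
  using sigma_less[of 0 "ennreal t"] by (simp add: sigma_0)

lemma sigma_less_1: "\<sigma> (ennreal t) < 1"
  using sigma_less[of "ennreal t" top] by (simp add: sigma_top)

text \<open>The point \<open>t\<close> may be \<open>top\<close>, where left-continuity says that
  \<sigma> tends to 1 along finite radii.\<close>

lemma sigma_tendsto_from_below:
  assumes "u \<longlonglongrightarrow> t" "\<And>n. u n < t" shows "(\<lambda>n. \<sigma> (u n)) \<longlonglongrightarrow> \<sigma> t"
proof -
  have "filterlim u (at_left t) sequentially"
    unfolding filterlim_at using assms(1) assms(2) assms(2)[THEN less_imp_neq] by simp
  then show ?thesis by (rule filterlim_compose[OF sigma_left])
qed

definition cdf :: "real \<Rightarrow> real" where
  "cdf r = (INF s\<in>{r<..}. \<sigma> (ennreal s))"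

abbreviation \<nu> :: "real measure" where
  "\<nu> \<equiv> stieltjes \<sigma>"

lemma \<nu>_eq: "\<nu> = interval_measure cdf"
  unfolding stieltjes_def cdf_def[abs_def] ..

lemma bdd_below_sigma: "bdd_below ((\<lambda>s. \<sigma> (ennreal s)) ` A)"
  by (rule bdd_belowI2[of _ 0]) (rule sigma_range)

lemma cdf_le: "r < s \<Longrightarrow> cdf r \<le> \<sigma> (ennreal s)"
  unfolding cdf_def by (rule cINF_lower[OF bdd_below_sigma]) simp

lemma cdf_ge: "\<sigma> (ennreal r) \<le> cdf r"
  unfolding cdf_def by (rule cINF_greatest) (auto intro!: sigma_mono ennreal_leI)

lemma cdf_range: "0 \<le> cdf r" "cdf r \<le> 1"
  using order_trans[OF sigma_range(1) cdf_ge] order_trans[OF cdf_le[of r "r + 1"] sigma_range(2)] by auto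

lemma cdf_mono: "r \<le> s \<Longrightarrow> cdf r \<le> cdf s"
  unfolding cdf_def by (rule cINF_superset_mono[OF _ bdd_below_sigma]) auto

lemma cdf_right: "continuous (at_right a) cdf"
proof (subst continuous_at_right_real_increasing, erule cdf_mono, intro allI impI)
  fix e :: real assume "0 < e"
  then have "(INF s\<in>{a<..}. \<sigma> (ennreal s)) < cdf a + e" by (simp add: cdf_def)
  then obtain s where s: "a < s" "\<sigma> (ennreal s) < cdf a + e"
    using cINF_less_iff[OF _ bdd_below_sigma, of "{a<..}"] by auto
  \<comment> \<open>The midpoint of \<open>a\<close> and \<open>s\<close> is still below
    \<open>s\<close>, where \<open>cdf\<close> is bounded by the value of \<sigma> at
    \<open>s\<close>.\<close>
  have "cdf (a + (s - a) / 2) \<le> \<sigma> (ennreal s)" using s by (intro cdf_le) (simp add: field_simps)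
  then show "\<exists>d>0. cdf (a + d) - cdf a < e" using s by (intro exI[of _ "(s - a) / 2"]) auto
qed

lemma cdf_nonpos: assumes "r \<le> 0" shows "cdf r = 0"
proof (rule antisym[OF _ cdf_range(1)], rule ccontr)
  assume "\<not> cdf r \<le> 0"
  then obtain t where "0 < t" "\<sigma> (ennreal t) < cdf r" using sigma_small[of "cdf r"] by auto
  then show False using cdf_le[of r t] assms by simp
qed

lemma sets_\<nu> [simp, measurable_cong]: "sets \<nu> = sets borel"
  unfolding \<nu>_eq by simp

lemma space_\<nu> [simp]: "space \<nu> = UNIV"
  unfolding \<nu>_eq by simp

lemma sigma_finite_\<nu>: "sigma_finite_measure \<nu>"
  unfolding \<nu>_eq by (rule sigma_finite_interval_measure[OF cdf_mono cdf_right])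

lemma emeasure_\<nu>_Ioc: "a \<le> b \<Longrightarrow> emeasure \<nu> {a<..b} = ennreal (cdf b - cdf a)"
  unfolding \<nu>_eq by (rule emeasure_interval_measure_Ioc[OF _ cdf_mono cdf_right])

lemma emeasure_\<nu>_UNIV: "emeasure \<nu> UNIV \<le> 1"
proof -
  have "emeasure \<nu> {- real n<..real n} \<le> 1" for n
    using cdf_range[of "real n"] cdf_range[of "- real n"]
    by (subst emeasure_\<nu>_Ioc) (auto simp: ennreal_le_1)
  then have "(SUP n. emeasure \<nu> {- real n<..real n}) \<le> 1" by (rule SUP_least)
  also have "(SUP n. emeasure \<nu> {- real n<..real n}) = emeasure \<nu> (\<Union>n. {- real n<..real n})"
    by (rule SUP_emeasure_incseq) (auto simp: incseq_def)
  also have "(\<Union>n. {- real n<..real n}) = UNIV"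
  proof (intro equalityI subsetI)
    fix r :: real
    obtain n where "\<bar>r\<bar> < real n" using reals_Archimedean2 by blast
    then show "r \<in> (\<Union>n. {- real n<..real n})" by (intro UN_I[of n]) auto
  qed simp
  finally show ?thesis .
qed

lemma finite_\<nu>: "finite_measure \<nu>"
proof
  show "emeasure \<nu> (space \<nu>) \<noteq> \<infinity>" using emeasure_\<nu>_UNIV by (auto simp: top_unique)
qed

text \<open>\<open>cdf\<close> vanishes up to 0 because \<sigma>(0+) = 0. Discarding the radius 0
  matters: a single point may be a null set, and then its average is 0 by division by zero.\<close>

lemma AE_\<nu>_pos: "AE r in \<nu>. 0 < r"
proof (rule AE_I)
  have "emeasure \<nu> {- real n<..0} = 0" for n by (subst emeasure_\<nu>_Ioc) (auto simp: cdf_nonpos)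
  then have "(SUP n. emeasure \<nu> {- real n<..0}) = 0" by simp
  moreover have "(SUP n. emeasure \<nu> {- real n<..0}) = emeasure \<nu> (\<Union>n. {- real n<..0})"
    by (rule SUP_emeasure_incseq) (auto simp: incseq_def)
  moreover have "(\<Union>n. {- real n<..0}) = {..0::real}"
  proof (intro equalityI subsetI)
    fix r :: real assume "r \<in> {..0}"
    obtain n where "\<bar>r\<bar> < real n" using reals_Archimedean2 by blast
    then show "r \<in> (\<Union>n. {- real n<..0})" using \<open>r \<in> {..0}\<close> by (intro UN_I[of n]) auto
  qed auto
  ultimately show "emeasure \<nu> {..0} = 0" by simp
qed auto

text \<open>The mass \<open>cdf (u n)\<close> is squeezed between \<open>\<sigma> (u n)\<close> and
  \<open>\<sigma> t\<close>, so left-continuity determines the limit. With \<open>t\<close> in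
  \<open>ennreal\<close> this covers a finite radius and infinity alike.\<close>

lemma measure_\<nu>_limit:
  fixes u :: "nat \<Rightarrow> real"
  assumes u: "incseq u" "\<And>n. 0 \<le> u n" "(\<lambda>n. ennreal (u n)) \<longlonglongrightarrow> t" "\<And>n. ennreal (u n) < t"
  shows "measure \<nu> (\<Union>n. {0<..u n}) = \<sigma> t"
proof -
  interpret finite_measure \<nu> by (rule finite_\<nu>)
  have "(\<lambda>n. measure \<nu> {0<..u n}) \<longlonglongrightarrow> measure \<nu> (\<Union>n. {0<..u n})"
  proof (rule finite_Lim_measure_incseq)
    show "incseq (\<lambda>n. {0<..u n})" using u(1) by (force simp: incseq_def)
  qed auto
  moreover have "measure \<nu> {0<..u n} = cdf (u n)" for n
    using emeasure_\<nu>_Ioc[OF u(2)[of n]] cdf_range[of "u n"] by (simp add: measure_def cdf_nonpos)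
  moreover have "(\<lambda>n. cdf (u n)) \<longlonglongrightarrow> \<sigma> t"
  proof (rule tendsto_sandwich[OF _ _ sigma_tendsto_from_below[OF u(3,4)] tendsto_const])
    show "\<forall>\<^sub>F n in sequentially. \<sigma> (ennreal (u n)) \<le> cdf (u n)" by (simp add: cdf_ge)
    have "cdf (u n) \<le> \<sigma> t" for n
    proof -
      obtain c where c: "ennreal (u n) < c" "c < t" using dense[OF u(4)[of n]] by blast
      have "c < top" by (rule less_le_trans[OF c(2) top_greatest])
      then obtain s where s: "c = ennreal s" "0 \<le> s" by (cases c) auto
      then have "u n < s" using c(1) by (simp add: ennreal_less_iff[OF u(2)])
      then show ?thesis using cdf_le[of "u n" s] sigma_mono[OF less_imp_le[OF c(2)]] s(1) by simp
    qed
    then show "\<forall>\<^sub>F n in sequentially. cdf (u n) \<le> \<sigma> t" by simp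
  qed
  ultimately show ?thesis using LIMSEQ_unique by simp
qed

lemma measure_\<nu>_Ioo: assumes R: "0 < R" shows "measure \<nu> {0<..<R} = \<sigma> (ennreal R)"
proof -
  \<comment> \<open>Starts at 0 and increases to \<open>R\<close> without reaching it, so the
    half-open intervals exhaust the open one and an atom at \<open>R\<close> stays outside.\<close>
  define u where "u n = R - R / (real n + 1)" for n
  have pos: "0 < R / (real n + 1)" for n using R by (simp add: add_nonneg_pos)
  have lim: "u \<longlonglongrightarrow> R"
  proof -
    have "(\<lambda>n. R - R * inverse (real (Suc n))) \<longlonglongrightarrow> R - R * 0"
      by (intro tendsto_intros LIMSEQ_inverse_real_of_nat)
    then show ?thesis by (simp add: u_def[abs_def] divide_inverse add.commute)
  qed
  have "measure \<nu> (\<Union>n. {0<..u n}) = \<sigma> (ennreal R)"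
  proof (rule measure_\<nu>_limit)
    show "incseq u" using R unfolding incseq_def u_def
      by (auto intro!: divide_left_mono mult_pos_pos)
    show "0 \<le> u n" for n using R by (simp add: u_def field_simps)
    show "(\<lambda>n. ennreal (u n)) \<longlonglongrightarrow> ennreal R" by (intro tendsto_ennrealI lim)
    show "ennreal (u n) < ennreal R" for n using pos[of n] R by (intro ennreal_lessI) (auto simp: u_def)
  qed
  moreover have "(\<Union>n. {0<..u n}) = {0<..<R}"
  proof (intro equalityI subsetI)
    fix r assume "r \<in> (\<Union>n. {0<..u n})"
    then obtain n where "0 < r" "r \<le> u n" by auto
    then show "r \<in> {0<..<R}" using pos[of n] by (simp add: u_def)
  next
    fix r assume r: "r \<in> {0<..<R}"
    then have "\<forall>\<^sub>F n in sequentially. r < u n" using order_tendstoD(1)[OF lim] by simp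
    then obtain n where "r < u n" by (auto simp: eventually_sequentially)
    then show "r \<in> (\<Union>n. {0<..u n})" using r by (intro UN_I[of n]) auto
  qed
  ultimately show ?thesis by simp
qed

lemma measure_\<nu>_Ioi: "measure \<nu> {0<..} = 1"
proof -
  have "measure \<nu> (\<Union>n. {0<..real n}) = \<sigma> top"
    by (rule measure_\<nu>_limit)
       (auto simp: incseq_def ennreal_of_nat_eq_real_of_nat[symmetric] of_nat_tendsto_top_ennreal of_nat_less_top)
  moreover have "(\<Union>n. {0<..real n}) = {0<..}"
  proof (intro equalityI subsetI)
    fix r :: real assume r: "r \<in> {0<..}"
    obtain n where "r < real n" using reals_Archimedean2 by blast
    then show "r \<in> (\<Union>n. {0<..real n})" using r by (intro UN_I[of n]) auto
  qed auto
  ultimately show ?thesis by (simp add: sigma_top)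
qed

end

section \<open>The isotropic Markov operator\<close>

context proper_ultrametric_measure
begin

lemma dist_measurable_pair: "(\<lambda>p. dist (fst p) (snd p)) \<in> borel_measurable (\<mu> \<Otimes>\<^sub>M \<mu>)"
proof (subst borel_measurable_iff_less, rule allI)
  fix t :: real
  obtain D :: "'a set" where D: "countable D" "closure D = UNIV" using separable by blast
  have "{p :: 'a \<times> 'a. dist (fst p) (snd p) < t} = (\<Union>d\<in>D. ball d t \<times> ball d t)"
  proof (intro equalityI subsetI)
    fix p :: "'a \<times> 'a" assume "p \<in> {p. dist (fst p) (snd p) < t}"
    then have p: "dist (fst p) (snd p) < t" by simp
    then have "0 < t" using zero_le_dist le_less_trans by blast
    moreover have "fst p \<in> closure D" using D by simp
    ultimately obtain d where d: "d \<in> D" "dist d (fst p) < t" by (auto simp: closure_approachable)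
    then show "p \<in> (\<Union>d\<in>D. ball d t \<times> ball d t)"
      using dist_lt[OF d(2) p] by (intro UN_I[of d]) (auto simp: mem_Times_iff)
  next
    fix p :: "'a \<times> 'a" assume "p \<in> (\<Union>d\<in>D. ball d t \<times> ball d t)"
    then obtain d where "dist d (fst p) < t" "dist d (snd p) < t" by (auto simp: mem_Times_iff)
    then show "p \<in> {p. dist (fst p) (snd p) < t}"
      using dist_lt[of "fst p" d t "snd p"] by (simp add: dist_commute)
  qed
  moreover have "(\<Union>d\<in>D. ball d t \<times> ball d t) \<in> sets (\<mu> \<Otimes>\<^sub>M \<mu>)"
    by (intro sets.countable_UN' D(1) pair_measureI) auto
  ultimately show "{w \<in> space (\<mu> \<Otimes>\<^sub>M \<mu>). dist (fst w) (snd w) < t} \<in> sets (\<mu> \<Otimes>\<^sub>M \<mu>)"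
    by (simp add: space_pair_measure)
qed

lemma dist_measurable [measurable (raw)]:
  assumes "f \<in> measurable N \<mu>" "g \<in> measurable N \<mu>"
  shows "(\<lambda>w. dist (f w) (g w)) \<in> borel_measurable N"
  using measurable_compose[OF measurable_Pair[OF assms] dist_measurable_pair] by simp

section \<open>Averages over balls\<close>

lemma integrable_indicator_cball:
  assumes f: "f \<in> l2 \<mu>" shows "integrable \<mu> (\<lambda>y. indicator (cball x r) y *\<^sub>R f y)"
proof -
  have "(\<lambda>y. f y * cnj (ind (cball x r) y)) = (\<lambda>y. indicator (cball x r) y *\<^sub>R f y)"
    by (rule ext) (simp add: scaleR_conv_of_real mult.commute)
  then show ?thesis using l2_inner_integrable[OF f ind_cball_l2[of x r]] by simp
qed

lemma ball_average_eq:
  "ball_average \<mu> r f x = (1 / measure \<mu> (cball x r)) *\<^sub>R (LINT y|\<mu>. indicator (cball x r) y *\<^sub>R f y)"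
  by (simp add: ball_average_def set_lebesgue_integral_def)

lemma ball_average_linear:
  assumes "f \<in> l2 \<mu>" "g \<in> l2 \<mu>"
  shows "ball_average \<mu> r (\<lambda>y. a * f y + b * g y) x = a * ball_average \<mu> r f x + b * ball_average \<mu> r g x"
proof -
  have "(LINT y|\<mu>. indicator (cball x r) y *\<^sub>R (a * f y + b * g y))
      = (LINT y|\<mu>. a * (indicator (cball x r) y *\<^sub>R f y) + b * (indicator (cball x r) y *\<^sub>R g y))"
    by (simp add: scaleR_add_right)
  also have "\<dots> = (LINT y|\<mu>. a * (indicator (cball x r) y *\<^sub>R f y)) + (LINT y|\<mu>. b * (indicator (cball x r) y *\<^sub>R g y))"
    by (intro Bochner_Integration.integral_add integrable_mult_right integrable_indicator_cball assms)
  also have "\<dots> = a * (LINT y|\<mu>. indicator (cball x r) y *\<^sub>R f y) + b * (LINT y|\<mu>. indicator (cball x r) y *\<^sub>R g y)"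
    by (simp only: integral_mult_right_zero)
  finally show ?thesis unfolding ball_average_eq by (simp only: scaleR_add_right mult_scaleR_right)
qed

text \<open>Jensen's inequality for the square, in the form of Cauchy-Schwarz against the indicator
  of the ball.\<close>

lemma ball_average_bound:
  assumes f: "f \<in> l2 \<mu>"
  shows "ennreal ((cmod (ball_average \<mu> r f x))\<^sup>2)
    \<le> (\<integral>\<^sup>+y. ennreal (indicator (cball x r) y / measure \<mu> (cball x r)) * ennreal ((cmod (f y))\<^sup>2) \<partial>\<mu>)"
proof -
  let ?B = "cball x r" let ?m = "measure \<mu> ?B"
  have [measurable]: "f \<in> borel_measurable \<mu>" "cball x r \<in> sets borel"
    using f by (simp_all add: l2_measurable)
  let ?I = "LINT y|\<mu>. indicator ?B y *\<^sub>R f y"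
  let ?J = "\<integral>\<^sup>+y. indicator ?B y * ennreal ((cmod (f y))\<^sup>2) \<partial>\<mu>"
  have "ennreal (cmod ?I) \<le> (\<integral>\<^sup>+y. ennreal (cmod (indicator ?B y *\<^sub>R f y)) \<partial>\<mu>)"
    by (rule integral_norm_bound_ennreal[OF integrable_indicator_cball[OF f]])
  also have "\<dots> = (\<integral>\<^sup>+y. indicator ?B y * (indicator ?B y * ennreal (cmod (f y))) \<partial>\<mu>)"
    by (rule nn_integral_cong) (simp add: indicator_def)
  finally have "(ennreal (cmod ?I))\<^sup>2 \<le> (\<integral>\<^sup>+y. indicator ?B y * (indicator ?B y * ennreal (cmod (f y))) \<partial>\<mu>)\<^sup>2"
    by (rule power_mono) simp
  also have "\<dots> \<le> (\<integral>\<^sup>+y. (indicator ?B y)\<^sup>2 \<partial>\<mu>) * (\<integral>\<^sup>+y. (indicator ?B y * ennreal (cmod (f y)))\<^sup>2 \<partial>\<mu>)"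
    by (rule Cauchy_Schwarz_nn_integral) measurable
  also have "(\<integral>\<^sup>+y. (indicator ?B y)\<^sup>2 \<partial>\<mu>) = (\<integral>\<^sup>+y. indicator ?B y \<partial>\<mu>)"
    by (rule nn_integral_cong) (simp add: indicator_def)
  also have "\<dots> = ennreal ?m" by (simp add: emeasure_cball)
  also have "(\<integral>\<^sup>+y. (indicator ?B y * ennreal (cmod (f y)))\<^sup>2 \<partial>\<mu>) = ?J"
    by (rule nn_integral_cong) (simp add: indicator_def ennreal_power)
  finally have CS: "ennreal ((cmod ?I)\<^sup>2) \<le> ennreal ?m * ?J" by (simp add: ennreal_power)
  have "(cmod (ball_average \<mu> r f x))\<^sup>2 = (1 / ?m)\<^sup>2 * (cmod ?I)\<^sup>2"
    unfolding ball_average_eq norm_scaleR by (simp add: power_mult_distrib power_divide)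
  then have "ennreal ((cmod (ball_average \<mu> r f x))\<^sup>2) = ennreal ((1 / ?m)\<^sup>2) * ennreal ((cmod ?I)\<^sup>2)"
    by (simp add: ennreal_mult)
  also have "\<dots> \<le> ennreal ((1 / ?m)\<^sup>2) * (ennreal ?m * ?J)" by (rule mult_left_mono[OF CS]) simp
  also have "\<dots> = ennreal ((1 / ?m)\<^sup>2 * ?m) * ?J" by (simp add: ennreal_mult mult.assoc)
  \<comment> \<open>Also right for a null ball, as division by zero gives 0.\<close>
  also have "(1 / ?m)\<^sup>2 * ?m = 1 / ?m" by (simp add: power2_eq_square)
  also have "ennreal (1 / ?m) * ?J = (\<integral>\<^sup>+y. ennreal (1 / ?m) * (indicator ?B y * ennreal ((cmod (f y))\<^sup>2)) \<partial>\<mu>)"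
    by (rule nn_integral_cmult[symmetric]) measurable
  also have "\<dots> = (\<integral>\<^sup>+y. ennreal (indicator ?B y / ?m) * ennreal ((cmod (f y))\<^sup>2) \<partial>\<mu>)"
    by (rule nn_integral_cong) (simp add: indicator_def)
  finally show ?thesis .
qed

end

section \<open>The Markov operator as a contraction of L^2\<close>

locale isotropic = proper_ultrametric_measure \<mu> + distance_distribution_function \<sigma>
  for \<mu> :: "'a::metric_space measure" and \<sigma>
begin

interpretation \<mu>: sigma_finite_measure \<mu> by (rule sigma_finite_\<mu>)
interpretation \<nu>: finite_measure \<nu> by (rule finite_\<nu>)
interpretation \<mu>\<mu>: pair_sigma_finite \<mu> \<mu> by (intro pair_sigma_finite.intro sigma_finite_\<mu>)
interpretation \<mu>\<nu>: pair_sigma_finite \<mu> \<nu> by (intro pair_sigma_finite.intro sigma_finite_\<mu> sigma_finite_\<nu>)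

text \<open>Written as an integral of a condition on \<open>dist\<close>, the measure depends
  measurably on centre and radius jointly, as the exchange of integrals requires.\<close>

lemma measure_cball_measurable:
  "(\<lambda>p. measure \<mu> (cball (fst p) (snd p))) \<in> borel_measurable (\<mu> \<Otimes>\<^sub>M \<nu>)"
proof -
  have "(\<lambda>p. LINT y|\<mu>. (if dist (fst p) y \<le> snd p then 1 else 0 :: real)) \<in> borel_measurable (\<mu> \<Otimes>\<^sub>M \<nu>)"
    by (rule \<mu>.borel_measurable_lebesgue_integral) measurable
  moreover have "(LINT y|\<mu>. (if dist x y \<le> r then 1 else 0 :: real)) = measure \<mu> (cball x r)" for x r
  proof -
    have "(LINT y|\<mu>. (if dist x y \<le> r then 1 else 0 :: real)) = (LINT y|\<mu>. indicator (cball x r) y)"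
      by (rule Bochner_Integration.integral_cong) (auto simp: indicator_def)
    then show ?thesis by simp
  qed
  ultimately show ?thesis by simp
qed

lemma ball_average_measurable:
  assumes [measurable]: "f \<in> borel_measurable \<mu>"
  shows "(\<lambda>p. ball_average \<mu> (snd p) f (fst p)) \<in> borel_measurable (\<mu> \<Otimes>\<^sub>M \<nu>)"
proof -
  have "(\<lambda>p. LINT y|\<mu>. (if dist (fst p) y \<le> snd p then f y else 0)) \<in> borel_measurable (\<mu> \<Otimes>\<^sub>M \<nu>)"
    by (rule \<mu>.borel_measurable_lebesgue_integral) measurable
  moreover have "(LINT y|\<mu>. (if dist x y \<le> r then f y else 0)) = (LINT y|\<mu>. indicator (cball x r) y *\<^sub>R f y)" for x r
    by (rule Bochner_Integration.integral_cong) (auto simp: indicator_def)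
  ultimately have [measurable]:
    "(\<lambda>p. LINT y|\<mu>. indicator (cball (fst p) (snd p)) y *\<^sub>R f y) \<in> borel_measurable (\<mu> \<Otimes>\<^sub>M \<nu>)" by simp
  note [measurable] = measure_cball_measurable
  show ?thesis unfolding ball_average_eq by measurable
qed

lemma ball_average_measurable_radius:
  assumes "f \<in> borel_measurable \<mu>"
  shows "(\<lambda>r. ball_average \<mu> r f x) \<in> borel_measurable \<nu>"
proof -
  have "(\<lambda>r. (x, r)) \<in> measurable \<nu> (\<mu> \<Otimes>\<^sub>M \<nu>)" by (rule measurable_Pair1') simp
  from measurable_compose[OF this ball_average_measurable[OF assms]] show ?thesis by simp
qed

lemma markov_operator_eq:
  "markov_operator \<mu> \<sigma> f x = (LINT r|\<nu>. indicator {0..} r *\<^sub>R ball_average \<mu> r f x)"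
  by (simp add: markov_operator_def set_lebesgue_integral_def)

lemma markov_operator_measurable:
  assumes "f \<in> borel_measurable \<mu>" shows "markov_operator \<mu> \<sigma> f \<in> borel_measurable \<mu>"
proof -
  note [measurable] = ball_average_measurable[OF assms]
  have "(\<lambda>x. LINT r|\<nu>. indicator {0..} r *\<^sub>R ball_average \<mu> r f x) \<in> borel_measurable \<mu>"
    by (rule \<nu>.borel_measurable_lebesgue_integral) (simp add: split_beta, measurable)
  then show ?thesis unfolding markov_operator_eq[abs_def] .
qed

text \<open>The averaging kernel is symmetric, because \<open>cball x r = cball y r\<close> whenever \<open>dist x y \<le> r\<close>.\<close>

lemma ball_average_contraction:
  assumes h[measurable]: "h \<in> borel_measurable \<mu>"
  shows "(\<integral>\<^sup>+x. \<integral>\<^sup>+y. ennreal (indicator (cball x r) y / measure \<mu> (cball x r)) * h y \<partial>\<mu> \<partial>\<mu>)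
    \<le> (\<integral>\<^sup>+y. h y \<partial>\<mu>)"
proof -
  have "(\<lambda>x. (x, r)) \<in> measurable \<mu> (\<mu> \<Otimes>\<^sub>M \<nu>)" by (rule measurable_Pair2') simp
  from measurable_compose[OF this measure_cball_measurable]
  have [measurable]: "(\<lambda>x. measure \<mu> (cball x r)) \<in> borel_measurable \<mu>" by simp
  have kernel: "ennreal (indicator (cball x r) y / measure \<mu> (cball x r))
      = ennreal (1 / measure \<mu> (cball y r)) * indicator (cball y r) x" for x y
  proof (cases "dist x y \<le> r")
    case True
    then have "0 \<le> r" by (rule order_trans[OF zero_le_dist])
    then show ?thesis using True cball_eq[OF True] by (simp add: dist_commute)
  next
    case False
    then show ?thesis by (simp add: dist_commute)
  qed
  have ind_eq: "indicator (cball y r) x = (if dist y x \<le> r then 1 else 0 :: ennreal)" for x y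
    by (simp add: indicator_def)
  have "(\<integral>\<^sup>+x. \<integral>\<^sup>+y. ennreal (indicator (cball x r) y / measure \<mu> (cball x r)) * h y \<partial>\<mu> \<partial>\<mu>)
      = (\<integral>\<^sup>+x. \<integral>\<^sup>+y. ennreal (1 / measure \<mu> (cball y r)) * indicator (cball y r) x * h y \<partial>\<mu> \<partial>\<mu>)"
    by (simp only: kernel)
  also have "\<dots> = (\<integral>\<^sup>+y. \<integral>\<^sup>+x. ennreal (1 / measure \<mu> (cball y r)) * indicator (cball y r) x * h y \<partial>\<mu> \<partial>\<mu>)"
    unfolding ind_eq by (rule \<mu>\<mu>.Fubini'[symmetric]) measurable
  also have "\<dots> \<le> (\<integral>\<^sup>+y. h y \<partial>\<mu>)"
  proof (rule nn_integral_mono)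
    fix y
    let ?m = "measure \<mu> (cball y r)"
    have [measurable]: "cball y r \<in> sets borel" by simp
    have "(\<integral>\<^sup>+x. ennreal (1 / ?m) * indicator (cball y r) x * h y \<partial>\<mu>)
        = (\<integral>\<^sup>+x. ennreal (1 / ?m) * indicator (cball y r) x \<partial>\<mu>) * h y"
      by (rule nn_integral_multc) measurable
    also have "(\<integral>\<^sup>+x. ennreal (1 / ?m) * indicator (cball y r) x \<partial>\<mu>) = ennreal (1 / ?m) * emeasure \<mu> (cball y r)"
      by (rule nn_integral_cmult_indicator) simp
    also have "\<dots> = ennreal (1 / ?m * ?m)" by (simp add: emeasure_cball flip: ennreal_mult)
    \<comment> \<open>Only an inequality, since \<open>1 / ?m * ?m\<close> is 0 for empty and null
      balls.\<close>
    also have "\<dots> * h y \<le> 1 * h y"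
      by (rule mult_right_mono) (auto simp: ennreal_le_1)
    finally show "(\<integral>\<^sup>+x. ennreal (1 / ?m) * indicator (cball y r) x * h y \<partial>\<mu>) \<le> h y" by simp
  qed
  finally show ?thesis .
qed

abbreviation total_average :: "('a \<Rightarrow> complex) \<Rightarrow> 'a \<Rightarrow> ennreal" where
  "total_average f \<equiv> \<lambda>x. \<integral>\<^sup>+r. ennreal (cmod (ball_average \<mu> r f x)) \<partial>\<nu>"

text \<open>Cauchy-Schwarz over the radii, whose total mass is at most 1, then Tonelli and the
  contraction at each fixed radius. Because the modulus stands inside the integral, the estimate
  also shows that the integral over the radii converges for almost every point.\<close>

lemma markov_bound:
  assumes f: "f \<in> l2 \<mu>"
  shows "(\<integral>\<^sup>+x. (total_average f x)\<^sup>2 \<partial>\<mu>) \<le> ennreal ((l2_norm \<mu> f)\<^sup>2)"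
proof -
  have fm[measurable]: "f \<in> borel_measurable \<mu>" using f by (rule l2_measurable)
  note [measurable] = ball_average_measurable[OF fm] ball_average_measurable_radius[OF fm]
  have "(total_average f x)\<^sup>2 \<le> (\<integral>\<^sup>+r. ennreal ((cmod (ball_average \<mu> r f x))\<^sup>2) \<partial>\<nu>)" for x
  proof -
    have "(\<integral>\<^sup>+r. ennreal (cmod (ball_average \<mu> r f x)) * 1 \<partial>\<nu>)\<^sup>2
        \<le> (\<integral>\<^sup>+r. (ennreal (cmod (ball_average \<mu> r f x)))\<^sup>2 \<partial>\<nu>) * (\<integral>\<^sup>+r. 1\<^sup>2 \<partial>\<nu>)"
      by (rule Cauchy_Schwarz_nn_integral) measurable
    also have "\<dots> \<le> (\<integral>\<^sup>+r. (ennreal (cmod (ball_average \<mu> r f x)))\<^sup>2 \<partial>\<nu>) * 1"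
      using emeasure_\<nu>_UNIV by (intro mult_left_mono) auto
    finally show ?thesis by (simp add: ennreal_power)
  qed
  then have "(\<integral>\<^sup>+x. (total_average f x)\<^sup>2 \<partial>\<mu>)
      \<le> (\<integral>\<^sup>+x. \<integral>\<^sup>+r. ennreal ((cmod (ball_average \<mu> r f x))\<^sup>2) \<partial>\<nu> \<partial>\<mu>)"
    by (rule nn_integral_mono)
  also have "\<dots> = (\<integral>\<^sup>+r. \<integral>\<^sup>+x. ennreal ((cmod (ball_average \<mu> r f x))\<^sup>2) \<partial>\<mu> \<partial>\<nu>)"
    by (rule \<mu>\<nu>.Fubini'[symmetric]) (simp add: split_beta, measurable)
  also have "\<dots> \<le> (\<integral>\<^sup>+r. ennreal ((l2_norm \<mu> f)\<^sup>2) \<partial>\<nu>)"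
  proof (rule nn_integral_mono)
    fix r
    have "(\<integral>\<^sup>+x. ennreal ((cmod (ball_average \<mu> r f x))\<^sup>2) \<partial>\<mu>)
        \<le> (\<integral>\<^sup>+x. \<integral>\<^sup>+y. ennreal (indicator (cball x r) y / measure \<mu> (cball x r)) * ennreal ((cmod (f y))\<^sup>2) \<partial>\<mu> \<partial>\<mu>)"
      by (intro nn_integral_mono ball_average_bound f)
    also have "\<dots> \<le> (\<integral>\<^sup>+y. ennreal ((cmod (f y))\<^sup>2) \<partial>\<mu>)"
      by (rule ball_average_contraction) measurable
    also have "\<dots> = ennreal ((l2_norm \<mu> f)\<^sup>2)" by (rule nn_integral_l2[OF f])
    finally show "(\<integral>\<^sup>+x. ennreal ((cmod (ball_average \<mu> r f x))\<^sup>2) \<partial>\<mu>) \<le> ennreal ((l2_norm \<mu> f)\<^sup>2)" .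
  qed
  also have "\<dots> = ennreal ((l2_norm \<mu> f)\<^sup>2) * emeasure \<nu> UNIV" by simp
  also have "\<dots> \<le> ennreal ((l2_norm \<mu> f)\<^sup>2) * 1" by (rule mult_left_mono[OF emeasure_\<nu>_UNIV]) simp
  finally show ?thesis by simp
qed

lemma AE_integrable_ball_average:
  assumes f: "f \<in> l2 \<mu>" shows "AE x in \<mu>. integrable \<nu> (\<lambda>r. ball_average \<mu> r f x)"
proof -
  have fm[measurable]: "f \<in> borel_measurable \<mu>" using f by (rule l2_measurable)
  note [measurable] = ball_average_measurable[OF fm]
  have "AE x in \<mu>. (total_average f x)\<^sup>2 \<noteq> \<infinity>"
  proof (rule nn_integral_PInf_AE)
    have "total_average f \<in> borel_measurable \<mu>"
      by (rule \<nu>.borel_measurable_nn_integral) (simp add: split_beta, measurable)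
    then show "(\<lambda>x. (total_average f x)\<^sup>2) \<in> borel_measurable \<mu>"
      by measurable
    have "(\<integral>\<^sup>+x. (total_average f x)\<^sup>2 \<partial>\<mu>) < \<infinity>"
      using markov_bound[OF f] by (rule le_less_trans) simp
    then show "(\<integral>\<^sup>+x. (total_average f x)\<^sup>2 \<partial>\<mu>) \<noteq> \<infinity>" by simp
  qed
  then show ?thesis
  proof (rule eventually_mono)
    fix x assume "(total_average f x)\<^sup>2 \<noteq> \<infinity>"
    then have "total_average f x < \<infinity>"
      by (auto simp: less_top power2_eq_square ennreal_mult_eq_top_iff)
    then show "integrable \<nu> (\<lambda>r. ball_average \<mu> r f x)"
      by (intro integrableI_bounded ball_average_measurable_radius[OF fm])
  qed
qed

lemma markov_operator_l2:
  assumes f: "f \<in> l2 \<mu>"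
  shows "markov_operator \<mu> \<sigma> f \<in> l2 \<mu>" and "l2_norm \<mu> (markov_operator \<mu> \<sigma> f) \<le> l2_norm \<mu> f"
proof -
  have fm: "f \<in> borel_measurable \<mu>" using f by (rule l2_measurable)
  have "(\<integral>\<^sup>+x. ennreal ((cmod (markov_operator \<mu> \<sigma> f x))\<^sup>2) \<partial>\<mu>)
      \<le> (\<integral>\<^sup>+x. (total_average f x)\<^sup>2 \<partial>\<mu>)"
  proof (rule nn_integral_mono_AE, rule eventually_mono[OF AE_integrable_ball_average[OF f]])
    fix x assume i: "integrable \<nu> (\<lambda>r. ball_average \<mu> r f x)"
    have "integrable \<nu> (\<lambda>r. indicator {0..} r *\<^sub>R ball_average \<mu> r f x)"
      by (rule integrable_mult_indicator[OF _ i]) simp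
    then have "ennreal (cmod (markov_operator \<mu> \<sigma> f x))
        \<le> (\<integral>\<^sup>+r. ennreal (cmod (indicator {0..} r *\<^sub>R ball_average \<mu> r f x)) \<partial>\<nu>)"
      unfolding markov_operator_eq by (rule integral_norm_bound_ennreal)
    also have "\<dots> \<le> total_average f x"
      by (rule nn_integral_mono) (simp add: indicator_def)
    finally have "(ennreal (cmod (markov_operator \<mu> \<sigma> f x)))\<^sup>2 \<le> (total_average f x)\<^sup>2"
      by (rule power_mono) simp
    then show "ennreal ((cmod (markov_operator \<mu> \<sigma> f x))\<^sup>2) \<le> (total_average f x)\<^sup>2"
      by (simp add: ennreal_power)
  qed
  also have "\<dots> \<le> ennreal ((l2_norm \<mu> f)\<^sup>2)" by (rule markov_bound[OF f])
  finally have b: "(\<integral>\<^sup>+x. ennreal ((cmod (markov_operator \<mu> \<sigma> f x))\<^sup>2) \<partial>\<mu>) \<le> ennreal ((l2_norm \<mu> f)\<^sup>2)" .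
  then have "(\<integral>\<^sup>+x. ennreal ((cmod (markov_operator \<mu> \<sigma> f x))\<^sup>2) \<partial>\<mu>) < \<infinity>" by (rule le_less_trans) simp
  then show l2: "markov_operator \<mu> \<sigma> f \<in> l2 \<mu>"
    unfolding l2_iff_nn_integral using markov_operator_measurable[OF fm] by simp
  have "(l2_norm \<mu> (markov_operator \<mu> \<sigma> f))\<^sup>2 \<le> (l2_norm \<mu> f)\<^sup>2"
    using b unfolding nn_integral_l2[OF l2] by (simp add: ennreal_le_iff)
  then show "l2_norm \<mu> (markov_operator \<mu> \<sigma> f) \<le> l2_norm \<mu> f" by (rule power2_le_imp_le) simp
qed

text \<open>Linearity is asserted almost everywhere because the integral over the radii may diverge
  on a null set, where it takes the default value 0.\<close>

lemma markov_operator_bounded: "bounded_operator \<mu> (markov_operator \<mu> \<sigma>)"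
  unfolding bounded_operator_def
proof (intro conjI ballI allI)
  fix f assume "f \<in> l2 \<mu>"
  then show "markov_operator \<mu> \<sigma> f \<in> l2 \<mu>" by (rule markov_operator_l2)
next
  fix f g a b assume f: "f \<in> l2 \<mu>" and g: "g \<in> l2 \<mu>"
  show "AE x in \<mu>. markov_operator \<mu> \<sigma> (\<lambda>y. a * f y + b * g y) x
      = a * markov_operator \<mu> \<sigma> f x + b * markov_operator \<mu> \<sigma> g x"
    using AE_integrable_ball_average[OF f] AE_integrable_ball_average[OF g]
  proof eventually_elim
    case (elim x)
    let ?f = "\<lambda>r. indicator {0..} r *\<^sub>R ball_average \<mu> r f x"
    let ?g = "\<lambda>r. indicator {0..} r *\<^sub>R ball_average \<mu> r g x"
    have i: "integrable \<nu> ?f" "integrable \<nu> ?g"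
      using elim by (auto intro!: integrable_mult_indicator)
    have "(LINT r|\<nu>. indicator {0..} r *\<^sub>R ball_average \<mu> r (\<lambda>y. a * f y + b * g y) x) = (LINT r|\<nu>. a * ?f r + b * ?g r)"
      by (simp add: ball_average_linear[OF f g] scaleR_add_right)
    also have "\<dots> = (LINT r|\<nu>. a * ?f r) + (LINT r|\<nu>. b * ?g r)"
      by (intro Bochner_Integration.integral_add integrable_mult_right i)
    also have "\<dots> = a * (LINT r|\<nu>. ?f r) + b * (LINT r|\<nu>. ?g r)"
      by (simp only: integral_mult_right_zero)
    finally show ?case unfolding markov_operator_eq .
  qed
next
  show "\<exists>K. \<forall>f\<in>l2 \<mu>. l2_norm \<mu> (markov_operator \<mu> \<sigma> f) \<le> K * l2_norm \<mu> f"
    using markov_operator_l2(2) by (intro exI[of _ 1]) simp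
qed

text \<open>A ball of radius below \<open>dist x0 y0\<close> lies in a region where \<open>f\<close>
  is constant. A ball of larger or equal radius either misses the support of \<open>f\<close> or
  contains it, and \<open>f\<close> has mean zero.\<close>

lemma ball_average_ball_space:
  fixes x0 y0 :: 'a
  assumes xy: "x0 \<noteq> y0" and f: "f \<in> ball_space \<mu> (cball x0 (dist x0 y0))" and r: "0 < r"
  shows "ball_average \<mu> r f x = (if r < dist x0 y0 then f x else 0)"
proof -
  let ?R = "dist x0 y0" let ?B = "cball x0 ?R"
  have inside: "ball_average \<mu> r f x = f x" if "r < ?R"
  proof -
    have "(LINT y|\<mu>. indicator (cball x r) y *\<^sub>R f y) = (LINT y|\<mu>. indicator (cball x r) y *\<^sub>R f x)"
    proof (rule Bochner_Integration.integral_cong[OF refl])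
      fix y
      show "indicator (cball x r) y *\<^sub>R f y = indicator (cball x r) y *\<^sub>R f x"
      proof (cases "y \<in> cball x r")
        case True
        then have "dist x y < ?R" using that by simp
        then show ?thesis using ball_space_locally_const[OF xy f, of x y] by simp
      qed simp
    qed
    also have "\<dots> = measure \<mu> (cball x r) *\<^sub>R f x"
      using emeasure_cball_finite[of x r] by (simp add: less_top)
    finally show ?thesis
      unfolding ball_average_eq using measure_cball_pos[OF r, of x] by simp
  qed
  have outside: "ball_average \<mu> r f x = 0" if "?R \<le> r"
  proof -
    have "(LINT y|\<mu>. indicator (cball x r) y *\<^sub>R f y) = 0"
    proof (cases "cball x r \<inter> ?B = {}")
      case True
      have "indicator (cball x r) y *\<^sub>R f y = 0" for y
      proof (cases "y \<in> cball x r")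
        case yr: True
        then have "y \<notin> ?B" using True by blast
        then show ?thesis using ball_space_support[OF xy f, of y] by simp
      qed simp
      then show ?thesis by (simp only: integral_zero)
    next
      case False
      then obtain p where p: "p \<in> cball x r" "p \<in> ?B" by blast
      have "cball x r = cball p r" "?B = cball p ?R" using p by (auto intro!: cball_eq)
      then have sub: "?B \<subseteq> cball x r" using that by auto
      have "indicator (cball x r) y *\<^sub>R f y = f y" for y
        using sub ball_space_support[OF xy f, of y] by (cases "y \<in> ?B") auto
      then show ?thesis by (simp only: ball_space_mean[OF xy f])
    qed
    then show ?thesis unfolding ball_average_eq by simp
  qed
  show ?thesis using inside outside by (cases "r < ?R") auto
qed

lemma integral_indicator_\<nu>:
  fixes c :: complex
  assumes A: "A \<in> sets borel"
  shows "(LINT r|\<nu>. indicator A r *\<^sub>R c) = measure \<nu> A *\<^sub>R c"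
proof -
  have "emeasure \<nu> A < \<infinity>"
    unfolding infinity_ennreal_def by (rule \<nu>.emeasure_finite[of A, unfolded infinity_ennreal_def less_top])
  then have "integrable \<nu> (indicator A :: real \<Rightarrow> real)"
    using A by (intro integrable_real_indicator) auto
  then have "(LINT r|\<nu>. indicator A r *\<^sub>R c) = (LINT r|\<nu>. indicator A r) *\<^sub>R c"
    by (intro integral_scaleR_left)
  then show ?thesis by simp
qed

lemma markov_operator_ball_space:
  fixes x0 y0 :: 'a
  assumes xy: "x0 \<noteq> y0" and f: "f \<in> ball_space \<mu> (cball x0 (dist x0 y0))"
  shows "markov_operator \<mu> \<sigma> f x = complex_of_real (\<sigma> (ennreal (dist x0 y0))) * f x"
proof -
  let ?R = "dist x0 y0"
  have fm: "f \<in> borel_measurable \<mu>" by (rule l2_measurable[OF ball_space_l2[OF xy f]])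
  note [measurable] = ball_average_measurable_radius[OF fm]
  have "markov_operator \<mu> \<sigma> f x = (LINT r|\<nu>. indicator {0<..<?R} r *\<^sub>R f x)"
    unfolding markov_operator_eq
  proof (rule integral_cong_AE)
    show "AE r in \<nu>. indicator {0..} r *\<^sub>R ball_average \<mu> r f x = indicator {0<..<?R} r *\<^sub>R f x"
      using AE_\<nu>_pos by (rule eventually_mono) (simp add: ball_average_ball_space[OF xy f])
  qed measurable
  also have "\<dots> = measure \<nu> {0<..<?R} *\<^sub>R f x"
    by (rule integral_indicator_\<nu>) simp
  also have "\<dots> = complex_of_real (\<sigma> (ennreal ?R)) * f x"
    using xy by (simp add: measure_\<nu>_Ioo scaleR_conv_of_real)
  finally show ?thesis .
qed

lemma markov_operator_const: "markov_operator \<mu> \<sigma> (\<lambda>_. c) x = c"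
proof -
  have avg: "ball_average \<mu> r (\<lambda>_. c) x = c" if "0 < r" for r
    unfolding ball_average_eq using emeasure_cball_finite[of x r] measure_cball_pos[OF that, of x]
    by (simp add: less_top)
  note [measurable] = ball_average_measurable_radius[of "\<lambda>_. c" x]
  have "markov_operator \<mu> \<sigma> (\<lambda>_. c) x = (LINT r|\<nu>. indicator {0<..} r *\<^sub>R c)"
    unfolding markov_operator_eq
  proof (rule integral_cong_AE)
    show "AE r in \<nu>. indicator {0..} r *\<^sub>R ball_average \<mu> r (\<lambda>_. c) x = indicator {0<..} r *\<^sub>R c"
      using AE_\<nu>_pos by (rule eventually_mono) (simp add: avg)
  qed measurable
  also have "\<dots> = measure \<nu> {0<..} *\<^sub>R c"
    by (rule integral_indicator_\<nu>) simp
  finally show ?thesis by (simp add: measure_\<nu>_Ioi)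
qed

end

section \<open>The spectrum of the isotropic Laplacian\<close>

context isotropic
begin

abbreviation laplacian :: "'a l2_operator" where
  "laplacian \<equiv> isotropic_laplacian \<mu> \<sigma>"

section \<open>Intrinsic distance and radii of balls\<close>

lemma inverse_intrinsic_dist:
  fixes x y :: 'a
  assumes "x \<noteq> y"
  shows "1 / intrinsic_dist \<sigma> x y = ln (1 / \<sigma> (ennreal (dist x y)))"
  using assms by (simp add: intrinsic_dist_def)

lemma ln_inverse_sigma_pos:
  assumes "0 < t" shows "0 < ln (1 / \<sigma> (ennreal t))"
  using sigma_pos[OF assms] sigma_less_1[of t] by (simp add: ln_gt_zero)

lemma intrinsic_dist_pos: "x \<noteq> y \<Longrightarrow> 0 < intrinsic_dist \<sigma> x y" for x y :: 'a
  using ln_inverse_sigma_pos[of "dist x y"] by (simp add: intrinsic_dist_def)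

lemma intrinsic_dist_nonneg: "0 \<le> intrinsic_dist \<sigma> x y" for x y :: 'a
  using intrinsic_dist_pos[of x y] by (cases "x = y") (auto simp: intrinsic_dist_def)

lemma intrinsic_dist_less:
  fixes x y x' y' :: 'a
  assumes less: "dist x y < dist x' y'"
  shows "intrinsic_dist \<sigma> x y < intrinsic_dist \<sigma> x' y'"
proof (cases "x = y")
  case True
  then have "x' \<noteq> y'" using less by auto
  then show ?thesis using True intrinsic_dist_pos[of x' y'] by (simp add: intrinsic_dist_def)
next
  case False
  then have ne: "x' \<noteq> y'" and p: "0 < dist x y" using less zero_le_dist[of x y] by auto
  have "\<sigma> (ennreal (dist x y)) < \<sigma> (ennreal (dist x' y'))"
    using less by (intro sigma_less ennreal_lessI) auto
  then have "1 / \<sigma> (ennreal (dist x' y')) < 1 / \<sigma> (ennreal (dist x y))"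
    using sigma_pos[OF p] by (intro divide_strict_left_mono) auto
  moreover have "0 < 1 / \<sigma> (ennreal (dist x' y'))" using ne sigma_pos[of "dist x' y'"] by simp
  ultimately have "ln (1 / \<sigma> (ennreal (dist x' y'))) < ln (1 / \<sigma> (ennreal (dist x y)))"
    by (rule ln_less_cancel_iff[THEN iffD2, rotated 2]) (use sigma_pos[OF p] in simp)
  then have "1 / ln (1 / \<sigma> (ennreal (dist x y))) < 1 / ln (1 / \<sigma> (ennreal (dist x' y')))"
    using ln_inverse_sigma_pos[of "dist x' y'"] ne ln_inverse_sigma_pos[OF p]
    by (intro divide_strict_left_mono) auto
  then show ?thesis using False ne by (simp only: intrinsic_dist_def if_False)
qed

text \<open>The intrinsic distance is a strictly increasing function of \<open>dist\<close>, hence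
  has the same balls.\<close>

lemma intrinsic_dist_le_iff:
  fixes x y x' y' :: 'a
  shows "intrinsic_dist \<sigma> x y \<le> intrinsic_dist \<sigma> x' y' \<longleftrightarrow> dist x y \<le> dist x' y'"
proof
  assume "dist x y \<le> dist x' y'"
  then consider "dist x y < dist x' y'" | "dist x y = dist x' y'" by linarith
  then show "intrinsic_dist \<sigma> x y \<le> intrinsic_dist \<sigma> x' y'"
  proof cases
    case 1 then show ?thesis using intrinsic_dist_less by (simp add: less_imp_le)
  next
    case 2
    then have "x = y \<longleftrightarrow> x' = y'" by (metis dist_eq_0_iff)
    with 2 show ?thesis by (simp add: intrinsic_dist_def)
  qed
next
  assume "intrinsic_dist \<sigma> x y \<le> intrinsic_dist \<sigma> x' y'"
  then show "dist x y \<le> dist x' y'" using intrinsic_dist_less[of x' y' x y] by linarith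
qed

text \<open>No smaller radius is possible because \<open>y\<close> itself belongs to the ball; so
  the \<open>LEAST\<close> is attained.\<close>

lemma intrinsic_radius_cball:
  fixes x y :: 'a
  shows "intrinsic_radius \<sigma> (cball x (dist x y)) = intrinsic_dist \<sigma> x y"
  unfolding intrinsic_radius_def
proof (rule Least_equality)
  show "0 \<le> intrinsic_dist \<sigma> x y \<and>
      (\<forall>z\<in>cball x (dist x y). cball x (dist x y) = {w. intrinsic_dist \<sigma> z w \<le> intrinsic_dist \<sigma> x y})"
  proof (intro conjI ballI intrinsic_dist_nonneg)
    fix z assume "z \<in> cball x (dist x y)"
    then have "cball x (dist x y) = cball z (dist x y)" by (intro cball_eq) simp
    also have "\<dots> = {w. intrinsic_dist \<sigma> z w \<le> intrinsic_dist \<sigma> x y}"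
      unfolding intrinsic_dist_le_iff cball_def ..
    finally show "cball x (dist x y) = {w. intrinsic_dist \<sigma> z w \<le> intrinsic_dist \<sigma> x y}" .
  qed
  fix r assume r: "0 \<le> r \<and> (\<forall>z\<in>cball x (dist x y). cball x (dist x y) = {w. intrinsic_dist \<sigma> z w \<le> r})"
  have eq: "cball x (dist x y) = {w. intrinsic_dist \<sigma> x w \<le> r}"
    by (rule bspec[OF conjunct2[OF r]]) simp
  have "y \<in> cball x (dist x y)" by simp
  then show "intrinsic_dist \<sigma> x y \<le> r" unfolding eq by simp
qed

definition positive_balls :: "'a set set" where
  "positive_balls = {B. is_ball B \<and> intrinsic_radius \<sigma> B > 0}"

lemma positive_ballsE:
  assumes "B \<in> positive_balls"
  obtains x y :: 'a where "x \<noteq> y" "B = cball x (dist x y)"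
proof -
  have B: "is_ball B" "intrinsic_radius \<sigma> B > 0" using assms by (auto simp: positive_balls_def)
  obtain x y where xy: "B = cball x (dist x y)" using is_ballE[OF B(1)] by blast
  have "x \<noteq> y" using B(2) unfolding xy intrinsic_radius_cball by (auto simp: intrinsic_dist_def)
  with xy show ?thesis using that by blast
qed

lemma positive_balls_cball: "x \<noteq> y \<Longrightarrow> cball x (dist x y) \<in> positive_balls" for x y :: 'a
  unfolding positive_balls_def using intrinsic_dist_pos[of x y] is_ball_cball[of "dist x y" x]
  by (simp add: intrinsic_radius_cball)

text \<open>The number \<open>\<sigma> (ennreal (dist x y))\<close>, expressed through the intrinsic
  radius so that it depends on the set \<open>B\<close> alone and not on the points representing
  it.\<close>

definition markov_eigenvalue :: "'a set \<Rightarrow> real" where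
  "markov_eigenvalue B = exp (- (1 / intrinsic_radius \<sigma> B))"

lemma markov_eigenvalue_cball:
  fixes x y :: 'a
  assumes "x \<noteq> y"
  shows "markov_eigenvalue (cball x (dist x y)) = \<sigma> (ennreal (dist x y))"
  unfolding markov_eigenvalue_def intrinsic_radius_cball inverse_intrinsic_dist[OF assms]
  using sigma_pos[of "dist x y"] assms by (simp add: ln_div)

lemma ln_markov_eigenvalue: "ln (1 / markov_eigenvalue B) = 1 / intrinsic_radius \<sigma> B"
  by (simp add: markov_eigenvalue_def ln_div)

lemma laplacian_eq:
  "laplacian = functional_calculus \<mu> (\<lambda>s. ln (1 / s)) (graph_of \<mu> (markov_operator \<mu> \<sigma>))"
  by (simp add: isotropic_laplacian_def)

lemma ln_inverse_measurable: "(\<lambda>s::real. ln (1 / s)) \<in> borel_measurable borel"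
  by measurable

section \<open>Ball spaces as eigenspaces and the two cases of total mass\<close>

lemma positive_balls_finite_dim:
  assumes "B \<in> positive_balls"
  shows "\<exists>G. finite G \<and> G \<subseteq> l2 \<mu> \<and> ball_space \<mu> B = lspan G"
proof -
  obtain x y where "x \<noteq> y" "B = cball x (dist x y)" using assms by (rule positive_ballsE)
  then show ?thesis using ball_space_finite_dim[of x y] by simp
qed

lemma positive_balls_nontrivial:
  assumes "B \<in> positive_balls" shows "\<exists>f\<in>ball_space \<mu> B. \<not> (AE w in \<mu>. f w = 0)"
proof -
  obtain x y where "x \<noteq> y" "B = cball x (dist x y)" using assms by (rule positive_ballsE)
  then show ?thesis using ball_space_nontrivial[of x y] by simp
qed

lemma positive_balls_orthogonal:
  assumes "B \<in> positive_balls" "B' \<in> positive_balls" "B \<noteq> B'" "f \<in> ball_space \<mu> B" "g \<in> ball_space \<mu> B'"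
  shows "l2_inner \<mu> f g = 0"
proof -
  obtain x y where xy: "x \<noteq> y" "B = cball x (dist x y)" using assms(1) by (rule positive_ballsE)
  obtain x' y' where xy': "x' \<noteq> y'" "B' = cball x' (dist x' y')" using assms(2) by (rule positive_ballsE)
  show ?thesis
    using assms(3,4,5) unfolding xy(2) xy'(2) by (rule ball_space_orthogonal[OF xy(1) xy'(1)])
qed

lemma positive_balls_eigen:
  assumes "B \<in> positive_balls" "f \<in> ball_space \<mu> B"
  shows "AE x in \<mu>. markov_operator \<mu> \<sigma> f x = complex_of_real (markov_eigenvalue B) * f x"
proof -
  obtain x y where xy: "x \<noteq> y" "B = cball x (dist x y)" using assms(1) by (rule positive_ballsE)
  show ?thesis
    using markov_operator_ball_space[OF xy(1)] assms(2)
    unfolding xy(2) markov_eigenvalue_cball[OF xy(1)] by simp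
qed

lemma positive_balls_mean:
  assumes "B \<in> positive_balls" "f \<in> ball_space \<mu> B" shows "(LINT w|\<mu>. f w) = 0"
proof -
  obtain x y where xy: "x \<noteq> y" "B = cball x (dist x y)" using assms(1) by (rule positive_ballsE)
  show ?thesis using assms(2) unfolding xy(2) by (rule ball_space_mean[OF xy(1)])
qed

lemma intrinsic_radii:
  "(\<lambda>B. 1 / intrinsic_radius \<sigma> B) ` positive_balls = {1 / r | r. r \<in> {intrinsic_dist \<sigma> x y | x y :: 'a. x \<noteq> y}}"
proof (intro equalityI subsetI)
  fix t assume "t \<in> (\<lambda>B. 1 / intrinsic_radius \<sigma> B) ` positive_balls"
  then obtain B where B: "B \<in> positive_balls" "t = 1 / intrinsic_radius \<sigma> B" by blast
  obtain x y where xy: "x \<noteq> y" "B = cball x (dist x y)" using B(1) by (rule positive_ballsE)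
  have "t = 1 / intrinsic_dist \<sigma> x y" using B(2) unfolding xy(2) intrinsic_radius_cball .
  then show "t \<in> {1 / r | r. r \<in> {intrinsic_dist \<sigma> x y | x y :: 'a. x \<noteq> y}}"
    using xy(1) by blast
next
  fix t assume "t \<in> {1 / r | r. r \<in> {intrinsic_dist \<sigma> x y | x y :: 'a. x \<noteq> y}}"
  then obtain x y :: 'a where xy: "x \<noteq> y" "t = 1 / intrinsic_dist \<sigma> x y" by blast
  then show "t \<in> (\<lambda>B. 1 / intrinsic_radius \<sigma> B) ` positive_balls"
    using positive_balls_cball[OF xy(1)] by (intro image_eqI[of _ _ "cball x (dist x y)"]) (simp_all add: intrinsic_radius_cball)
qed

lemma zero_in_closure:
  assumes inf: "emeasure \<mu> UNIV = \<infinity>"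
  shows "0 \<in> closure {1 / r | r. r \<in> {intrinsic_dist \<sigma> x y | x y :: 'a. x \<noteq> y}}"
  unfolding closure_approachable
proof (intro allI impI)
  fix e :: real assume e: "0 < e"
  fix x0 :: 'a
  have "(\<lambda>n. \<sigma> (of_nat n)) \<longlonglongrightarrow> \<sigma> top"
    by (rule sigma_tendsto_from_below[OF of_nat_tendsto_top_ennreal of_nat_less_top])
  \<comment> \<open>The threshold \<open>exp (- e)\<close> is the value of \<sigma> beyond which the
    logarithm of its reciprocal drops below \<open>e\<close>.\<close>
  then have "\<forall>\<^sub>F n in sequentially. exp (- e) < \<sigma> (of_nat n)"
    by (rule order_tendstoD) (use e in \<open>simp add: sigma_top\<close>)
  then obtain n where n: "exp (- e) < \<sigma> (of_nat n)" by (auto simp: eventually_sequentially)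
  have "\<exists>y. real n < dist x0 y"
  proof (rule ccontr)
    assume "\<nexists>y. real n < dist x0 y"
    then have "cball x0 (real n) = UNIV" by (auto simp: not_less)
    then show False using emeasure_cball_finite[of x0 "real n"] inf by simp
  qed
  then obtain y where y: "real n < dist x0 y" by blast
  then have xy: "x0 \<noteq> y" by auto
  have "of_nat n \<le> ennreal (dist x0 y)"
    using y by (simp add: ennreal_of_nat_eq_real_of_nat ennreal_leI)
  then have s: "exp (- e) < \<sigma> (ennreal (dist x0 y))" using n sigma_mono less_le_trans by blast
  then have "ln (exp (- e)) < ln (\<sigma> (ennreal (dist x0 y)))"
    by (intro ln_less_cancel_iff[THEN iffD2]) (auto intro: less_trans[OF exp_gt_zero])
  then have "ln (1 / \<sigma> (ennreal (dist x0 y))) < e"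
    using sigma_pos[of "dist x0 y"] xy by (simp add: ln_div)
  then have "1 / intrinsic_dist \<sigma> x0 y < e" by (simp only: inverse_intrinsic_dist[OF xy])
  moreover have "0 < 1 / intrinsic_dist \<sigma> x0 y" using intrinsic_dist_pos[OF xy] by simp
  ultimately have "dist (1 / intrinsic_dist \<sigma> x0 y) 0 < e" by simp
  moreover have "1 / intrinsic_dist \<sigma> x0 y \<in> {1 / r | r. r \<in> {intrinsic_dist \<sigma> x y | x y :: 'a. x \<noteq> y}}"
    using xy by blast
  ultimately show "\<exists>t\<in>{1 / r | r. r \<in> {intrinsic_dist \<sigma> x y | x y :: 'a. x \<noteq> y}}. dist t 0 < e" by (rule bexI)
qed

lemma eigenspaces_infinite:
  assumes inf: "emeasure \<mu> UNIV = \<infinity>"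
  shows "l2_eigenspaces \<mu> positive_balls (ball_space \<mu>) (markov_operator \<mu> \<sigma>) markov_eigenvalue"
proof
  show "bounded_operator \<mu> (markov_operator \<mu> \<sigma>)" by (rule markov_operator_bounded)
  fix f assume f: "f \<in> l2 \<mu>"
    and z: "\<And>B h. B \<in> positive_balls \<Longrightarrow> h \<in> ball_space \<mu> B \<Longrightarrow> l2_inner \<mu> f h = 0"
  show "AE x in \<mu>. f x = 0"
    by (rule complete_infinite[OF inf f]) (rule z[OF positive_balls_cball])
qed (erule positive_balls_finite_dim positive_balls_nontrivial
      | rule positive_balls_orthogonal positive_balls_eigen; assumption)+

abbreviation constants :: "('a \<Rightarrow> complex) set" where
  "constants \<equiv> range (\<lambda>c _. c)"

lemma constants_eq_lspan: "constants = lspan {\<lambda>_. 1}"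
  by (subst lspan_finite) auto

text \<open>\<open>None\<close> is the index of the constants, with Markov eigenvalue 1. They are
  orthogonal to every ball space because its elements have mean zero.\<close>

lemma eigenspaces_finite:
  assumes fin: "emeasure \<mu> UNIV < \<infinity>"
  shows "l2_eigenspaces \<mu> (insert None (Some ` positive_balls)) (case_option constants (ball_space \<mu>))
    (markov_operator \<mu> \<sigma>) (case_option 1 markov_eigenvalue)"
proof
  show "bounded_operator \<mu> (markov_operator \<mu> \<sigma>)" by (rule markov_operator_bounded)
  let ?I = "insert None (Some ` positive_balls)" and ?H = "case_option constants (ball_space \<mu>)"
  have one: "(\<lambda>_. 1) \<in> l2 \<mu>" by (rule const_l2[OF fin])
  show "\<exists>G. finite G \<and> G \<subseteq> l2 \<mu> \<and> ?H i = lspan G" if "i \<in> ?I" for i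
  proof (cases i)
    case None
    then show ?thesis using one by (intro exI[of _ "{\<lambda>_. 1}"]) (simp add: constants_eq_lspan)
  next
    case (Some B)
    then show ?thesis using that positive_balls_finite_dim[of B] by auto
  qed
  have const_orth: "l2_inner \<mu> h (\<lambda>_. c) = 0" if "B \<in> positive_balls" "h \<in> ball_space \<mu> B" for B h c
    unfolding l2_inner_def using positive_balls_mean[OF that] by simp
  show "l2_inner \<mu> f g = 0" if ij: "i \<in> ?I" "j \<in> ?I" "i \<noteq> j" and fg: "f \<in> ?H i" "g \<in> ?H j" for i j f g
  proof (cases i)
    case None
    then obtain B where B: "j = Some B" "B \<in> positive_balls" using ij by auto
    obtain c where c: "f = (\<lambda>_. c)" using fg(1) None by auto
    show ?thesis using const_orth[OF B(2), of g c] fg(2) B(1)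
      unfolding c by (subst l2_inner_cnj) simp
  next
    case i: (Some B)
    then have B: "B \<in> positive_balls" using ij by auto
    show ?thesis
    proof (cases j)
      case None
      then obtain c where c: "g = (\<lambda>_. c)" using fg(2) by auto
      show ?thesis unfolding c by (rule const_orth[OF B]) (use fg(1) i in simp)
    next
      case j: (Some B')
      show ?thesis by (rule positive_balls_orthogonal[of B B']) (use ij fg i j in auto)
    qed
  qed
  show "\<exists>f\<in>?H i. \<not> (AE x in \<mu>. f x = 0)" if "i \<in> ?I" for i
  proof (cases i)
    case None
    have "\<not> (AE x in \<mu>. (1::complex) = 0)"
    proof
      assume "AE x in \<mu>. (1::complex) = 0"
      then have "emeasure \<mu> UNIV = 0" by (subst (asm) AE_iff_measurable[of UNIV]) auto
      moreover have "0 < emeasure \<mu> UNIV" using support by (auto simp: full_support_def)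
      ultimately show False by simp
    qed
    then show ?thesis using None by (intro bexI[of _ "\<lambda>_. 1"]) auto
  next
    case (Some B)
    then show ?thesis using that positive_balls_nontrivial[of B] by auto
  qed
  show "AE x in \<mu>. markov_operator \<mu> \<sigma> f x = complex_of_real (case_option 1 markov_eigenvalue i) * f x"
    if i: "i \<in> ?I" and fi: "f \<in> ?H i" for i f
  proof (cases i)
    case None
    then obtain c where "f = (\<lambda>_. c)" using fi by auto
    then show ?thesis using None by (simp add: markov_operator_const)
  next
    case (Some B)
    then show ?thesis using i fi positive_balls_eigen[of B f] by auto
  qed
  fix f assume f: "f \<in> l2 \<mu>" and z: "\<And>i h. i \<in> ?I \<Longrightarrow> h \<in> ?H i \<Longrightarrow> l2_inner \<mu> f h = 0"
  show "AE x in \<mu>. f x = 0"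
  proof (rule complete_finite[OF fin f])
    show "l2_inner \<mu> f (\<lambda>_. 1) = 0" by (rule z[of None]) auto
    fix x y :: 'a and h assume "x \<noteq> y" "h \<in> ball_space \<mu> (cball x (dist x y))"
    then show "l2_inner \<mu> f h = 0"
      using positive_balls_cball[of x y] by (intro z[of "Some (cball x (dist x y))"]) auto
  qed
qed

lemma laplacian_infinite:
  assumes inf: "emeasure \<mu> UNIV = \<infinity>"
  shows "pure_point_spectrum \<mu> laplacian"
    and "spectrum \<mu> laplacian = complex_of_real `
      (closure {1 / r | r. r \<in> {intrinsic_dist \<sigma> x y | x y :: 'a. x \<noteq> y}} \<union> {0})"
    and "B \<in> positive_balls \<Longrightarrow> ball_space \<mu> B \<subseteq>
      eigenspace \<mu> laplacian (complex_of_real (1 / intrinsic_radius \<sigma> B))"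
    and "orthogonal_sum_decomposition \<mu> positive_balls (ball_space \<mu>)"
proof -
  interpret l2_eigenspaces \<mu> positive_balls "ball_space \<mu>" "markov_operator \<mu> \<sigma>" markov_eigenvalue
    by (rule eigenspaces_infinite[OF inf])
  show "pure_point_spectrum \<mu> laplacian"
    unfolding laplacian_eq by (rule pure_point_spectrum_calculus[OF ln_inverse_measurable])
  show "spectrum \<mu> laplacian = complex_of_real `
      (closure {1 / r | r. r \<in> {intrinsic_dist \<sigma> x y | x y :: 'a. x \<noteq> y}} \<union> {0})"
    unfolding laplacian_eq spectrum_calculus[OF ln_inverse_measurable] ln_markov_eigenvalue intrinsic_radii
    using zero_in_closure[OF inf] by (simp only: insert_absorb Un_insert_right Un_empty_right)
  show "ball_space \<mu> B \<subseteq> eigenspace \<mu> laplacian (complex_of_real (1 / intrinsic_radius \<sigma> B))"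
    if "B \<in> positive_balls"
    using eigenspace_calculus[OF ln_inverse_measurable that] unfolding laplacian_eq ln_markov_eigenvalue .
  show "orthogonal_sum_decomposition \<mu> positive_balls (ball_space \<mu>)" by (rule decomposition)
qed

lemma laplacian_finite:
  assumes fin: "emeasure \<mu> UNIV < \<infinity>"
  shows "pure_point_spectrum \<mu> laplacian"
    and "spectrum \<mu> laplacian = complex_of_real `
      (closure {1 / r | r. r \<in> {intrinsic_dist \<sigma> x y | x y :: 'a. x \<noteq> y}} \<union> {0})"
    and "B \<in> positive_balls \<Longrightarrow> ball_space \<mu> B \<subseteq>
      eigenspace \<mu> laplacian (complex_of_real (1 / intrinsic_radius \<sigma> B))"
    and "constants \<subseteq> eigenspace \<mu> laplacian 0"
    and "orthogonal_sum_decomposition \<mu> (insert None (Some ` positive_balls)) (case_option constants (ball_space \<mu>))"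
proof -
  interpret l2_eigenspaces \<mu> "insert None (Some ` positive_balls)" "case_option constants (ball_space \<mu>)"
    "markov_operator \<mu> \<sigma>" "case_option 1 markov_eigenvalue"
    by (rule eigenspaces_finite[OF fin])
  show "pure_point_spectrum \<mu> laplacian"
    unfolding laplacian_eq by (rule pure_point_spectrum_calculus[OF ln_inverse_measurable])
  \<comment> \<open>The index \<open>None\<close> contributes \<open>ln (1 / 1) = 0\<close>, an
    isolated point of the spectrum if the intrinsic distances are bounded; hence \<open>0\<close> is
    inserted before taking the closure.\<close>
  have "(\<lambda>i. ln (1 / case_option 1 markov_eigenvalue i)) ` insert None (Some ` positive_balls)
      = insert 0 ((\<lambda>B. 1 / intrinsic_radius \<sigma> B) ` positive_balls)"
    by (simp add: image_image ln_markov_eigenvalue)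
  then show "spectrum \<mu> laplacian = complex_of_real `
      (closure {1 / r | r. r \<in> {intrinsic_dist \<sigma> x y | x y :: 'a. x \<noteq> y}} \<union> {0})"
    unfolding laplacian_eq spectrum_calculus[OF ln_inverse_measurable]
    by (simp only: intrinsic_radii closure_insert Un_insert_right Un_empty_right)
  show "ball_space \<mu> B \<subseteq> eigenspace \<mu> laplacian (complex_of_real (1 / intrinsic_radius \<sigma> B))"
    if "B \<in> positive_balls"
    using eigenspace_calculus[OF ln_inverse_measurable, of "Some B"] that
    unfolding laplacian_eq by (simp only: option.case ln_markov_eigenvalue insert_iff imageI simp_thms)
  show "constants \<subseteq> eigenspace \<mu> laplacian 0"
    using eigenspace_calculus[OF ln_inverse_measurable, of None] unfolding laplacian_eq by simp
  show "orthogonal_sum_decomposition \<mu> (insert None (Some ` positive_balls)) (case_option constants (ball_space \<mu>))"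
    by (rule decomposition)
qed

end

theorem corollary3p9:
  fixes \<mu> :: "'a::metric_space measure"
    and \<sigma> :: "ennreal \<Rightarrow> real"
  assumes ultra: "\<And>x y z :: 'a. dist x z \<le> max (dist x y) (dist y z)"
    and separable: "\<exists>D :: 'a set. countable D \<and> closure D = UNIV"
    and proper: "\<And>(x :: 'a) r. compact (cball x r)"
    and radon: "radon_measure \<mu>"
    and support: "full_support \<mu>"
    and sigma: "distance_distribution \<sigma>"
  defines "L \<equiv> isotropic_laplacian \<mu> \<sigma>"
    and "\<Lambda> \<equiv> {intrinsic_dist \<sigma> x y | x y :: 'a. x \<noteq> y}"
    and "\<B> \<equiv> {B :: 'a set. is_ball B \<and> intrinsic_radius \<sigma> B > 0}"
    and "Const \<equiv> range (\<lambda>(c :: complex) (_ :: 'a). c)"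
  shows "pure_point_spectrum \<mu> L \<and>
    spectrum \<mu> L = complex_of_real ` (closure {1 / r | r. r \<in> \<Lambda>} \<union> {0}) \<and>
    (\<forall>B\<in>\<B>. finite_dimensional (ball_space \<mu> B) \<and>
       ball_space \<mu> B \<subseteq> eigenspace \<mu> L (complex_of_real (1 / intrinsic_radius \<sigma> B))) \<and>
    (emeasure \<mu> UNIV = \<infinity> \<longrightarrow>
       orthogonal_sum_decomposition \<mu> \<B> (ball_space \<mu>)) \<and>
    (emeasure \<mu> UNIV < \<infinity> \<longrightarrow>
       finite_dimensional Const \<and> Const \<subseteq> eigenspace \<mu> L 0 \<and>
       orthogonal_sum_decomposition \<mu> (insert None (Some ` \<B>))
         (case_option Const (ball_space \<mu>)))"
proof -
  interpret isotropic \<mu> \<sigma>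
    by (intro isotropic.intro proper_ultrametric_measure.intro distance_distribution_function.intro assms)
  have \<B>: "\<B> = positive_balls" by (simp add: \<B>_def positive_balls_def)
  have fd: "finite_dimensional (ball_space \<mu> B)" if "B \<in> positive_balls" for B
    using positive_balls_finite_dim[OF that] by (auto simp: finite_dimensional_def)
  have fdc: "finite_dimensional Const"
    unfolding Const_def finite_dimensional_def constants_eq_lspan by blast
  show ?thesis
  proof (cases "emeasure \<mu> UNIV = \<infinity>")
    case True
    show ?thesis
      unfolding \<B> L_def \<Lambda>_def
      using True fd laplacian_infinite[OF True] by simp
  next
    case False
    then have fin: "emeasure \<mu> UNIV < \<infinity>" by (simp add: less_top)
    show ?thesis
      unfolding \<B> L_def \<Lambda>_def
      using False fd fdc laplacian_finite[OF fin] unfolding Const_def by simp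
  qed
qed

end
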